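(* Let $\mathcal{H}$ be a separable real Hilbert space (finite- or infinite-dimensional), and let $P$ and $Q$ be Borel probability measures on $\mathcal{H}$. (i) If $\|F_P^{\mathrm{g}}(x)\|=\|F_Q^{\mathrm{g}}(x)\|$ for all $x\in\mathcal{H}$, then $P=Q$. (ii) If $\|F_P^{\mathrm{g}}(x)\|=\|F_Q^{\mathrm{g}}(x)\|$ for all $x$ in a dense subset $\mathcal{D}\subset\mathcal{H}$ and $\dim\mathcal{H}\ge 2$, then $P\neq Q$ only if there exist distinct $m_P,m_Q\in\mathcal{H}$ and $\beta\in(1/2,1]$ such that $$P=\beta\,\delta_{m_P}+(1-\beta)\,\delta_{m_Q}\quad\text{and}\quad Q=(1-\beta)\,\delta_{m_P}+\beta\,\delta_{m_Q},$$ where $\delta_x$ denotes the Dirac probability measure at $x$. (iii) If $\|F_P^{\mathrm{g}}(x)\|=\|F_Q^{\mathrm{g}}(x)\|$ for all $x$ in a dense subset $\mathcal{D}\subset\mathcal{H}$ and $\dim\mathcal{H}=1$, then $P\neq Q$ only if $P$ and $Q$ have unique medians $m_P$ and $m_Q$ (respectively), $P$ and $Q$ coincide on the Borel subsets of $\mathcal{H}\setminus\{m_P,m_Q\}$, they give no mass to the open interval joining $m_P$ and $m_Q$, and $P[\{m_P\}]>0$ and $Q[\{m_Q\}]>0$.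
   Context: For a Borel probability measure $P$ on $\mathcal{H}$ (with inner product $\langle\cdot,\cdot\rangle$ and norm $\|\cdot\|$), the spatial distribution function of $P$ is the map $$F_P^{\mathrm{g}}:\mathcal{H}\to\{x\in\mathcal{H}:\|x\|\le 1\},\qquad F_P^{\mathrm{g}}(x)=\int_{\mathcal{H}\setminus\{x\}}\frac{x-z}{\|x-z\|}\,dP(z),$$ where the $\mathcal{H}$-valued integral is defined (uniquely) through the Riesz representation theorem, i.e. $\langle F_P^{\mathrm{g}}(x),v\rangle=\int_{\mathcal{H}\setminus\{x\}}\frac{\langle x-z,v\rangle}{\|x-z\|}\,dP(z)$ for all $v\in\mathcal{H}$. The spatial depth of $x$ with respect to $P$ is $1-\|F_P^{\mathrm{g}}(x)\|$. A (spatial) median of $P$ is a global minimizer over $\mathcal{H}$ of $h_P(x)=\int_{\mathcal{H}}\{\|x-z\|-\|z\|\}\,dP(z)$; when $\dim\mathcal{H}=1$ this is the usual notion of univariate median. *)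

theory Defs
  imports "HOL-Probability.Probability" "HOL-Library.Extended_Nat"
begin

text \<open>
  A separable real Hilbert space is a type of sort \<open>{real_inner, banach, polish_space}\<close>. The
  class \<open>polish_space\<close> asks for completeness and second countability, and for a metric
  space the latter is the same as separability; \<open>banach\<close> adds no further axiom, but it is not
  inferred from the other two. The dimension is arbitrary, and the zero space is allowed.
\<close>

text \<open>The library's \<open>dim\<close> is 0 on infinite-dimensional spaces, hence the extended value.\<close>

definition space_dim :: "'a::real_vector itself \<Rightarrow> enat" where
  "space_dim _ =
     (if \<exists>B::'a set. finite B \<and> span B = UNIV then enat (dim (UNIV :: 'a set)) else \<infinity>)"

definition borel_prob :: "'a::topological_space measure \<Rightarrow> bool" where
  "borel_prob P \<longleftrightarrow> prob_space P \<and> sets P = sets borel"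

text \<open>
  The vector-valued integral is the Riesz representer of the scalar integrals; it exists and is
  unique by \<open>spatial_df_inner\<close> and \<open>spatial_df_unique\<close> below.
\<close>

definition spatial_df :: "'a::{real_inner, banach, polish_space} measure \<Rightarrow> 'a \<Rightarrow> 'a" where
  "spatial_df P x =
     (THE y. \<forall>v. inner y v = (LINT z:UNIV - {x}|P. inner (x - z) v / norm (x - z)))"

definition spatial_objective :: "'a::{real_inner, banach, polish_space} measure \<Rightarrow> 'a \<Rightarrow> real" where
  "spatial_objective P x = (LINT z|P. norm (x - z) - norm z)"

definition spatial_median :: "'a::{real_inner, banach, polish_space} measure \<Rightarrow> 'a \<Rightarrow> bool" where
  "spatial_median P m \<longleftrightarrow> (\<forall>x. spatial_objective P m \<le> spatial_objective P x)"

lemma spatial_df_ex1: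
  fixes P :: "'a::{real_inner, banach, polish_space} measure"
  assumes "borel_prob P"
  shows "\<exists>!y. \<forall>v. inner y v = (LINT z:UNIV - {x}|P. inner (x - z) v / norm (x - z))"
proof -
  interpret prob_space P using assms by (simp add: borel_prob_def)
  have [measurable_cong, simp]: "sets P = sets borel"
    using assms by (simp add: borel_prob_def)
  define f where "f z = indicator (UNIV - {x}) z *\<^sub>R sgn (x - z)" for z
  have "f \<in> borel_measurable P"
    unfolding f_def sgn_div_norm by measurable
  then have f: "integrable P f"
    by (intro integrable_const_bound[where B = 1])
       (auto simp: f_def norm_sgn indicator_def)
  have *: "inner (integral\<^sup>L P f) v = (LINT z:UNIV - {x}|P. inner (x - z) v / norm (x - z))" for v
  proof -
    have "inner (integral\<^sup>L P f) v = (LINT z|P. inner (f z) v)"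
      using f by (simp add: integral_inner_left)
    also have "\<dots> = (LINT z:UNIV - {x}|P. inner (x - z) v / norm (x - z))"
      unfolding set_lebesgue_integral_def
      by (intro Bochner_Integration.integral_cong)
         (auto simp: f_def sgn_div_norm divide_inverse mult_ac)
    finally show ?thesis .
  qed
  show ?thesis
  proof (rule ex1I[of _ "integral\<^sup>L P f"])
    fix y assume "\<forall>v. inner y v = (LINT z:UNIV - {x}|P. inner (x - z) v / norm (x - z))"
    then have "\<forall>v. inner y v = inner (integral\<^sup>L P f) v" using * by simp
    then show "y = integral\<^sup>L P f"
      by (metis inner_commute vector_eq_rdot)
  qed (use * in simp)
qed

lemma spatial_df_inner:
  assumes "borel_prob P"
  shows "inner (spatial_df P x) v = (LINT z:UNIV - {x}|P. inner (x - z) v / norm (x - z))"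
  using theI'[OF spatial_df_ex1[OF assms, of x]] unfolding spatial_df_def by blast

lemma spatial_df_unique:
  assumes "borel_prob P"
    and "\<And>v. inner y v = (LINT z:UNIV - {x}|P. inner (x - z) v / norm (x - z))"
  shows "spatial_df P x = y"
  using spatial_df_ex1[OF assms(1), of x] spatial_df_inner[OF assms(1), of x] assms(2) by blast

end

(*
The objective h_P is convex with subdifferential F_P(x) + P{x} B at x, B the closed unit ball, and
near x the map F_P approaches F_P(x) + P{x} v in the direction v. Equality of the norms of F_P and
F_Q on a dense set thus gives ||F_P(x) + P{x} v|| = ||F_Q(x) + Q{x} v|| for all x and all unit v.
So each x is either regular, with ||F_P(x)|| = ||F_Q(x)|| and P{x} = Q{x}, or exceptional, with these
two numbers exchanged between P and Q.

If all points are regular, h_P and h_Q have minimal subgradients of equal norm, and comparing them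
along implicit Euler steps of the gradient flow of h_P shows that they differ by a constant.
An exceptional point minimizes h_P + h_Q, and h_P - h_Q is invariant under the gradient flow of
h_P + h_Q, since the gradients of the sum and the difference are orthogonal. If the minimizer is
unique, h_P - h_Q is therefore constant again; otherwise P and Q live on a line. That h_P determines P
up to a constant follows from the positive definiteness of the Gaussian kernel, because the norm is
a mixture of functions 1 - exp (- s^2 ||x||^2).

On a line, equality of |2 F - 1| for the two cumulative distribution functions forces P and Q
to differ by alpha (delta_mP - delta_mQ), with no mass between mP and mQ. If there is a direction
orthogonal to the line, evaluating at points slightly above mP and mQ compares the masses to the
left and to the right of the segment with strictly smaller quantities, so both vanish.
*)
theory Submission
  imports Defs
begin

text \<open>The two flow arguments are not interchangeable. Comparing h_P with h_Q along the flow of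
  h_P needs slopes of equal norm at every point visited, which fails at exceptional points. Along
  the flow of the sum an exceptional point can only be a minimizer, where the flow stops. Equality
  of the norms at every point, and not just on a dense set, rules out exceptional points: equal
  norms at x force equal masses there. Without compactness and differentiability, flows are replaced
  by proximal steps of length \<tau>. Each step only minimizes a strongly convex function, its error
  is at most a multiple of \<tau> times a drop of the slope or of its square, so the total error
  telescopes to O(\<tau>), and \<tau> is arbitrary. The regular case compares infima; the
  exceptional case needs norm convergence to the minimizer, which the growth of the sum around its
  atom provides. Probability measures may lack moments, so norms are only ever integrated as
  differences. Gaussian features work in every dimension: energies become limits of sums of
  squares.\<close>

section \<open>Gaussian kernels on separable Hilbert spaces\<close>

text \<open>
  A Parseval sequence: an orthonormal basis padded by zeros, so that finite-dimensional spaces need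
  no separate treatment.
\<close>

fun gram_schmidt_seq :: "(nat \<Rightarrow> 'a::real_inner) \<Rightarrow> nat \<Rightarrow> 'a" where
  "gram_schmidt_seq d n =
     sgn (d n - (\<Sum>i\<in>set [0..<n]. inner (d n) (gram_schmidt_seq d i) *\<^sub>R gram_schmidt_seq d i))"

declare gram_schmidt_seq.simps [simp del]

lemma gram_schmidt_seq_norm: "inner (gram_schmidt_seq d n) (gram_schmidt_seq d n) = 1 \<or> gram_schmidt_seq d n = 0"
  by (subst gram_schmidt_seq.simps, subst (1) gram_schmidt_seq.simps, subst (1) gram_schmidt_seq.simps)
    (simp add: norm_sgn flip: power2_norm_eq_inner)

lemma gram_schmidt_seq_orth:
  "i < n \<Longrightarrow> inner (gram_schmidt_seq d n) (gram_schmidt_seq d i) = 0"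
proof (induction n arbitrary: i rule: less_induct)
  case (less n)
  let ?e = "gram_schmidt_seq d"
  have "(\<Sum>j\<in>set [0..<n]. inner (d n) (?e j) * inner (?e j) (?e i))
      = (\<Sum>j\<in>set [0..<n]. if j = i then inner (d n) (?e i) else 0)"
  proof (intro sum.cong refl)
    fix j assume j: "j \<in> set [0..<n]"
    consider "j = i" | "j < i" | "i < j" by linarith
    then show "inner (d n) (?e j) * inner (?e j) (?e i) = (if j = i then inner (d n) (?e i) else 0)"
    proof cases
      \<comment> \<open>If \<open>?e i\<close> is the zero vector, both sides vanish; otherwise its
        square is 1.\<close>
      case 1 then show ?thesis using gram_schmidt_seq_norm[of d i] by auto
    next
      case 2 then show ?thesis using less.IH[of i j] less.prems by (simp add: inner_commute)
    next
      case 3 then show ?thesis using less.IH[of j i] j by simp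
    qed
  qed
  also have "\<dots> = inner (d n) (?e i)" using less.prems by simp
  finally have "inner (d n - (\<Sum>j\<in>set [0..<n]. inner (d n) (?e j) *\<^sub>R ?e j)) (?e i) = 0"
    by (simp add: inner_diff_left inner_sum_left)
  then show ?case by (subst gram_schmidt_seq.simps) (simp add: sgn_div_norm)
qed

lemma gram_schmidt_seq_inner:
  "inner (gram_schmidt_seq d i) (gram_schmidt_seq d j)
    = (if i = j \<and> gram_schmidt_seq d i \<noteq> 0 then 1 else 0)"
  using gram_schmidt_seq_norm[of d i] gram_schmidt_seq_orth[of i j d] gram_schmidt_seq_orth[of j i d]
  by (cases i j rule: linorder_cases) (auto simp: inner_commute)

text \<open>Holds also when the residual is 0, since then \<open>d n\<close> is already spanned. It
  carries the density of \<open>d\<close> over to the spans of the sequence.\<close>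

lemma gram_schmidt_seq_span: "d n \<in> span (gram_schmidt_seq d ` {..n})"
proof -
  let ?e = "gram_schmidt_seq d"
  let ?p = "\<Sum>i\<in>set [0..<n]. inner (d n) (?e i) *\<^sub>R ?e i"
  have "norm r *\<^sub>R sgn r = r" for r :: 'a by (cases "r = 0") (simp_all add: sgn_div_norm)
  from this[of "d n - ?p"] have "d n = ?p + norm (d n - ?p) *\<^sub>R ?e n"
    unfolding gram_schmidt_seq.simps[of d n, symmetric] by (simp add: algebra_simps)
  also have "\<dots> \<in> span (?e ` {..n})"
    by (intro span_add span_sum span_scale span_base) auto
  finally show ?thesis .
qed

text \<open>The partial sums \<open>p N x\<close> are orthogonal projections, hence best
  approximations: once a dense point \<open>d n\<close> near \<open>x\<close> lies in the span of
  the first \<open>N\<close> vectors, \<open>p N x\<close> is at least as close to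
  \<open>x\<close>.\<close>

lemma ex_parseval_sequence:
  obtains e :: "nat \<Rightarrow> 'a::{real_inner, polish_space}"
  where "\<And>x y. (\<lambda>N. \<Sum>i<N. inner x (e i) * inner y (e i)) \<longlonglongrightarrow> inner x y"
    "\<And>x N. (\<Sum>i<N. (inner x (e i))\<^sup>2) \<le> (norm x)\<^sup>2"
proof -
  obtain D :: "'a set" where D: "countable D" "\<And>X. open X \<Longrightarrow> X \<noteq> {} \<Longrightarrow> \<exists>d\<in>D. d \<in> X"
    using countable_dense_setE by metis
  then have "D \<noteq> {}" using D(2)[of UNIV] by auto
  define d where "d = from_nat_into D"
  define e where "e = gram_schmidt_seq d"
  define p where "p N x = (\<Sum>i<N. inner x (e i) *\<^sub>R e i)" for N x
  have orth: "inner (x - p N x) (e i) = 0" if "i < N" for x N i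
  proof -
    have "inner (p N x) (e i) = (\<Sum>j<N. if j = i then inner x (e i) else 0)"
      unfolding p_def inner_sum_left
      by (intro sum.cong) (auto simp: e_def gram_schmidt_seq_inner)
    then show ?thesis using that by (simp add: inner_diff_left)
  qed
  have orth': "inner (x - p N x) y = 0" if "y \<in> span (e ` {..<N})" for x y N
    using that by (induction y rule: span_induct_alt) (auto simp: orth inner_add_right)
  have pspan: "p N x \<in> span (e ` {..<N})" for N x
    unfolding p_def by (intro span_sum span_scale span_base) auto
  have pin: "inner (p N x) y = (\<Sum>i<N. inner x (e i) * inner y (e i))" for N x y
    unfolding p_def inner_sum_left by (simp add: inner_commute)
  have pyth: "(norm (x - y))\<^sup>2 = (norm (x - p N x))\<^sup>2 + (norm (p N x - y))\<^sup>2"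
    if "y \<in> span (e ` {..<N})" for x y N
  proof -
    have "x - y = (x - p N x) + (p N x - y)" by simp
    moreover have "inner (x - p N x) (p N x - y) = 0"
      using that pspan by (intro orth' span_diff)
    ultimately show ?thesis
      by (metis add.right_neutral mult_zero_right norm_add_Pythagorean orthogonal_def)
  qed
  have conv: "(\<lambda>N. p N x) \<longlonglongrightarrow> x" for x
  proof (rule metric_LIMSEQ_I)
    fix r :: real assume "r > 0"
    then obtain y where "y \<in> D" "y \<in> ball x r" using D(2)[of "ball x r"] by auto
    then obtain n where n: "d n \<in> ball x r"
      using \<open>D \<noteq> {}\<close> D(1) unfolding d_def by (metis from_nat_into_surj)
    show "\<exists>n0. \<forall>n\<ge>n0. dist (p n x) x < r"
    proof (intro exI allI impI)
      fix N assume "N \<ge> Suc n"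
      then have "e ` {..n} \<subseteq> e ` {..<N}" by auto
      then have "d n \<in> span (e ` {..<N})"
        using gram_schmidt_seq_span[of d n] span_mono unfolding e_def by blast
      from pyth[OF this, of x] have "(norm (x - p N x))\<^sup>2 \<le> (norm (x - d n))\<^sup>2" by simp
      then have "norm (x - p N x) \<le> norm (x - d n)" by (rule power2_le_imp_le) simp
      then show "dist (p N x) x < r" using n by (simp add: dist_norm norm_minus_commute)
    qed
  qed
  show ?thesis
  proof (rule that)
    show "(\<lambda>N. \<Sum>i<N. inner x (e i) * inner y (e i)) \<longlonglongrightarrow> inner x y" for x y
      unfolding pin[symmetric] by (intro tendsto_intros conv)
    show "(\<Sum>i<N. (inner x (e i))\<^sup>2) \<le> (norm x)\<^sup>2" for x N
    proof -
      have "(norm x)\<^sup>2 = (norm (x - p N x))\<^sup>2 + (norm (p N x))\<^sup>2"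
        using pyth[where y = 0 and N = N and x = x] by (simp add: span_zero)
      moreover have "(norm (p N x))\<^sup>2 = inner (p N x) x"
        using orth'[OF pspan[of N x], of x]
        unfolding power2_norm_eq_inner inner_diff_left by (simp add: inner_commute)
      ultimately show ?thesis unfolding pin by (simp add: power2_eq_square)
    qed
  qed
qed

text \<open>The multinomial theorem without collecting equal monomials: ordered lists need no
  multinomial coefficients, and each term is a plain product of coordinates.\<close>

lemma power_sum_lists:
  fixes a :: "nat \<Rightarrow> real"
  assumes "finite A"
  shows "(\<Sum>i\<in>A. a i) ^ n = (\<Sum>l | set l \<subseteq> A \<and> length l = n. prod_list (map a l))"
proof (induction n)
  case 0
  have "{l. set l \<subseteq> A \<and> length l = 0} = {[]}" by auto
  then show ?case by simp
next
  case (Suc n)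
  have inj: "inj_on (\<lambda>(l, i). i # l) ({l. set l \<subseteq> A \<and> length l = n} \<times> A)" by (auto simp: inj_on_def)
  have "(\<Sum>l | set l \<subseteq> A \<and> length l = Suc n. prod_list (map a l))
      = (\<Sum>(l, i)\<in>{l. set l \<subseteq> A \<and> length l = n} \<times> A. a i * prod_list (map a l))"
    unfolding lists_length_Suc_eq
    by (subst sum.reindex[OF inj]) (auto intro!: sum.cong)
  also have "\<dots> = (\<Sum>l | set l \<subseteq> A \<and> length l = n. \<Sum>i\<in>A. a i * prod_list (map a l))"
    by (simp add: sum.cartesian_product)
  also have "\<dots> = (\<Sum>i\<in>A. a i) ^ Suc n"
    by (simp add: Suc mult.commute sum_distrib_left sum_distrib_right)
  finally show ?case by simp
qed

text \<open>At \<open>t = 0\<close> this is the constant 1, so statements about Gaussian integrals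
  with \<open>t \<ge> 0\<close> include the total mass.\<close>

definition gauss :: "real \<Rightarrow> 'a::real_normed_vector \<Rightarrow> real" where
  "gauss t y = exp (- (t * (norm y)\<^sup>2))"

lemma gauss_le_1 [simp]: "t \<ge> 0 \<Longrightarrow> gauss t y \<le> 1" and gauss_pos [simp]: "gauss t y > 0"
  and gauss_nonneg [simp]: "gauss t y \<ge> 0" and abs_gauss: "\<bar>gauss t y\<bar> = gauss t y"
  by (simp_all add: gauss_def)

lemma gauss_measurable [measurable]: "gauss t \<in> borel_measurable borel"
  unfolding gauss_def by measurable

text \<open>
  Expansion of the Gaussian kernel into features, coming from
  \<open>gauss t (x - z) = gauss t x * gauss t z * exp (2 t \<langle>x, z\<rangle>)\<close>, the exponential series and
  \<open>\<langle>x, z\<rangle> = (\<Sum>i. x\<^sub>i z\<^sub>i)\<close>; the features are indexed by finite lists of coordinates.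
\<close>

lemma gauss_features:
  assumes t: "t > 0"
  obtains \<phi> :: "nat list \<Rightarrow> 'a::{real_inner, polish_space} \<Rightarrow> real" and L :: "nat \<Rightarrow> nat list set"
  where "\<And>l. \<phi> l \<in> borel_measurable borel" "\<And>l x. \<bar>\<phi> l x\<bar> \<le> 1"
    "\<And>N. finite (L N)" "\<And>l. \<forall>\<^sub>F N in sequentially. l \<in> L N"
    "\<And>x z. (\<lambda>N. \<Sum>l\<in>L N. \<phi> l x * \<phi> l z) \<longlonglongrightarrow> gauss t (x - z)"
    "\<And>N x z. \<bar>\<Sum>l\<in>L N. \<phi> l x * \<phi> l z\<bar> \<le> 1"
proof -
  obtain e :: "nat \<Rightarrow> 'a" where
    e: "\<And>x y. (\<lambda>N. \<Sum>i<N. inner x (e i) * inner y (e i)) \<longlonglongrightarrow> inner x y"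
    and bessel: "\<And>x N. (\<Sum>i<N. (inner x (e i))\<^sup>2) \<le> (norm x)\<^sup>2"
    using ex_parseval_sequence by blast
  define c where "c = 2 * t"
  have c: "c > 0" using t by (simp add: c_def)
  \<comment> \<open>One parameter truncates both the number of coordinates and the degree of the
    exponential series, so each \<open>L N\<close> is finite while every list is eventually
    included.\<close>
  define L where "L N = {l. set l \<subseteq> {..<N} \<and> length l < N}" for N :: nat
  define \<phi> where "\<phi> l x = gauss t x * (sqrt (c ^ length l / fact (length l)) * prod_list (map (\<lambda>i. inner x (e i)) l))"
    for l x
  define T where "T N r = (\<Sum>n<N. c ^ n / fact n * r ^ n)" for N :: nat and r :: real
  have finL: "finite (L N)" for N
  proof -
    have "L N \<subseteq> {l. set l \<subseteq> {..<N} \<and> length l \<le> N}" by (auto simp: L_def)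
    then show ?thesis using finite_lists_length_le[of "{..<N}" N] finite_subset by blast
  qed
  have prods: "prod_list (map f l) * prod_list (map g l) = prod_list (map (\<lambda>i. f i * g i) l)"
    for f g :: "nat \<Rightarrow> real" and l
    by (induction l) (simp_all add: mult_ac)
  have feat: "\<phi> l x * \<phi> l z = gauss t x * gauss t z *
      (c ^ length l / fact (length l) * prod_list (map (\<lambda>i. inner x (e i) * inner z (e i)) l))" for l x z
  proof -
    let ?q = "sqrt (c ^ length l / fact (length l))"
    have "\<phi> l x * \<phi> l z = gauss t x * gauss t z * ((?q * ?q) *
        prod_list (map (\<lambda>i. inner x (e i) * inner z (e i)) l))"
      unfolding \<phi>_def prods[symmetric] by (simp only: mult_ac)
    also have "?q * ?q = c ^ length l / fact (length l)" using c by simp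
    finally show ?thesis .
  qed
  have sumL: "(\<Sum>l\<in>L N. \<phi> l x * \<phi> l z) = gauss t x * gauss t z * T N (\<Sum>i<N. inner x (e i) * inner z (e i))" for N x z
  proof -
    have LU: "L N = (\<Union>n\<in>{..<N}. {l. set l \<subseteq> {..<N} \<and> length l = n})" by (auto simp: L_def)
    have "(\<Sum>l\<in>L N. c ^ length l / fact (length l) * prod_list (map (\<lambda>i. inner x (e i) * inner z (e i)) l))
      = (\<Sum>n<N. \<Sum>l | set l \<subseteq> {..<N} \<and> length l = n. c ^ length l / fact (length l) * prod_list (map (\<lambda>i. inner x (e i) * inner z (e i)) l))"
      unfolding LU by (rule sum.UNION_disjoint) (auto simp: finite_lists_length_eq)
    also have "\<dots> = T N (\<Sum>i<N. inner x (e i) * inner z (e i))"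
      unfolding T_def by (intro sum.cong) (auto simp: power_sum_lists sum_distrib_left)
    finally show ?thesis unfolding feat sum_distrib_left[symmetric] by simp
  qed
  have Tsums: "(\<lambda>n. c ^ n / fact n * r ^ n) sums exp (c * r)" for r
    using exp_converges[of "c * r"] by (simp add: power_mult_distrib scaleR_conv_of_real divide_inverse mult_ac)
  have Tle: "T N r \<le> exp (c * r)" if "r \<ge> 0" for N r
    unfolding T_def sums_unique[OF Tsums[of r]] using c that
    by (intro sum_le_suminf sums_summable[OF Tsums]) auto
  have gg: "gauss t x * gauss t z * exp (c * inner x z) = gauss t (x - z)" for x z :: 'a
    unfolding gauss_def c_def exp_add[symmetric] power2_norm_eq_inner
    by (simp add: inner_diff_left inner_diff_right inner_commute algebra_simps)
  \<comment> \<open>On the diagonal the kernel equals 1 and all terms are squares. The bound on the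
    features and, by Cauchy-Schwarz, the uniform bound on the partial kernels both come from
    here.\<close>
  have diag: "(\<Sum>l\<in>L N. (\<phi> l x)\<^sup>2) \<le> 1" for N x
  proof -
    have "(\<Sum>l\<in>L N. (\<phi> l x)\<^sup>2) = gauss t x * gauss t x * T N (\<Sum>i<N. (inner x (e i))\<^sup>2)"
      using sumL[where N = N and x = x and z = x] by (simp add: power2_eq_square)
    also have "\<dots> \<le> gauss t x * gauss t x * exp (c * inner x x)"
    proof (intro mult_left_mono)
      have "T N (\<Sum>i<N. (inner x (e i))\<^sup>2) \<le> exp (c * (\<Sum>i<N. (inner x (e i))\<^sup>2))"
        by (rule Tle) (simp add: sum_nonneg)
      also have "\<dots> \<le> exp (c * inner x x)" using bessel[where N = N and x = x] c by (simp add: power2_norm_eq_inner)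
      finally show "T N (\<Sum>i<N. (inner x (e i))\<^sup>2) \<le> exp (c * inner x x)" .
    qed simp
    also have "\<dots> = 1" unfolding gg by (simp add: gauss_def)
    finally show ?thesis .
  qed
  have ev: "\<forall>\<^sub>F N in sequentially. l \<in> L N" for l
  proof (rule eventually_sequentiallyI)
    fix N assume N: "Suc (length l + sum_list l) \<le> N"
    have "i < N" if "i \<in> set l" for i using member_le_sum_list[OF that] N by linarith
    then show "l \<in> L N" using N by (auto simp: L_def)
  qed
  show ?thesis
  proof (rule that)
    show "\<phi> l \<in> borel_measurable borel" for l
    proof -
      have "(\<lambda>x. prod_list (map (\<lambda>i. inner x (e i)) l)) \<in> borel_measurable borel"
        by (induction l) auto
      then show ?thesis unfolding \<phi>_def by measurable
    qed
    show "\<bar>\<phi> l x\<bar> \<le> 1" for l x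
    proof -
      obtain N where "l \<in> L N" using ev[of l] eventually_sequentially by auto
      then have "(\<phi> l x)\<^sup>2 \<le> (\<Sum>l\<in>L N. (\<phi> l x)\<^sup>2)" by (intro member_le_sum finL) auto
      then show ?thesis using diag[where N = N and x = x] by (simp add: abs_square_le_1 [symmetric])
    qed
    show "\<bar>\<Sum>l\<in>L N. \<phi> l x * \<phi> l z\<bar> \<le> 1" for N x z
    proof -
      have "(\<Sum>l\<in>L N. \<phi> l x * \<phi> l z)\<^sup>2 \<le> (\<Sum>l\<in>L N. (\<phi> l x)\<^sup>2) * (\<Sum>l\<in>L N. (\<phi> l z)\<^sup>2)"
        by (rule Cauchy_Schwarz_ineq_sum)
      also have "\<dots> \<le> 1" using diag by (intro mult_le_one sum_nonneg) auto
      finally show ?thesis by (simp add: abs_square_le_1)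
    qed
    show "(\<lambda>N. \<Sum>l\<in>L N. \<phi> l x * \<phi> l z) \<longlonglongrightarrow> gauss t (x - z)" for x z
    proof -
      define a where "a N = (\<Sum>i<N. inner x (e i) * inner z (e i))" for N
      define R where "R = norm x * norm z"
      have aR: "\<bar>a N\<bar> \<le> R" for N
      proof -
        have "(a N)\<^sup>2 \<le> (\<Sum>i<N. (inner x (e i))\<^sup>2) * (\<Sum>i<N. (inner z (e i))\<^sup>2)"
          unfolding a_def by (rule Cauchy_Schwarz_ineq_sum)
        also have "\<dots> \<le> (norm x)\<^sup>2 * (norm z)\<^sup>2"
          by (intro mult_mono bessel) (auto intro: sum_nonneg)
        also have "\<dots> = R\<^sup>2" by (simp add: R_def power_mult_distrib)
        finally show ?thesis using abs_le_square_iff[of "a N" R] by (simp add: R_def)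
      qed
      \<comment> \<open>The argument \<open>a N\<close> moves with the truncation order, so
        convergence of the series at a fixed argument is not enough. The remainder is majorized by
        the one at \<open>R\<close>, which bounds every \<open>\<bar>a N\<bar>\<close>.\<close>
      have tail: "\<bar>exp (c * a N) - T N (a N)\<bar> \<le> exp (c * R) - T N R" for N
      proof -
        have s: "(\<lambda>n. c ^ (n + N) / fact (n + N) * r ^ (n + N)) sums (exp (c * r) - T N r)" for r
          using sums_split_initial_segment[OF Tsums[of r], of N] by (simp add: T_def)
        have nn: "norm (c ^ (n + N) / fact (n + N) * a N ^ (n + N)) \<le> c ^ (n + N) / fact (n + N) * R ^ (n + N)" for n
          using c aR[of N] by (simp add: abs_mult power_abs del: power_add)
            (intro mult_left_mono divide_right_mono power_mono, auto)
        have "norm (suminf (\<lambda>n. c ^ (n + N) / fact (n + N) * a N ^ (n + N)))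
            \<le> suminf (\<lambda>n. c ^ (n + N) / fact (n + N) * R ^ (n + N))"
          by (rule norm_suminf_le[OF nn sums_summable[OF s]])
        then show ?thesis using sums_unique[OF s] by simp
      qed
      have "(\<lambda>N. exp (c * R) - T N R) \<longlonglongrightarrow> exp (c * R) - exp (c * R)"
        using Tsums[of R] unfolding T_def sums_def by (intro tendsto_diff tendsto_const)
      then have T0: "(\<lambda>N. exp (c * R) - T N R) \<longlonglongrightarrow> 0" by simp
      have "(\<lambda>N. exp (c * a N) - T N (a N)) \<longlonglongrightarrow> 0"
        by (rule Lim_null_comparison[OF _ T0], rule always_eventually, rule allI, subst real_norm_def, rule tail)
      moreover have "(\<lambda>N. exp (c * a N)) \<longlonglongrightarrow> exp (c * inner x z)"
        unfolding a_def by (intro tendsto_intros e)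
      ultimately have "(\<lambda>N. exp (c * a N) - (exp (c * a N) - T N (a N))) \<longlonglongrightarrow> exp (c * inner x z) - 0"
        by (rule tendsto_diff[rotated])
      then have "(\<lambda>N. T N (a N)) \<longlonglongrightarrow> exp (c * inner x z)" by simp
      then have "(\<lambda>N. gauss t x * gauss t z * T N (a N)) \<longlonglongrightarrow> gauss t x * gauss t z * exp (c * inner x z)"
        by (intro tendsto_intros)
      then show ?thesis unfolding sumL gg a_def .
    qed
  qed (use finL ev in auto)
qed

section \<open>Gaussian integrals determine a Borel probability measure\<close>

lemma borel_prob_prob_space: "borel_prob P \<Longrightarrow> prob_space P"
  and borel_prob_sets: "borel_prob P \<Longrightarrow> sets P = sets borel"
  by (auto simp: borel_prob_def)

lemma borel_prob_space: "borel_prob P \<Longrightarrow> space P = UNIV"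
  using sets_eq_imp_space_eq[of P borel] by (simp add: borel_prob_def)

lemma borel_prob_integrable_bounded:
  fixes f :: "'a::topological_space \<Rightarrow> 'b::{banach, second_countable_topology}"
  assumes P: "borel_prob P" and f: "f \<in> borel_measurable borel" and bd: "\<And>x. norm (f x) \<le> B"
  shows "integrable P f"
proof -
  interpret prob_space P using P by (rule borel_prob_prob_space)
  have "f \<in> borel_measurable P" using f measurable_cong_sets[OF borel_prob_sets[OF P]] by blast
  then show ?thesis by (intro integrable_const_bound[where B = B]) (use bd in auto)
qed

lemma borel_prob_abs_integral_le:
  fixes f :: "'a::topological_space \<Rightarrow> real"
  assumes P: "borel_prob P" and f: "f \<in> borel_measurable borel" and bd: "\<And>x. \<bar>f x\<bar> \<le> B"
  shows "\<bar>integral\<^sup>L P f\<bar> \<le> B"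
proof -
  interpret prob_space P using P by (rule borel_prob_prob_space)
  have i: "integrable P f" by (rule borel_prob_integrable_bounded[OF P f, of B]) (use bd in simp)
  have "\<bar>integral\<^sup>L P f\<bar> \<le> (\<integral>x. \<bar>f x\<bar> \<partial>P)" using integral_norm_bound[of P f] by simp
  also have "\<dots> \<le> (\<integral>x. B \<partial>P)" using i bd by (intro integral_mono) auto
  finally show ?thesis by (simp add: prob_space)
qed

text \<open>Complete the square around the weighted mean \<open>w\<close> of \<open>x\<close> and
  \<open>y\<close>; what is left over is free of \<open>z\<close> and becomes \<open>C\<close>. For
  \<open>s = t = 0\<close> there is no mean, and both factors are 1.\<close>

lemma gauss_mult:
  fixes x y :: "'a::real_inner"
  assumes "s \<ge> 0" "t \<ge> 0"
  obtains C w where "\<And>z. gauss s (x - z) * gauss t (y - z) = C * gauss (s + t) (w - z)"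
proof (cases "s + t = 0")
  case True
  then have "s = 0" "t = 0" using assms by auto
  then show ?thesis by (intro that[of 1 0]) (simp add: gauss_def)
next
  case False
  then have st: "s + t > 0" using assms by simp
  define w where "w = (s *\<^sub>R x + t *\<^sub>R y) /\<^sub>R (s + t)"
  have "s * (norm (x - z))\<^sup>2 + t * (norm (y - z))\<^sup>2
      = (s * (norm x)\<^sup>2 + t * (norm y)\<^sup>2 - (s + t) * (norm w)\<^sup>2) + (s + t) * (norm (w - z))\<^sup>2" for z
  proof -
    have "(s + t) * inner w z = s * inner x z + t * inner y z"
      using st by (simp add: w_def inner_add_left)
    then show ?thesis
      by (simp add: power2_norm_eq_inner inner_diff_left inner_diff_right inner_commute algebra_simps)
  qed
  then show ?thesis
    by (intro that[of "exp (- (s * (norm x)\<^sup>2 + t * (norm y)\<^sup>2 - (s + t) * (norm w)\<^sup>2))" w])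
      (simp only: gauss_def exp_add[symmetric] minus_add_distrib[symmetric])
qed

lemma gauss_power: "gauss t x ^ k = gauss (real k * t) x"
  unfolding gauss_def exp_of_nat_mult[symmetric] by (simp add: mult.assoc)

text \<open>
  By Weierstrass' theorem a continuous function of \<open>gauss 1 (x - z)\<close> is a uniform limit of
  polynomials, and products of Gaussians are again Gaussians.
\<close>

lemma gauss_integrals_prod:
  fixes P Q :: "'a::{real_inner, polish_space} measure"
  assumes P: "borel_prob P" and Q: "borel_prob Q"
    and eq: "\<And>t x. t > 0 \<Longrightarrow> (\<integral>z. gauss t (x - z) \<partial>P) = (\<integral>z. gauss t (x - z) \<partial>Q)"
    and X: "\<And>x \<phi>. (x, \<phi>) \<in> set X \<Longrightarrow> continuous_on UNIV \<phi> \<and> (\<forall>u. \<bar>\<phi> u\<bar> \<le> 1)"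
    and t: "t \<ge> 0"
  shows "(\<integral>z. prod_list (map (\<lambda>(x, \<phi>). \<phi> (gauss 1 (x - z))) X) * gauss t (y - z) \<partial>P)
       = (\<integral>z. prod_list (map (\<lambda>(x, \<phi>). \<phi> (gauss 1 (x - z))) X) * gauss t (y - z) \<partial>Q)"
  using X t
\<comment> \<open>The free factor \<open>gauss t (y - z)\<close> makes the induction go through: a
  monomial in the new Gaussian is again a Gaussian centred at \<open>x\<close>, and it merges with
  this factor into a single one.\<close>
proof (induction X arbitrary: t y)
  case Nil
  show ?case
  proof (cases "t = 0")
    case True
    then show ?thesis
      using prob_space.prob_space[OF borel_prob_prob_space[OF P]] prob_space.prob_space[OF borel_prob_prob_space[OF Q]]
      by (simp add: gauss_def)
  qed (use Nil eq in simp)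
next
  case (Cons a X)
  obtain x \<phi> where a: "a = (x, \<phi>)" by force
  have \<phi>: "continuous_on UNIV \<phi>" "\<And>u. \<bar>\<phi> u\<bar> \<le> 1" using Cons.prems a by auto
  have X: "\<And>x \<phi>. (x, \<phi>) \<in> set X \<Longrightarrow> continuous_on UNIV \<phi> \<and> (\<forall>u. \<bar>\<phi> u\<bar> \<le> 1)"
    using Cons.prems by auto
  define R where "R z = prod_list (map (\<lambda>(x, \<phi>). \<phi> (gauss 1 (x - z))) X)" for z
  have Rm [measurable]: "R \<in> borel_measurable borel" and Rb: "\<bar>R z\<bar> \<le> 1" for z
    using X unfolding R_def
  proof (induction X)
    case (Cons b X)
    { case 1
      obtain x' \<phi>' where b: "b = (x', \<phi>')" by force
      then have "continuous_on UNIV \<phi>'" using 1 by auto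
      then have [measurable]: "\<phi>' \<in> borel_measurable borel" by (rule borel_measurable_continuous_onI)
      have "(\<lambda>z. prod_list (map (\<lambda>(x, \<phi>). \<phi> (gauss 1 (x - z))) X)) \<in> borel_measurable borel"
        using Cons 1 by auto
      then show ?case unfolding b by simp
    next
      case 2
      obtain x' \<phi>' where b: "b = (x', \<phi>')" by force
      then have "\<bar>\<phi>' u\<bar> \<le> 1" for u using 2 by auto
      then show ?case using Cons 2 unfolding b by (auto simp: abs_mult intro!: mult_le_one) }
  qed auto
  have [measurable]: "\<phi> \<in> borel_measurable borel" using \<phi>(1) by (rule borel_measurable_continuous_onI)
  define I where "I M f = (\<integral>z. f (gauss 1 (x - z)) * R z * gauss t (y - z) \<partial>M)"
    for M :: "'a measure" and f :: "real \<Rightarrow> real"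
  have poly: "I P p = I Q p" if pol: "real_polynomial_function p" for p
  proof -
    obtain c n where p: "p = (\<lambda>u. \<Sum>i\<le>n. c i * u ^ i)"
      using pol unfolding real_polynomial_function_iff_sum by blast
    have e: "I M p = (\<Sum>i\<le>n. c i * (\<integral>z. R z * (gauss (real i) (x - z) * gauss t (y - z)) \<partial>M))"
      if M: "borel_prob M" for M
    proof -
      have int: "integrable M (\<lambda>z. R z * (gauss (real i) (x - z) * gauss t (y - z)))" for i
      proof (rule borel_prob_integrable_bounded[OF M, of _ 1])
        show "norm (R z * (gauss (real i) (x - z) * gauss t (y - z))) \<le> 1" for z
          using Rb[of z] Cons.prems(2) by (auto simp: abs_mult abs_gauss intro!: mult_le_one)
      qed measurable
      have "I M p = (\<integral>z. (\<Sum>i\<le>n. c i * (R z * (gauss (real i) (x - z) * gauss t (y - z)))) \<partial>M)"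
        unfolding I_def p by (simp add: gauss_power sum_distrib_left sum_distrib_right mult_ac)
      also have "\<dots> = (\<Sum>i\<le>n. c i * (\<integral>z. R z * (gauss (real i) (x - z) * gauss t (y - z)) \<partial>M))"
        by (subst Bochner_Integration.integral_sum) (use int in auto)
      finally show ?thesis .
    qed
    have "(\<integral>z. R z * (gauss (real i) (x - z) * gauss t (y - z)) \<partial>P)
        = (\<integral>z. R z * (gauss (real i) (x - z) * gauss t (y - z)) \<partial>Q)" for i
    proof -
      obtain C w where w: "\<And>z. gauss (real i) (x - z) * gauss t (y - z) = C * gauss (real i + t) (w - z)"
        using gauss_mult[of "real i" t x y] Cons.prems(2) by auto
      have "(\<integral>z. R z * gauss (real i + t) (w - z) \<partial>P) = (\<integral>z. R z * gauss (real i + t) (w - z) \<partial>Q)"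
        unfolding R_def by (rule Cons.IH[OF X]) (use Cons.prems(2) in auto)
      then show ?thesis unfolding w by (simp add: mult.left_commute)
    qed
    then show ?thesis using e[OF P] e[OF Q] by simp
  qed
  have approx: "\<bar>I M \<phi> - I M p\<bar> \<le> e" if M: "borel_prob M" and p: "real_polynomial_function p"
    and e: "\<And>u. u \<in> {0..1} \<Longrightarrow> \<bar>\<phi> u - p u\<bar> < e" for M p e
  proof -
    have "continuous_on UNIV p" using p by (simp add: continuous_on_polymonial_function real_polynomial_function_eq)
    then have [measurable]: "p \<in> borel_measurable borel" by (rule borel_measurable_continuous_onI)
    have g: "gauss 1 (x - z) \<in> {0..1}" for z by simp
    have pb: "\<bar>p u\<bar> \<le> 1 + e" if "u \<in> {0..1}" for u using e[OF that] \<phi>(2)[of u] by linarith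
    have e0: "e > 0" using e[of 0] by simp
    have 1: "integrable M (\<lambda>z. \<phi> (gauss 1 (x - z)) * R z * gauss t (y - z))"
      by (rule borel_prob_integrable_bounded[OF M, of _ 1])
        (use Rb \<phi>(2) Cons.prems(2) in \<open>auto simp: abs_mult abs_gauss intro!: mult_le_one\<close>)
    have 2: "integrable M (\<lambda>z. p (gauss 1 (x - z)) * R z * gauss t (y - z))"
    proof (rule borel_prob_integrable_bounded[OF M, of _ "(1 + e) * 1 * 1"])
      show "norm (p (gauss 1 (x - z)) * R z * gauss t (y - z)) \<le> (1 + e) * 1 * 1" for z
        unfolding real_norm_def abs_mult abs_gauss
        by (intro mult_mono pb g Rb) (use Cons.prems(2) e0 in auto)
    qed measurable
    have "I M \<phi> - I M p = (\<integral>z. (\<phi> (gauss 1 (x - z)) - p (gauss 1 (x - z))) * R z * gauss t (y - z) \<partial>M)"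
      unfolding I_def by (subst Bochner_Integration.integral_diff[symmetric, OF 1 2]) (simp add: left_diff_distrib)
    also have "\<bar>\<dots>\<bar> \<le> e * 1 * 1"
    proof (rule borel_prob_abs_integral_le[OF M])
      show "\<bar>(\<phi> (gauss 1 (x - z)) - p (gauss 1 (x - z))) * R z * gauss t (y - z)\<bar> \<le> e * 1 * 1" for z
        unfolding abs_mult abs_gauss
        by (intro mult_mono Rb less_imp_le[OF e] g) (use Cons.prems(2) e0 in auto)
    qed measurable
    finally show ?thesis by simp
  qed
  have "I P \<phi> = I Q \<phi>"
  proof (rule ccontr)
    assume ne: "I P \<phi> \<noteq> I Q \<phi>"
    define e where "e = \<bar>I P \<phi> - I Q \<phi>\<bar> / 4"
    have e: "e > 0" using ne by (simp add: e_def)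
    obtain p where p: "real_polynomial_function p" "\<And>u. u \<in> {0..1} \<Longrightarrow> \<bar>\<phi> u - p u\<bar> < e"
      using Stone_Weierstrass_real_polynomial_function[of "{0..1}" \<phi> e] e continuous_on_subset[OF \<phi>(1)] by auto
    have "\<bar>I P \<phi> - I P p\<bar> \<le> e" by (rule approx[OF P p(1)]) (rule p(2))
    moreover have "\<bar>I Q \<phi> - I Q p\<bar> \<le> e" by (rule approx[OF Q p(1)]) (rule p(2))
    moreover have "\<bar>I P \<phi> - I Q \<phi>\<bar> \<le> \<bar>I P \<phi> - I P p\<bar> + \<bar>I Q \<phi> - I P p\<bar>" by linarith
    moreover have "\<bar>I P \<phi> - I Q \<phi>\<bar> = 4 * e" by (simp add: e_def)
    ultimately show False using poly[OF p(1)] e by simp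
  qed
  then show ?case unfolding I_def R_def a by (simp add: mult.assoc)
qed

text \<open>Balls are superlevel sets of \<open>gauss 1 (x - z)\<close> in \<open>z\<close>. Hence
  the sets \<open>U X\<close> form an intersection-stable generator of the Borel sets, and their
  indicators are limits of products of continuous functions of Gaussians.\<close>

lemma gauss_integrals_eqI:
  fixes P Q :: "'a::{real_inner, polish_space} measure"
  assumes P: "borel_prob P" and Q: "borel_prob Q"
    and eq: "\<And>t x. t > 0 \<Longrightarrow> (\<integral>z. gauss t (x - z) \<partial>P) = (\<integral>z. gauss t (x - z) \<partial>Q)"
  shows "P = Q"
proof -
  define U where "U X = {z::'a. \<forall>(x, c) \<in> set X. gauss 1 (x - z) > c}" for X :: "('a \<times> real) list"
  define E where "E = range U"
  have Um [measurable]: "U X \<in> sets borel" for X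
  proof (induction X)
    case (Cons a X)
    have "U (a # X) = {z. gauss 1 (fst a - z) > snd a} \<inter> U X" by (auto simp: U_def)
    also have "\<dots> \<in> sets borel" using Cons by (intro sets.Int) auto
    finally show ?case .
  qed (simp add: U_def)
  \<comment> \<open>Ramps of slope \<open>n\<close> starting at \<open>c\<close> and capped at 1;
    they vanish at \<open>c\<close> itself, so the limit is the indicator of the strict
    inequality.\<close>
  define \<psi> where "\<psi> c n u = min 1 (real n * max 0 (u - c))" for c u :: real and n :: nat
  have \<psi>lim: "(\<lambda>n. \<psi> c n u) \<longlonglongrightarrow> (if u > c then 1 else 0)" for c u
  proof (cases "u > c")
    case True
    obtain n0 where n0: "real n0 * (u - c) > 1" using True reals_Archimedean3[of "u - c"] by auto
    have "\<forall>\<^sub>F n in sequentially. \<psi> c n u = 1"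
    proof (rule eventually_sequentiallyI[of n0])
      fix n assume "n0 \<le> n"
      then have "real n0 * (u - c) \<le> real n * (u - c)" using True by (intro mult_right_mono) auto
      then show "\<psi> c n u = 1" using n0 True unfolding \<psi>_def by linarith
    qed
    then show ?thesis using True by (simp add: tendsto_eventually)
  qed (simp add: \<psi>_def)
  \<comment> \<open>The factor \<open>gauss 0 (0 - z)\<close> is 1 and only brings the integrand
    into the form treated by \<open>gauss_integrals_prod\<close>.\<close>
  have lim: "(\<lambda>n. \<integral>z. prod_list (map (\<lambda>(x, \<phi>). \<phi> (gauss 1 (x - z))) (map (\<lambda>(x, c). (x, \<psi> c n)) X)) * gauss 0 (0 - z) \<partial>M)
      \<longlonglongrightarrow> measure M (U X)" if M: "borel_prob M" for M X
  proof -
    let ?f = "\<lambda>n z. prod_list (map (\<lambda>(x, c). \<psi> c n (gauss 1 (x - z))) X)"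
    interpret prob_space M using M by (rule borel_prob_prob_space)
    have fm: "?f n \<in> borel_measurable borel" for n
    proof (induction X)
      case (Cons a X)
      have "\<psi> (snd a) n \<in> borel_measurable borel" unfolding \<psi>_def[abs_def] by measurable
      then show ?case using Cons by (auto simp: case_prod_beta)
    qed simp
    then have [measurable]: "?f n \<in> borel_measurable M" for n
      using measurable_cong_sets[OF borel_prob_sets[OF M]] by blast
    have b: "\<bar>?f n z\<bar> \<le> 1" for n z
      by (induction X) (auto simp: abs_mult \<psi>_def intro!: mult_le_one)
    have l: "(\<lambda>n. ?f n z) \<longlonglongrightarrow> indicator (U X) z" for z
    proof (induction X)
      case (Cons a X)
      then have "(\<lambda>n. \<psi> (snd a) n (gauss 1 (fst a - z)) * prod_list (map (\<lambda>(x, c). \<psi> c n (gauss 1 (x - z))) X))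
         \<longlonglongrightarrow> (if gauss 1 (fst a - z) > snd a then 1 else 0) * indicator (U X) z"
        by (intro tendsto_mult \<psi>lim)
      moreover have "(if gauss 1 (fst a - z) > snd a then 1 else 0) * indicator (U X) z = (indicator (U (a # X)) z :: real)"
        by (auto simp: U_def indicator_def split: prod.splits)
      ultimately show ?case unfolding list.map prod_list.Cons case_prod_beta by (simp only:)
    qed (simp add: U_def)
    have "(\<lambda>n. integral\<^sup>L M (?f n)) \<longlonglongrightarrow> integral\<^sup>L M (indicator (U X))"
      by (rule integral_dominated_convergence[where w = "\<lambda>_. 1"])
        (use b l borel_measurable_indicator[of "U X" M] in \<open>auto simp: borel_prob_sets[OF M]\<close>)
    also have "integral\<^sup>L M (indicator (U X)) = measure M (U X)"
      by (simp add: borel_prob_space[OF M])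
    also have "(\<lambda>n. integral\<^sup>L M (?f n)) = (\<lambda>n. \<integral>z. prod_list (map (\<lambda>(x, \<phi>). \<phi> (gauss 1 (x - z))) (map (\<lambda>(x, c). (x, \<psi> c n)) X)) * gauss 0 (0 - z) \<partial>M)"
      by (simp add: comp_def case_prod_unfold gauss_def)
    finally show ?thesis .
  qed
  have mU: "measure P (U X) = measure Q (U X)" for X
  proof (rule LIMSEQ_unique[OF lim[OF P]])
    have "(\<integral>z. prod_list (map (\<lambda>(x, \<phi>). \<phi> (gauss 1 (x - z))) (map (\<lambda>(x, c). (x, \<psi> c n)) X)) * gauss 0 (0 - z) \<partial>P)
       = (\<integral>z. prod_list (map (\<lambda>(x, \<phi>). \<phi> (gauss 1 (x - z))) (map (\<lambda>(x, c). (x, \<psi> c n)) X)) * gauss 0 (0 - z) \<partial>Q)" for n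
    proof (rule gauss_integrals_prod[OF P Q eq])
      fix x \<phi> assume "(x, \<phi>) \<in> set (map (\<lambda>(x, c). (x, \<psi> c n)) X)"
      then obtain c where "\<phi> = \<psi> c n" by auto
      then show "continuous_on UNIV \<phi> \<and> (\<forall>u. \<bar>\<phi> u\<bar> \<le> 1)"
        by (auto simp: \<psi>_def[abs_def] intro!: continuous_intros)
    qed auto
    then show "(\<lambda>n. \<integral>z. prod_list (map (\<lambda>(x, \<phi>). \<phi> (gauss 1 (x - z))) (map (\<lambda>(x, c). (x, \<psi> c n)) X)) * gauss 0 (0 - z) \<partial>P)
      \<longlonglongrightarrow> measure Q (U X)" using lim[OF Q, of X] by simp
  qed
  have gen: "sets borel = sigma_sets UNIV E"
  proof
    have "open S \<Longrightarrow> S \<in> sigma_sets UNIV E" for S :: "'a set"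
    proof -
      assume S: "open S"
      define F where "F = {ball x r | x r. r > 0 \<and> ball x r \<subseteq> S}"
      \<comment> \<open>An open set is an uncountable union of balls at first; second countability
        leaves countably many.\<close>
      obtain F' where F': "F' \<subseteq> F" "countable F'" "\<Union>F' = \<Union>F"
        using Lindelof[of F] by (auto simp: F_def)
      have "\<Union>F = S" using S unfolding F_def by (auto simp: open_contains_ball) (metis centre_in_ball)
      moreover have "B \<in> E" if BF: "B \<in> F" for B
      proof -
        obtain x r where B: "B = ball x r" "r > 0" using BF by (auto simp: F_def)
        have "gauss 1 (x - z) > exp (- r\<^sup>2) \<longleftrightarrow> norm (x - z) < r" for z
          unfolding gauss_def using B(2)
          by (simp, metis less_imp_le norm_ge_zero power2_less_imp_less power_strict_mono zero_less_numeral)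
        then have "ball x r = U [(x, exp (- r\<^sup>2))]" unfolding U_def ball_def dist_norm by simp
        then have "B = U [(x, exp (- r\<^sup>2))]" using B(1) by (rule trans[rotated])
        then show ?thesis by (auto simp: E_def)
      qed
      ultimately have "S = \<Union>F'" "\<And>B. B \<in> F' \<Longrightarrow> B \<in> sigma_sets UNIV E" using F' by auto
      then show ?thesis using sigma_sets_UNION[OF F'(2)] by simp
    qed
    then show "sets borel \<subseteq> sigma_sets UNIV E"
      unfolding borel_def by (subst sets_measure_of) (auto intro!: sigma_sets_mono)
    show "sigma_sets UNIV E \<subseteq> sets borel"
    proof -
      have "E \<subseteq> sets borel" unfolding E_def using Um by (intro image_subsetI)
      then show ?thesis using sets.sigma_sets_subset[of E "borel :: 'a measure"] by simp
    qed
  qed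
  interpret P: prob_space P using P by (rule borel_prob_prob_space)
  interpret Q: prob_space Q using Q by (rule borel_prob_prob_space)
  show ?thesis
  proof (rule measure_eqI_generator_eq[where E = E and \<Omega> = UNIV and A = "\<lambda>_. UNIV"])
    show "Int_stable E"
    proof (rule Int_stableI)
      fix a b assume "a \<in> E" "b \<in> E"
      then obtain X Y where "a = U X" "b = U Y" by (auto simp: E_def)
      then have "a \<inter> b = U (X @ Y)" by (auto simp: U_def)
      then show "a \<inter> b \<in> E" by (auto simp: E_def)
    qed
    show "emeasure P X = emeasure Q X" if "X \<in> E" for X
      using that mU by (auto simp: E_def P.emeasure_eq_measure Q.emeasure_eq_measure)
    have "U [] = UNIV" by (simp add: U_def)
    then show "range (\<lambda>_::nat. UNIV) \<subseteq> E" unfolding E_def by (metis image_subsetI rangeI)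
  qed (use gen borel_prob_sets[OF P] borel_prob_sets[OF Q] P.emeasure_finite in auto)
qed

section \<open>The objective function determines the measure\<close>

lemma integrable_inverse_1_plus_square_lborel: "integrable lborel (\<lambda>x::real. inverse (1 + x\<^sup>2))"
  using integrable_inverse_1_plus_square by (simp add: set_integrable_def einterval_def)

text \<open>Substituting \<open>r * s\<close> for \<open>s\<close> makes the integral proportional
  to \<open>r\<close>, with \<open>K\<close> its value at \<open>r = 1\<close>. It converges because
  the integrand is bounded near 0 and decays like \<open>1 / s^2\<close>. At \<open>s = 0\<close> it
  is 0 by the convention for division.\<close>

lemma gauss_subordination:
  obtains K :: real where "K \<ge> 0"
    "\<And>r. r \<ge> 0 \<Longrightarrow> has_bochner_integral lborel (\<lambda>s. (1 - exp (- (s\<^sup>2 * r\<^sup>2))) / s\<^sup>2) (K * r)"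
proof -
  define g where "g s = (1 - exp (- s\<^sup>2)) / s\<^sup>2" for s :: real
  have [measurable]: "g \<in> borel_measurable borel" unfolding g_def by measurable
  have g0: "0 \<le> g s" for s by (simp add: g_def)
  have gle: "g s \<le> 2 * inverse (1 + s\<^sup>2)" for s
  proof (cases "s = 0")
    case False
    have 1: "1 - exp (- s\<^sup>2) \<le> s\<^sup>2" using exp_ge_add_one_self[of "- s\<^sup>2"] by simp
    have 2: "s\<^sup>2 * (1 - exp (- s\<^sup>2)) \<le> s\<^sup>2 * 1" by (intro mult_left_mono) auto
    have "(1 - exp (- s\<^sup>2)) * (1 + s\<^sup>2) = (1 - exp (- s\<^sup>2)) + s\<^sup>2 * (1 - exp (- s\<^sup>2))"
      by (simp add: algebra_simps)
    also have "\<dots> \<le> 2 * s\<^sup>2" using 1 2 by simp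
    finally have "(1 - exp (- s\<^sup>2)) * (1 + s\<^sup>2) \<le> 2 * s\<^sup>2" .
    moreover have "1 + s\<^sup>2 > 0" by (simp add: add_pos_nonneg)
    ultimately show ?thesis using False unfolding g_def by (simp add: field_simps)
  qed (simp add: g_def)
  have ig: "integrable lborel g"
    by (rule Bochner_Integration.integrable_bound[OF integrable_mult_right[OF integrable_inverse_1_plus_square_lborel, of 2]])
      (use g0 gle in auto)
  define K where "K = integral\<^sup>L lborel g"
  show ?thesis
  proof (rule that[of K])
    show "K \<ge> 0" unfolding K_def using g0 by (intro integral_nonneg_AE) auto
    fix r :: real assume "r \<ge> 0"
    show "has_bochner_integral lborel (\<lambda>s. (1 - exp (- (s\<^sup>2 * r\<^sup>2))) / s\<^sup>2) (K * r)"
    proof (cases "r = 0")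
      case False
      then have r: "r > 0" using \<open>r \<ge> 0\<close> by simp
      have "K = r * (\<integral>s. g (0 + r * s) \<partial>lborel)"
        unfolding K_def using lborel_integral_real_affine[of r g 0] r by simp
      moreover have "integrable lborel (\<lambda>s. g (0 + r * s))"
        using lborel_integrable_real_affine[OF ig, of r 0] r by simp
      ultimately have "has_bochner_integral lborel (\<lambda>s. r\<^sup>2 * g (0 + r * s)) (r\<^sup>2 * (K / r))"
        using r by (intro has_bochner_integral_mult_right) (simp add: has_bochner_integral_iff)
      moreover have "r\<^sup>2 * (K / r) = K * r" using r by (simp add: power2_eq_square)
      moreover have "r\<^sup>2 * g (0 + r * s) = (1 - exp (- (s\<^sup>2 * r\<^sup>2))) / s\<^sup>2" for s
        using r by (simp add: g_def power_mult_distrib mult.commute)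
      ultimately show ?thesis by simp
    qed (simp add: has_bochner_integral_zero)
  qed
qed

section \<open>Correlations and the Gaussian energy of a pair of measures\<close>

definition gauss_corr :: "'a::real_normed_vector measure \<Rightarrow> 'a measure \<Rightarrow> real \<Rightarrow> 'a \<Rightarrow> real" where
  "gauss_corr A B t a = (\<integral>p. gauss t (fst p - snd p + a) \<partial>(A \<Otimes>\<^sub>M B))"

text \<open>Subtracting the norm at shift 0 bounds the integrand by \<open>norm a\<close>, which
  makes it integrable for arbitrary probability measures.\<close>

definition norm_corr :: "'a::real_normed_vector measure \<Rightarrow> 'a measure \<Rightarrow> 'a \<Rightarrow> real" where
  "norm_corr A B a = (\<integral>p. norm (fst p - snd p + a) - norm (fst p - snd p) \<partial>(A \<Otimes>\<^sub>M B))"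

lemma borel_prob_pair: "borel_prob A \<Longrightarrow> borel_prob B \<Longrightarrow> prob_space (A \<Otimes>\<^sub>M B)"
  by (intro prob_space_pair borel_prob_prob_space)

lemma borel_prob_pair_measurable:
  assumes "borel_prob A" "borel_prob B" "f \<in> borel_measurable (borel \<Otimes>\<^sub>M borel)"
  shows "f \<in> borel_measurable (A \<Otimes>\<^sub>M B)"
proof -
  have s: "sets (A \<Otimes>\<^sub>M B) = sets (borel \<Otimes>\<^sub>M borel)"
    using assms by (intro sets_pair_measure_cong borel_prob_sets)
  show ?thesis unfolding measurable_cong_sets[OF s refl] by (rule assms(3))
qed

lemma borel_prob_pair_integrable_bounded:
  fixes f :: "'a::topological_space \<times> 'b::topological_space \<Rightarrow> real"
  assumes A: "borel_prob A" and B: "borel_prob B" and f: "f \<in> borel_measurable (borel \<Otimes>\<^sub>M borel)" and bd: "\<And>p. \<bar>f p\<bar> \<le> C"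
  shows "integrable (A \<Otimes>\<^sub>M B) f"
proof -
  interpret prob_space "A \<Otimes>\<^sub>M B" using A B by (rule borel_prob_pair)
  show ?thesis
    by (rule integrable_const_bound[where B = C, OF _ borel_prob_pair_measurable[OF A B f]]) (use bd in auto)
qed

lemma borel_prob_pair_sigma_finite: "borel_prob A \<Longrightarrow> borel_prob B \<Longrightarrow> pair_sigma_finite A B"
  by (simp add: pair_sigma_finite.intro borel_prob_prob_space prob_space_imp_sigma_finite)

text \<open>Fubini for the subordination formula. The difference of the two Gaussians has constant
  sign in \<open>s\<close>, so its absolute integral is exactly \<open>K\<close> times a difference
  of norms, at most \<open>K * norm a\<close>; this gives integrability on the product.\<close>

lemma norm_corr_subordination:
  fixes A B :: "'a::{real_inner, polish_space} measure"
  assumes A: "borel_prob A" and B: "borel_prob B" and K0: "K \<ge> 0"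
    and K: "\<And>r. r \<ge> 0 \<Longrightarrow> has_bochner_integral lborel (\<lambda>s. (1 - exp (- (s\<^sup>2 * r\<^sup>2))) / s\<^sup>2) (K * r)"
  shows "has_bochner_integral lborel (\<lambda>s. (gauss_corr A B (s\<^sup>2) 0 - gauss_corr A B (s\<^sup>2) a) / s\<^sup>2) (K * norm_corr A B a)"
proof -
  interpret M: prob_space "A \<Otimes>\<^sub>M B" using A B by (rule borel_prob_pair)
  interpret pair_sigma_finite "A \<Otimes>\<^sub>M B" lborel
    by (intro pair_sigma_finite.intro prob_space_imp_sigma_finite sigma_finite_lborel M.prob_space_axioms)
  have [measurable_cong]: "sets A = sets borel" "sets B = sets borel"
    by (rule borel_prob_sets[OF A], rule borel_prob_sets[OF B])
  define F where "F r r' s = (exp (- (s\<^sup>2 * r\<^sup>2)) - exp (- (s\<^sup>2 * r'\<^sup>2))) / s\<^sup>2" for r r' s :: real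
  have F1: "has_bochner_integral lborel (F r r') (K * (r' - r))" if "r \<ge> 0" "r' \<ge> 0" for r r'
  proof -
    have "has_bochner_integral lborel (\<lambda>s. (1 - exp (- (s\<^sup>2 * r'\<^sup>2))) / s\<^sup>2 - (1 - exp (- (s\<^sup>2 * r\<^sup>2))) / s\<^sup>2) (K * r' - K * r)"
      by (intro has_bochner_integral_diff K that)
    then show ?thesis by (simp add: F_def[abs_def] right_diff_distrib flip: diff_divide_distrib)
  qed
  have F2: "(\<integral>s. norm (F r r' s) \<partial>lborel) = K * \<bar>r' - r\<bar>" if "r \<ge> 0" "r' \<ge> 0" for r r'
  proof -
    have pos: "norm (F r r' s) = F r r' s" if "0 \<le> r" "r \<le> r'" for r r' s
    proof -
      have "s\<^sup>2 * r\<^sup>2 \<le> s\<^sup>2 * r'\<^sup>2" using that by (intro mult_left_mono power_mono) auto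
      then show ?thesis by (simp add: F_def)
    qed
    have sym: "norm (F r r' s) = norm (F r' r s)" for s
      unfolding F_def by (simp add: abs_minus_commute)
    show ?thesis
    proof (cases "r \<le> r'")
      case True
      then show ?thesis using pos[of r r'] that F1[OF that] by (simp add: has_bochner_integral_iff)
    next
      case False
      then show ?thesis unfolding sym using pos[of r' r] that F1[OF that(2,1)] by (simp add: has_bochner_integral_iff)
    qed
  qed
  let ?y = "\<lambda>p::'a \<times> 'a. fst p - snd p"
  define f where "f = (\<lambda>(p, s). F (norm (?y p)) (norm (?y p + a)) s)"
  have f_gauss: "f (p, s) = (gauss (s\<^sup>2) (?y p + 0) - gauss (s\<^sup>2) (?y p + a)) / s\<^sup>2" for p s
    by (simp add: f_def F_def gauss_def)
  have bd: "\<bar>norm (?y p + a) - norm (?y p)\<bar> \<le> norm a" for p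
    using norm_triangle_ineq3[of "?y p + a" "?y p"] by simp
  have int: "integrable ((A \<Otimes>\<^sub>M B) \<Otimes>\<^sub>M lborel) f"
  proof (rule Fubini_integrable)
    show "f \<in> borel_measurable ((A \<Otimes>\<^sub>M B) \<Otimes>\<^sub>M lborel)" unfolding f_def F_def by measurable
    have "integrable (A \<Otimes>\<^sub>M B) (\<lambda>p. K * \<bar>norm (?y p + a) - norm (?y p)\<bar>)"
      by (intro integrable_mult_right borel_prob_pair_integrable_bounded[OF A B, of _ "norm a"]) (use bd in auto)
    then show "integrable (A \<Otimes>\<^sub>M B) (\<lambda>p. \<integral>s. norm (f (p, s)) \<partial>lborel)"
      by (simp add: f_def F2[unfolded real_norm_def])
    show "AE p in A \<Otimes>\<^sub>M B. integrable lborel (\<lambda>s. f (p, s))"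
      using F1 by (auto simp: f_def has_bochner_integral_iff)
  qed
  have gi: "integrable (A \<Otimes>\<^sub>M B) (\<lambda>p. gauss (s\<^sup>2) (?y p + b))" for s b
    by (rule borel_prob_pair_integrable_bounded[OF A B, of _ 1]) (auto simp: abs_gauss)
  have s_int: "(\<integral>p. f (p, s) \<partial>(A \<Otimes>\<^sub>M B)) = (gauss_corr A B (s\<^sup>2) 0 - gauss_corr A B (s\<^sup>2) a) / s\<^sup>2" for s
    unfolding f_gauss gauss_corr_def integral_divide_zero
    by (subst Bochner_Integration.integral_diff[OF gi gi]) (rule refl)
  have "integrable lborel (\<lambda>s. \<integral>p. f (p, s) \<partial>(A \<Otimes>\<^sub>M B))"
    using integrable_snd[of "\<lambda>p s. f (p, s)"] int by simp
  moreover have "(\<integral>s. (\<integral>p. f (p, s) \<partial>(A \<Otimes>\<^sub>M B)) \<partial>lborel) = (\<integral>p. (\<integral>s. f (p, s) \<partial>lborel) \<partial>(A \<Otimes>\<^sub>M B))"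
    using Fubini_integral[of "\<lambda>p s. f (p, s)"] int by simp
  moreover have "(\<integral>s. f (p, s) \<partial>lborel) = K * (norm (?y p + a) - norm (?y p))" for p
    unfolding f_def case_prod_conv using F1 by (intro has_bochner_integral_integral_eq) auto
  ultimately show ?thesis unfolding s_int norm_corr_def by (simp add: has_bochner_integral_iff)
qed

lemma spatial_objective_integrable:
  fixes P :: "'a::{real_inner, banach, polish_space} measure"
  assumes "borel_prob P"
  shows "integrable P (\<lambda>z. norm (x - z) - norm z)"
proof (rule borel_prob_integrable_bounded[OF assms])
  show "norm (norm (x - z) - norm z) \<le> norm x" for z
    using norm_triangle_ineq3[of "x - z" "- z"] by simp
qed measurable

lemma spatial_objective_diff:
  fixes P :: "'a::{real_inner, banach, polish_space} measure"
  assumes "borel_prob P"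
  shows "integrable P (\<lambda>z. norm (y - z) - norm (x - z))"
    "spatial_objective P y - spatial_objective P x = (\<integral>z. norm (y - z) - norm (x - z) \<partial>P)"
proof -
  note i = spatial_objective_integrable[OF assms]
  show "integrable P (\<lambda>z. norm (y - z) - norm (x - z))"
    using Bochner_Integration.integrable_diff[OF i[of y] i[of x]] by simp
  show "spatial_objective P y - spatial_objective P x = (\<integral>z. norm (y - z) - norm (x - z) \<partial>P)"
    unfolding spatial_objective_def by (subst Bochner_Integration.integral_diff[symmetric, OF i i]) simp
qed

text \<open>This is how the objectives enter: \<open>B\<close> contributes only through increments
  of its objective, so measures whose objectives differ by a constant have the same correlation with
  every \<open>A\<close>.\<close>

lemma norm_corr_eq:
  fixes A B :: "'a::{real_inner, banach, polish_space} measure"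
  assumes A: "borel_prob A" and B: "borel_prob B"
  shows "norm_corr A B a = (\<integral>x. spatial_objective B (x + a) - spatial_objective B x \<partial>A)"
proof -
  interpret pair_sigma_finite A B using A B by (rule borel_prob_pair_sigma_finite)
  let ?f = "\<lambda>p. norm (fst p - snd p + a) - norm (fst p - snd p)"
  have "\<bar>?f p\<bar> \<le> norm a" for p
    using norm_triangle_ineq3[of "fst p - snd p + a" "fst p - snd p"] by simp
  then have "integrable (A \<Otimes>\<^sub>M B) ?f"
    by (intro borel_prob_pair_integrable_bounded[OF A B, of _ "norm a"]) auto
  from integral_fst'[OF this]
  have "norm_corr A B a = (\<integral>x. (\<integral>z. norm (x - z + a) - norm (x - z) \<partial>B) \<partial>A)"
    by (simp add: norm_corr_def)
  also have "(\<lambda>x. \<integral>z. norm (x - z + a) - norm (x - z) \<partial>B) = (\<lambda>x. spatial_objective B (x + a) - spatial_objective B x)"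
    unfolding spatial_objective_diff(2)[OF B] by (simp add: algebra_simps)
  finally show ?thesis .
qed

text \<open>A product of means is a mean over the product measure, and the uniform bound on the
  partial kernels permits the limit. The two shifts survive only as \<open>a - b\<close> because the
  Gaussian sees differences.\<close>

lemma gauss_corr_features:
  fixes A B :: "'a::{real_inner, polish_space} measure"
  assumes A: "borel_prob A" and B: "borel_prob B"
    and \<phi>: "\<And>l. \<phi> l \<in> borel_measurable borel" "\<And>l x. \<bar>\<phi> l x\<bar> \<le> 1"
    and lim: "\<And>x z. (\<lambda>N. \<Sum>l\<in>L N. \<phi> l x * \<phi> l z) \<longlonglongrightarrow> gauss t (x - z)"
    and bd: "\<And>N x z. \<bar>\<Sum>l\<in>L N. \<phi> l x * \<phi> l z\<bar> \<le> 1"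
  shows "(\<lambda>N. \<Sum>l\<in>L N. (\<integral>x. \<phi> l (x + a) \<partial>A) * (\<integral>z. \<phi> l (z + b) \<partial>B)) \<longlonglongrightarrow> gauss_corr A B t (a - b)"
proof -
  interpret pair_sigma_finite A B using A B by (rule borel_prob_pair_sigma_finite)
  interpret M: prob_space "A \<Otimes>\<^sub>M B" using A B by (rule borel_prob_pair)
  note [measurable] = \<phi>(1)
  have i: "integrable (A \<Otimes>\<^sub>M B) (\<lambda>p. \<phi> l (fst p + a) * \<phi> l (snd p + b))" for l
    by (rule borel_prob_pair_integrable_bounded[OF A B, of _ 1]) (auto simp: abs_mult \<phi>(2) intro!: mult_le_one)
  have "(\<integral>x. \<phi> l (x + a) \<partial>A) * (\<integral>z. \<phi> l (z + b) \<partial>B) = (\<integral>p. \<phi> l (fst p + a) * \<phi> l (snd p + b) \<partial>(A \<Otimes>\<^sub>M B))" for l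
    using integral_fst'[OF i[of l]] by simp
  then have "(\<lambda>N. \<Sum>l\<in>L N. (\<integral>x. \<phi> l (x + a) \<partial>A) * (\<integral>z. \<phi> l (z + b) \<partial>B))
      = (\<lambda>N. \<integral>p. (\<Sum>l\<in>L N. \<phi> l (fst p + a) * \<phi> l (snd p + b)) \<partial>(A \<Otimes>\<^sub>M B))"
    using i by simp
  also have "\<dots> \<longlonglongrightarrow> (\<integral>p. gauss t ((fst p + a) - (snd p + b)) \<partial>(A \<Otimes>\<^sub>M B))"
  proof (rule integral_dominated_convergence[where w = "\<lambda>_. 1"])
    show "(\<lambda>p. gauss t (fst p + a - (snd p + b))) \<in> borel_measurable (A \<Otimes>\<^sub>M B)"
      by (rule borel_prob_pair_measurable[OF A B]) measurable
    show "(\<lambda>p. \<Sum>l\<in>L N. \<phi> l (fst p + a) * \<phi> l (snd p + b)) \<in> borel_measurable (A \<Otimes>\<^sub>M B)" for N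
      by (rule borel_prob_pair_measurable[OF A B]) measurable
  qed (use lim bd in auto)
  also have "(\<integral>p. gauss t ((fst p + a) - (snd p + b)) \<partial>(A \<Otimes>\<^sub>M B)) = gauss_corr A B t (a - b)"
    by (simp add: gauss_corr_def algebra_simps)
  finally show ?thesis .
qed

text \<open>Pairing of the signed measure \<mu> = P - Q with its translate by \<open>a\<close> under
  the Gaussian kernel; at \<open>a = 0\<close> it is the squared norm of the mean feature vector of
  \<mu>.\<close>

definition gauss_energy :: "'a::real_normed_vector measure \<Rightarrow> 'a measure \<Rightarrow> real \<Rightarrow> 'a \<Rightarrow> real" where
  "gauss_energy P Q t a = gauss_corr P P t a + gauss_corr Q Q t a - gauss_corr P Q t a - gauss_corr Q P t a"

text \<open>In terms of mean feature vectors this is the squared norm of the vector of \<mu> = P - Q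
  minus the vector of its translate by \<open>a\<close>.\<close>

lemma gauss_energy_second_difference_nonneg:
  fixes P Q :: "'a::{real_inner, polish_space} measure"
  assumes P: "borel_prob P" and Q: "borel_prob Q" and t: "t > 0"
  shows "0 \<le> 2 * gauss_energy P Q t 0 - gauss_energy P Q t a - gauss_energy P Q t (- a)"
proof -
  obtain \<phi> :: "nat list \<Rightarrow> 'a \<Rightarrow> real" and L where f: "\<And>l. \<phi> l \<in> borel_measurable borel" "\<And>l x. \<bar>\<phi> l x\<bar> \<le> 1"
    "\<And>N. finite (L N)" "\<And>l. \<forall>\<^sub>F N in sequentially. l \<in> L N"
    "\<And>x z. (\<lambda>N. \<Sum>l\<in>L N. \<phi> l x * \<phi> l z) \<longlonglongrightarrow> gauss t (x - z)"
    "\<And>N x z. \<bar>\<Sum>l\<in>L N. \<phi> l x * \<phi> l z\<bar> \<le> 1"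
    using gauss_features[OF t, where 'a = 'a] by blast
  define p where "p a l = (\<integral>x. \<phi> l (x + a) \<partial>P)" for a l
  define q where "q a l = (\<integral>x. \<phi> l (x + a) \<partial>Q)" for a l
  note lim = gauss_corr_features[OF _ _ f(1,2,5,6)]
  have PP: "(\<lambda>N. \<Sum>l\<in>L N. p a l * p b l) \<longlonglongrightarrow> gauss_corr P P t (a - b)"
   and PQ: "(\<lambda>N. \<Sum>l\<in>L N. p a l * q b l) \<longlonglongrightarrow> gauss_corr P Q t (a - b)"
   and QP: "(\<lambda>N. \<Sum>l\<in>L N. q a l * p b l) \<longlonglongrightarrow> gauss_corr Q P t (a - b)"
   and QQ: "(\<lambda>N. \<Sum>l\<in>L N. q a l * q b l) \<longlonglongrightarrow> gauss_corr Q Q t (a - b)" for a b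
    unfolding p_def q_def by (rule lim P Q)+
  let ?S = "\<lambda>u v N. \<Sum>l\<in>L N. u l * v l"
  have "(\<lambda>N. ?S (p 0) (p 0) N + ?S (p a) (p a) N - ?S (p 0) (p a) N - ?S (p a) (p 0) N
     + (?S (q 0) (q 0) N + ?S (q a) (q a) N - ?S (q 0) (q a) N - ?S (q a) (q 0) N)
     - (?S (p 0) (q 0) N + ?S (p a) (q a) N - ?S (p 0) (q a) N - ?S (p a) (q 0) N)
     - (?S (q 0) (p 0) N + ?S (q a) (p a) N - ?S (q 0) (p a) N - ?S (q a) (p 0) N))
     \<longlonglongrightarrow>
       gauss_corr P P t (0 - 0) + gauss_corr P P t (a - a) - gauss_corr P P t (0 - a) - gauss_corr P P t (a - 0)
     + (gauss_corr Q Q t (0 - 0) + gauss_corr Q Q t (a - a) - gauss_corr Q Q t (0 - a) - gauss_corr Q Q t (a - 0))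
     - (gauss_corr P Q t (0 - 0) + gauss_corr P Q t (a - a) - gauss_corr P Q t (0 - a) - gauss_corr P Q t (a - 0))
     - (gauss_corr Q P t (0 - 0) + gauss_corr Q P t (a - a) - gauss_corr Q P t (0 - a) - gauss_corr Q P t (a - 0))"
    by (intro tendsto_add tendsto_diff PP PQ QP QQ)
  moreover have "?S (p 0) (p 0) N + ?S (p a) (p a) N - ?S (p 0) (p a) N - ?S (p a) (p 0) N
     + (?S (q 0) (q 0) N + ?S (q a) (q a) N - ?S (q 0) (q a) N - ?S (q a) (q 0) N)
     - (?S (p 0) (q 0) N + ?S (p a) (q a) N - ?S (p 0) (q a) N - ?S (p a) (q 0) N)
     - (?S (q 0) (p 0) N + ?S (q a) (p a) N - ?S (q 0) (p a) N - ?S (q a) (p 0) N)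
     = (\<Sum>l\<in>L N. (p 0 l - p a l - q 0 l + q a l)\<^sup>2)" for N
    unfolding sum.distrib[symmetric] sum_subtractf[symmetric]
    by (intro sum.cong refl) (simp add: power2_eq_square algebra_simps)
  ultimately have "(\<lambda>N. \<Sum>l\<in>L N. (p 0 l - p a l - q 0 l + q a l)\<^sup>2) \<longlonglongrightarrow>
      2 * gauss_energy P Q t 0 - gauss_energy P Q t a - gauss_energy P Q t (- a)"
    by (simp add: gauss_energy_def algebra_simps)
  then show ?thesis by (rule LIMSEQ_le_const) (intro exI[of _ 0] allI impI sum_nonneg zero_le_power2)
qed

text \<open>Sums of squares with limit 0 over growing index sets have only zero terms, so
  \<open>P\<close> and \<open>Q\<close> share all mean features; Gaussian integrals are limits of
  combinations of these.\<close>

lemma gauss_energy_eq_0D: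
  fixes P Q :: "'a::{real_inner, polish_space} measure"
  assumes P: "borel_prob P" and Q: "borel_prob Q" and t: "t > 0"
    and E: "gauss_energy P Q t 0 = 0"
  shows "(\<integral>z. gauss t (x - z) \<partial>P) = (\<integral>z. gauss t (x - z) \<partial>Q)"
proof -
  obtain \<phi> :: "nat list \<Rightarrow> 'a \<Rightarrow> real" and L where f: "\<And>l. \<phi> l \<in> borel_measurable borel" "\<And>l x. \<bar>\<phi> l x\<bar> \<le> 1"
    "\<And>N. finite (L N)" "\<And>l. \<forall>\<^sub>F N in sequentially. l \<in> L N"
    "\<And>x z. (\<lambda>N. \<Sum>l\<in>L N. \<phi> l x * \<phi> l z) \<longlonglongrightarrow> gauss t (x - z)"
    "\<And>N x z. \<bar>\<Sum>l\<in>L N. \<phi> l x * \<phi> l z\<bar> \<le> 1"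
    using gauss_features[OF t, where 'a = 'a] by blast
  define p where "p l = (\<integral>x. \<phi> l (x + 0) \<partial>P)" for l
  define q where "q l = (\<integral>x. \<phi> l (x + 0) \<partial>Q)" for l
  note lim = gauss_corr_features[OF _ _ f(1,2,5,6), where a = 0 and b = 0]
  have "(\<lambda>N. (\<Sum>l\<in>L N. p l * p l) + (\<Sum>l\<in>L N. q l * q l) - (\<Sum>l\<in>L N. p l * q l) - (\<Sum>l\<in>L N. q l * p l))
    \<longlonglongrightarrow> gauss_corr P P t (0 - 0) + gauss_corr Q Q t (0 - 0) - gauss_corr P Q t (0 - 0) - gauss_corr Q P t (0 - 0)"
    unfolding p_def q_def by (intro tendsto_add tendsto_diff lim P Q)
  moreover have "(\<Sum>l\<in>L N. p l * p l) + (\<Sum>l\<in>L N. q l * q l) - (\<Sum>l\<in>L N. p l * q l) - (\<Sum>l\<in>L N. q l * p l)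
      = (\<Sum>l\<in>L N. (p l - q l)\<^sup>2)" for N
    unfolding sum.distrib[symmetric] sum_subtractf[symmetric]
    by (intro sum.cong refl) (simp add: power2_eq_square algebra_simps)
  ultimately have l0: "(\<lambda>N. \<Sum>l\<in>L N. (p l - q l)\<^sup>2) \<longlonglongrightarrow> 0" using E by (simp add: gauss_energy_def)
  have "p l = q l" for l
  proof -
    have "(p l - q l)\<^sup>2 \<le> 0"
    proof (rule tendsto_lowerbound[OF l0])
      show "\<forall>\<^sub>F N in sequentially. (p l - q l)\<^sup>2 \<le> (\<Sum>l\<in>L N. (p l - q l)\<^sup>2)"
        using f(4)[of l] by eventually_elim (auto intro: member_le_sum simp: f(3))
    qed simp
    then show ?thesis by simp
  qed
  then have pq: "p = q" by auto
  have lim: "(\<lambda>N. \<Sum>l\<in>L N. \<phi> l x * (\<integral>z. \<phi> l (z + 0) \<partial>M)) \<longlonglongrightarrow> (\<integral>z. gauss t (x - z) \<partial>M)"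
    if M: "borel_prob M" for M
  proof -
    interpret prob_space M using M by (rule borel_prob_prob_space)
    note [measurable] = f(1)
    have [measurable_cong]: "sets M = sets borel" using M by (rule borel_prob_sets)
    have i: "integrable M (\<phi> l)" for l
      by (rule borel_prob_integrable_bounded[OF M f(1), of l 1]) (simp add: f(2))
    have "(\<lambda>N. \<integral>z. (\<Sum>l\<in>L N. \<phi> l x * \<phi> l z) \<partial>M) \<longlonglongrightarrow> (\<integral>z. gauss t (x - z) \<partial>M)"
      by (rule integral_dominated_convergence[where w = "\<lambda>_. 1"]) (use f(5,6) in auto)
    moreover have "(\<integral>z. (\<Sum>l\<in>L N. \<phi> l x * \<phi> l z) \<partial>M) = (\<Sum>l\<in>L N. \<phi> l x * (\<integral>z. \<phi> l (z + 0) \<partial>M))" for N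
      using i by simp
    ultimately show ?thesis by simp
  qed
  have "(\<integral>z. \<phi> l (z + 0) \<partial>P) = (\<integral>z. \<phi> l (z + 0) \<partial>Q)" for l
    using fun_cong[OF pq, of l] by (simp only: p_def q_def)
  then have "(\<lambda>N. \<Sum>l\<in>L N. \<phi> l x * (\<integral>z. \<phi> l (z + 0) \<partial>P)) \<longlonglongrightarrow> (\<integral>z. gauss t (x - z) \<partial>Q)"
    using lim[OF Q] by (simp only:)
  from LIMSEQ_unique[OF lim[OF P] this] show ?thesis .
qed

text \<open>The kernel forgets mass that is moved to infinity along \<open>v\<close>: its values
  tend to 0 and are dominated by 1.\<close>

lemma gauss_energy_tendsto_0:
  fixes P Q :: "'a::{real_inner, polish_space} measure"
  assumes P: "borel_prob P" and Q: "borel_prob Q" and t: "t > 0" and v: "v \<noteq> 0"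
  shows "(\<lambda>n. gauss_energy P Q t (real n *\<^sub>R v)) \<longlonglongrightarrow> 0"
proof -
  have "(\<lambda>n. gauss_corr A B t (real n *\<^sub>R v)) \<longlonglongrightarrow> (\<integral>p. 0 \<partial>(A \<Otimes>\<^sub>M B))"
    if A: "borel_prob A" and B: "borel_prob B" for A B :: "'a measure"
    unfolding gauss_corr_def
  proof (rule integral_dominated_convergence[where w = "\<lambda>_. 1"])
    interpret prob_space "A \<Otimes>\<^sub>M B" using A B by (rule borel_prob_pair)
    show "integrable (A \<Otimes>\<^sub>M B) (\<lambda>_. 1::real)" by simp
    show "(\<lambda>p. gauss t (fst p - snd p + real n *\<^sub>R v)) \<in> borel_measurable (A \<Otimes>\<^sub>M B)" for n
      by (rule borel_prob_pair_measurable[OF A B]) measurable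
    have "(\<lambda>n. gauss t (y + real n *\<^sub>R v)) \<longlonglongrightarrow> 0" for y
    proof -
      have "filterlim (\<lambda>n. real n * norm v) at_top sequentially"
        using v by (intro filterlim_tendsto_pos_mult_at_top[OF tendsto_const] filterlim_real_sequentially filterlim_at_top_mult_tendsto_pos) auto
      then have "filterlim (\<lambda>n. - norm y + real n * norm v) at_top sequentially"
        by (rule filterlim_tendsto_add_at_top[OF tendsto_const])
      then have "filterlim (\<lambda>n. norm (y + real n *\<^sub>R v)) at_top sequentially"
      proof (rule filterlim_at_top_mono, intro always_eventually allI)
        fix n
        show "- norm y + real n * norm v \<le> norm (y + real n *\<^sub>R v)"
          using norm_diff_ineq[of "real n *\<^sub>R v" y] by (simp add: add.commute)
      qed
      then have "filterlim (\<lambda>n. t * (norm (y + real n *\<^sub>R v))\<^sup>2) at_top sequentially"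
        using t by (intro filterlim_tendsto_pos_mult_at_top[OF tendsto_const] filterlim_pow_at_top) auto
      then show ?thesis unfolding gauss_def
        by (intro filterlim_compose[OF exp_at_bot] filterlim_uminus_at_bot_at_top[THEN filterlim_compose])
    qed
    then show "AE p in A \<Otimes>\<^sub>M B. (\<lambda>n. gauss t (fst p - snd p + real n *\<^sub>R v)) \<longlonglongrightarrow> 0" by simp
    show "AE p in A \<Otimes>\<^sub>M B. norm (gauss t (fst p - snd p + real n *\<^sub>R v)) \<le> 1" for n
      using t by (simp add: abs_gauss)
  qed simp
  then have c: "(\<lambda>n. gauss_corr A B t (real n *\<^sub>R v)) \<longlonglongrightarrow> 0"
    if "borel_prob A" "borel_prob B" for A B :: "'a measure" using that by simp
  have "(\<lambda>n. gauss_energy P Q t (real n *\<^sub>R v)) \<longlonglongrightarrow> 0 + 0 - 0 - 0"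
    unfolding gauss_energy_def by (intro tendsto_add tendsto_diff c P Q)
  then show ?thesis by simp
qed

text \<open>
  With \<open>\<mu> = P - Q\<close>, the nonnegative second differences of the Gaussian energy of \<open>\<mu>\<close>,
  integrated over all scales, add up to a second difference of \<open>\<integral>\<integral> \<parallel>x - z + a\<parallel> d\<mu> d\<mu> = 0\<close>, so they
  vanish; letting the shift tend to infinity shows that the energy itself vanishes.
\<close>

theorem spatial_objective_inj:
  fixes P Q :: "'a::{real_inner, banach, polish_space} measure"
  assumes P: "borel_prob P" and Q: "borel_prob Q"
    and eq: "\<And>x. spatial_objective P x - spatial_objective Q x = c"
    and v: "(v::'a) \<noteq> 0"
  shows "P = Q"
proof (rule gauss_integrals_eqI[OF P Q])
  obtain K :: real where K: "K \<ge> 0" "\<And>r. r \<ge> 0 \<Longrightarrow> has_bochner_integral lborel (\<lambda>s. (1 - exp (- (s\<^sup>2 * r\<^sup>2))) / s\<^sup>2) (K * r)"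
    using gauss_subordination by blast
  have eq': "spatial_objective P y - spatial_objective P x = spatial_objective Q y - spatial_objective Q x" for x y
    using eq[of x] eq[of y] by simp
  have W: "norm_corr A P a = norm_corr A Q a" if "borel_prob A" for A a
    unfolding norm_corr_eq[OF that P] norm_corr_eq[OF that Q] eq' ..
  \<comment> \<open>By \<open>W\<close> with \<open>A = P\<close> and with \<open>A = Q\<close>, the
    four norm correlations cancel in pairs.\<close>
  have E: "has_bochner_integral lborel (\<lambda>s. (gauss_energy P Q (s\<^sup>2) 0 - gauss_energy P Q (s\<^sup>2) a) / s\<^sup>2) 0" for a
  proof -
    let ?I = "\<lambda>A B s. (gauss_corr A B (s\<^sup>2) 0 - gauss_corr A B (s\<^sup>2) a) / s\<^sup>2"
    have "has_bochner_integral lborel (\<lambda>s. ?I P P s + ?I Q Q s - ?I P Q s - ?I Q P s)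
      (K * norm_corr P P a + K * norm_corr Q Q a - K * norm_corr P Q a - K * norm_corr Q P a)"
      by (intro has_bochner_integral_diff has_bochner_integral_add norm_corr_subordination P Q K)
    also have "K * norm_corr P P a + K * norm_corr Q Q a - K * norm_corr P Q a - K * norm_corr Q P a = 0"
      using W[OF P, of a] W[OF Q, of a] by simp
    also have "(\<lambda>s. ?I P P s + ?I Q Q s - ?I P Q s - ?I Q P s)
        = (\<lambda>s. (gauss_energy P Q (s\<^sup>2) 0 - gauss_energy P Q (s\<^sup>2) a) / s\<^sup>2)"
      by (simp add: gauss_energy_def diff_divide_distrib add_divide_distrib fun_eq_iff)
    finally show ?thesis .
  qed
  define J where "J a s = 2 * gauss_energy P Q (s\<^sup>2) 0 - gauss_energy P Q (s\<^sup>2) a - gauss_energy P Q (s\<^sup>2) (- a)" for a s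
  have J0: "AE s in lborel. J a s / s\<^sup>2 = 0" for a
  proof -
    have "has_bochner_integral lborel (\<lambda>s. (gauss_energy P Q (s\<^sup>2) 0 - gauss_energy P Q (s\<^sup>2) a) / s\<^sup>2
        + (gauss_energy P Q (s\<^sup>2) 0 - gauss_energy P Q (s\<^sup>2) (- a)) / s\<^sup>2) (0 + 0)"
      by (intro has_bochner_integral_add E)
    then have "has_bochner_integral lborel (\<lambda>s. J a s / s\<^sup>2) 0"
      by (simp add: J_def[abs_def] algebra_simps flip: add_divide_distrib)
    moreover have "0 \<le> J a s / s\<^sup>2" for s
      using gauss_energy_second_difference_nonneg[OF P Q, of "s\<^sup>2" a] unfolding J_def
      by (cases "s = 0") auto
    ultimately show ?thesis
      using integral_nonneg_eq_0_iff_AE[of lborel "\<lambda>s. J a s / s\<^sup>2"] by (simp add: has_bochner_integral_iff)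
  qed
  have good: "AE s in lborel. gauss_energy P Q (s\<^sup>2) 0 = 0 \<or> s = 0"
  proof -
    \<comment> \<open>Only the countably many shifts \<open>real n *\<^sub>R v\<close> are used, so
      one null set of scales serves all of them.\<close>
    have "AE s in lborel. \<forall>n. J (real n *\<^sub>R v) s / s\<^sup>2 = 0" unfolding AE_all_countable using J0 by blast
    then show ?thesis
    proof eventually_elim
      case (elim s)
      show ?case
      proof (cases "s = 0")
        case False
        then have s: "s\<^sup>2 > 0" by simp
        have "(\<lambda>n. J (real n *\<^sub>R v) s) \<longlonglongrightarrow> 2 * gauss_energy P Q (s\<^sup>2) 0 - 0 - 0"
          unfolding J_def using gauss_energy_tendsto_0[OF P Q s v] gauss_energy_tendsto_0[OF P Q s, of "- v"] v
          by (intro tendsto_diff tendsto_const) auto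
        moreover have "J (real n *\<^sub>R v) s = 0" for n using elim False by simp
        ultimately have "(\<lambda>n. 0) \<longlonglongrightarrow> 2 * gauss_energy P Q (s\<^sup>2) 0 - 0 - 0" by simp
        from LIMSEQ_unique[OF this tendsto_const] show ?thesis by simp
      qed simp
    qed
  qed
  fix t :: real and x :: 'a assume t: "t > 0"
  \<comment> \<open>A null set contains no interval, so every scale is approached from above by
    scales of zero energy; continuity of the Gaussian integrals in the scale then reaches
    \<open>t\<close> itself.\<close>
  have "\<exists>s. sqrt t < s \<and> s < sqrt t + 1 / real (Suc n) \<and> gauss_energy P Q (s\<^sup>2) 0 = 0" for n
  proof (rule ccontr)
    assume neg: "\<not> ?thesis"
    have "AE s in lborel. s \<notin> {sqrt t <..< sqrt t + 1 / real (Suc n)}"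
      using good
    proof eventually_elim
      case (elim s)
      have "sqrt t > 0" using t by simp
      then show ?case using elim neg by auto
    qed
    then have "{sqrt t <..< sqrt t + 1 / real (Suc n)} \<in> null_sets lborel"
      by (subst AE_iff_null_sets) auto
    then have "emeasure lborel {sqrt t <..< sqrt t + 1 / real (Suc n)} = 0" by (rule null_setsD1)
    then show False by (subst (asm) emeasure_lborel_Ioo) auto
  qed
  then obtain s where s: "\<And>n. sqrt t < s n" "\<And>n. s n < sqrt t + 1 / real (Suc n)" "\<And>n. gauss_energy P Q ((s n)\<^sup>2) 0 = 0"
    by metis
  have "s \<longlonglongrightarrow> sqrt t"
  proof (rule tendsto_sandwich[OF _ _ tendsto_const])
    have "(\<lambda>n. sqrt t + 1 / real (Suc n)) \<longlonglongrightarrow> sqrt t + 0"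
      by (intro tendsto_intros LIMSEQ_Suc[OF lim_inverse_n'])
    then show "(\<lambda>n. sqrt t + 1 / real (Suc n)) \<longlonglongrightarrow> sqrt t" by simp
  qed (intro always_eventually allI less_imp_le s)+
  then have "(\<lambda>n. (s n)\<^sup>2) \<longlonglongrightarrow> (sqrt t)\<^sup>2" by (rule tendsto_power)
  then have st: "(\<lambda>n. (s n)\<^sup>2) \<longlonglongrightarrow> t" using t by simp
  have lim: "(\<lambda>n. \<integral>z. gauss ((s n)\<^sup>2) (x - z) \<partial>M) \<longlonglongrightarrow> (\<integral>z. gauss t (x - z) \<partial>M)" if M: "borel_prob M" for M
  proof (rule integral_dominated_convergence[where w = "\<lambda>_. 1"])
    interpret prob_space M using M by (rule borel_prob_prob_space)
    have [measurable_cong]: "sets M = sets borel" using M by (rule borel_prob_sets)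
    show "(\<lambda>z. gauss t (x - z)) \<in> borel_measurable M" "(\<lambda>z. gauss ((s n)\<^sup>2) (x - z)) \<in> borel_measurable M" for n
      by measurable
    show "integrable M (\<lambda>_. 1::real)" by simp
    have "(\<lambda>n. gauss ((s n)\<^sup>2) (x - z)) \<longlonglongrightarrow> gauss t (x - z)" for z
      unfolding gauss_def by (intro tendsto_intros st)
    then show "AE z in M. (\<lambda>n. gauss ((s n)\<^sup>2) (x - z)) \<longlonglongrightarrow> gauss t (x - z)" by simp
  qed (simp add: abs_gauss)
  have "(s n)\<^sup>2 > 0" for n 
    by (rule zero_less_power, rule less_trans[OF real_sqrt_gt_zero[OF t] s(1)])
  then have "(\<integral>z. gauss ((s n)\<^sup>2) (x - z) \<partial>P) = (\<integral>z. gauss ((s n)\<^sup>2) (x - z) \<partial>Q)" for n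
    by (intro gauss_energy_eq_0D[OF P Q _ s(3)])
  then show "(\<integral>z. gauss t (x - z) \<partial>P) = (\<integral>z. gauss t (x - z) \<partial>Q)"
    by (intro LIMSEQ_unique[OF lim[OF P]]) (simp only: lim[OF Q])
qed

section \<open>Proximal sequences of convex functions\<close>

definition subgrad :: "('a::real_inner \<Rightarrow> real) \<Rightarrow> 'a \<Rightarrow> 'a \<Rightarrow> bool" where
  "subgrad f x u \<longleftrightarrow> (\<forall>y. f x + inner u (y - x) \<le> f y)"

lemma subgradD: "subgrad f x u \<Longrightarrow> f x + inner u (y - x) \<le> f y"
  by (simp add: subgrad_def)

lemma subgrad_mono:
  assumes "subgrad f x u" "subgrad f y v"
  shows "0 \<le> inner (u - v) (x - y)"
  using subgradD[OF assms(1), of y] subgradD[OF assms(2), of x]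
  by (simp add: inner_diff_left inner_diff_right)

lemma subgrad_add:
  assumes "subgrad f x u" "subgrad g x v"
  shows "subgrad (\<lambda>x. f x + g x) x (u + v)"
  unfolding subgrad_def
proof
  fix y
  show "f x + g x + inner (u + v) (y - x) \<le> f y + g y"
    using subgradD[OF assms(1), of y] subgradD[OF assms(2), of y] by (simp add: inner_add_left)
qed

text \<open>The claim is the Euler condition at the minimizer of \<open>G\<close>. Bounded sequences
  need not have convergent subsequences, but the quadratic term makes \<open>G\<close> strongly
  convex, so minimizing sequences are Cauchy.\<close>

lemma proximal_point:
  fixes f :: "'a::{real_inner, complete_space} \<Rightarrow> real"
  assumes cvx: "convex_on UNIV f" and lip: "L-lipschitz_on UNIV f" and lam: "\<tau> > 0"
  obtains y where "subgrad f y ((x - y) /\<^sub>R \<tau>)"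
proof -
  define G where "G y = f y + (norm (y - x))\<^sup>2 / (2 * \<tau>)" for y
  have L: "L \<ge> 0" using lip lipschitz_on_nonneg by blast
  have lip': "\<bar>f a - f b\<bar> \<le> L * norm (a - b)" for a b
    using lipschitz_onD[OF lip, of a b] by (simp add: dist_norm)
  \<comment> \<open>The quadratic term beats the Lipschitz bound; the constant comes from completing
    the square in \<open>norm (y - x)\<close>, with the worst case at
    \<open>L * \<tau>\<close>.\<close>
  have lower: "f x - L\<^sup>2 * \<tau> / 2 \<le> G y" for y
  proof -
    have "0 \<le> (norm (y - x) - L * \<tau>)\<^sup>2 / (2 * \<tau>)" using lam by simp
    also have "\<dots> = (norm (y - x))\<^sup>2 / (2 * \<tau>) - L * norm (y - x) + L\<^sup>2 * \<tau> / 2"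
      using lam by (simp add: power2_eq_square field_simps)
    finally show ?thesis using lip'[of y x] unfolding G_def by linarith
  qed
  define I where "I = (INF y. G y)"
  have bdd: "bdd_below (range G)" using lower by (auto intro!: bdd_belowI)
  have I_le: "I \<le> G y" for y unfolding I_def by (rule cINF_lower[OF bdd]) simp
  have "\<exists>y. G y < I + 1 / real (Suc n)" for n
  proof -
    have "I < I + 1 / real (Suc n)" by simp
    then show ?thesis unfolding I_def by (subst (asm) cINF_less_iff) (use bdd in auto)
  qed
  then obtain ys where ys: "\<And>n. G (ys n) < I + 1 / real (Suc n)" by metis
  \<comment> \<open>Convexity at the midpoint and the parallelogram identity: two nearly minimal
    points must be close to each other.\<close>
  have mid: "(norm (a - b))\<^sup>2 / (8 * \<tau>) \<le> (G a + G b) / 2 - I" for a b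
  proof -
    let ?m = "(1/2) *\<^sub>R a + (1/2) *\<^sub>R b"
    have f: "f ?m \<le> f a / 2 + f b / 2"
      using convex_onD[OF cvx, of "1/2" a b] by simp
    have n: "(norm (?m - x))\<^sup>2 = (norm (a - x))\<^sup>2 / 2 + (norm (b - x))\<^sup>2 / 2 - (norm (a - b))\<^sup>2 / 4"
    proof -
      have "?m - x = (1/2) *\<^sub>R (a - x) + (1/2) *\<^sub>R (b - x)"
        by (simp add: algebra_simps flip: scaleR_add_left)
      moreover have "a - b = (a - x) - (b - x)" by simp
      ultimately show ?thesis
        unfolding power2_norm_eq_inner
        by (simp add: inner_add_left inner_add_right inner_diff_left inner_diff_right inner_commute field_simps)
    qed
    have "I \<le> f ?m + (norm (?m - x))\<^sup>2 / (2 * \<tau>)" using I_le[of ?m] by (simp add: G_def)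
    also have "(norm (?m - x))\<^sup>2 / (2 * \<tau>) = (norm (a - x))\<^sup>2 / (2 * \<tau>) / 2
        + (norm (b - x))\<^sup>2 / (2 * \<tau>) / 2 - (norm (a - b))\<^sup>2 / (8 * \<tau>)"
      unfolding n using lam by (simp add: field_simps)
    finally show ?thesis using f unfolding G_def by argo
  qed
  have "Cauchy ys"
  proof (rule metric_CauchyI)
    fix e :: real assume e: "e > 0"
    obtain N where N: "1 / real (Suc N) < e\<^sup>2 / (8 * \<tau>)"
      using e lam by (metis divide_pos_pos nat_approx_posE zero_less_power mult_pos_pos zero_less_numeral)
    show "\<exists>M. \<forall>m\<ge>M. \<forall>n\<ge>M. dist (ys m) (ys n) < e"
    proof (intro exI allI impI)
      fix m n assume mn: "m \<ge> N" "n \<ge> N"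
      have "1 / real (Suc m) \<le> 1 / real (Suc N)" "1 / real (Suc n) \<le> 1 / real (Suc N)"
        using mn by (auto intro!: divide_left_mono)
      then have "(norm (ys m - ys n))\<^sup>2 / (8 * \<tau>) < e\<^sup>2 / (8 * \<tau>)"
        using mid[of "ys m" "ys n"] ys[of m] ys[of n] N by argo
      then have "(norm (ys m - ys n))\<^sup>2 < e\<^sup>2" using lam by (simp add: divide_less_cancel)
      then show "dist (ys m) (ys n) < e" using e by (simp add: dist_norm power_less_imp_less_base)
    qed
  qed
  then obtain y where y: "ys \<longlonglongrightarrow> y" using Cauchy_convergent convergentD by blast
  have cont: "continuous_on UNIV f" using lip by (rule lipschitz_on_continuous_on)
  have fy: "(\<lambda>n. f (ys n)) \<longlonglongrightarrow> f y"
    by (rule continuous_on_tendsto_compose[OF cont y]) auto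
  have "(\<lambda>n. G (ys n)) \<longlonglongrightarrow> G y" unfolding G_def
    by (intro tendsto_intros fy y) (use lam in auto)
  moreover have "(\<lambda>n. I + 1 / real (Suc n)) \<longlonglongrightarrow> I + 0"
    by (intro tendsto_intros LIMSEQ_Suc[OF lim_inverse_n'])
  ultimately have "G y \<le> I"
    by (intro LIMSEQ_le[where X = "\<lambda>n. G (ys n)" and Y = "\<lambda>n. I + 1 / real (Suc n)"])
      (use ys less_imp_le in auto)
  then have min: "G y \<le> G z" for z using I_le[of z] by simp
  have "subgrad f y ((x - y) /\<^sub>R \<tau>)" unfolding subgrad_def
  proof
    fix z
    define A where "A = f z - f y - inner (x - y) (z - y) / \<tau>"
    define B where "B = (norm (z - y))\<^sup>2 / (2 * \<tau>)"
    \<comment> \<open>Minimality of \<open>y\<close> against the point at parameter \<open>t\<close>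
      on the way to \<open>z\<close>, divided by \<open>t\<close>; letting \<open>t\<close> tend to
      0 then removes the quadratic term.\<close>
    have t: "0 \<le> A + t * B" if t: "0 < t" "t \<le> 1" for t
    proof -
      let ?w = "(1 - t) *\<^sub>R y + t *\<^sub>R z"
      have fw: "f ?w \<le> (1 - t) * f y + t * f z" using convex_onD[OF cvx, of t y z] t by simp
      have nw: "(norm (?w - x))\<^sup>2 = (norm (y - x))\<^sup>2 - 2 * t * inner (x - y) (z - y) + t\<^sup>2 * (norm (z - y))\<^sup>2"
      proof -
        have "?w - x = (y - x) + t *\<^sub>R (z - y)" by (simp add: algebra_simps)
        then show ?thesis unfolding power2_norm_eq_inner
          by (simp add: inner_add_left inner_add_right inner_diff_left inner_diff_right inner_commute power2_eq_square algebra_simps)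
      qed
      have "f y + (norm (y - x))\<^sup>2 / (2 * \<tau>) \<le> (1 - t) * f y + t * f z + ((norm (y - x))\<^sup>2 - 2 * t * inner (x - y) (z - y) + t\<^sup>2 * (norm (z - y))\<^sup>2) / (2 * \<tau>)"
        using min[of ?w] fw unfolding G_def nw by linarith
      moreover have "((norm (y - x))\<^sup>2 - 2 * t * inner (x - y) (z - y) + t\<^sup>2 * (norm (z - y))\<^sup>2) / (2 * \<tau>)
          = (norm (y - x))\<^sup>2 / (2 * \<tau>) - t * (inner (x - y) (z - y) / \<tau>) + t * (t * B)"
        unfolding B_def using lam by (simp add: field_simps power2_eq_square)
      ultimately have "0 \<le> t * (A + t * B)"
        unfolding A_def by (simp add: algebra_simps)
      then show ?thesis using t by (simp add: zero_le_mult_iff)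
    qed
    have "(\<lambda>n. A + 1 / real (Suc n) * B) \<longlonglongrightarrow> A + 0 * B"
      by (intro tendsto_intros LIMSEQ_Suc[OF lim_inverse_n'])
    then have "0 \<le> A + 0 * B" by (rule LIMSEQ_le_const) (intro exI allI impI t, auto)
    then show "f y + inner ((x - y) /\<^sub>R \<tau>) (z - y) \<le> f z" by (simp add: A_def divide_inverse_commute)
  qed
  then show ?thesis using that by blast
qed

text \<open>Implicit Euler scheme for the gradient flow of \<open>f\<close>.\<close>

lemma proximal_sequence:
  fixes f :: "'a::{real_inner, complete_space} \<Rightarrow> real"
  assumes cvx: "convex_on UNIV f" and lip: "L-lipschitz_on UNIV f"
    and coer: "\<And>c. bounded {x. f x \<le> c}"
    and lam: "\<tau> > 0" and u0: "subgrad f x0 u0"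
  obtains x u where "x 0 = x0" "u 0 = u0" "\<And>k. x k - x (Suc k) = \<tau> *\<^sub>R u (Suc k)"
    "\<And>k. subgrad f (x k) (u k)" "\<And>k. norm (u (Suc k)) \<le> norm (u k)"
    "\<And>k. \<tau> * (norm (u (Suc k)))\<^sup>2 \<le> f (x k) - f (x (Suc k))"
    "bounded (range x)" "u \<longlonglongrightarrow> 0"
proof -
  have "\<exists>y. subgrad f y ((x - y) /\<^sub>R \<tau>)" for x
    using proximal_point[OF cvx lip lam] by blast
  then obtain pr where pr: "\<And>x. subgrad f (pr x) ((x - pr x) /\<^sub>R \<tau>)" by metis
  define x where "x k = (pr ^^ k) x0" for k
  define u where "u k = (if k = 0 then u0 else (x (k - 1) - x k) /\<^sub>R \<tau>)" for k
  have x0: "x 0 = x0" and u0': "u 0 = u0" by (simp_all add: x_def u_def)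
  have step: "x k - x (Suc k) = \<tau> *\<^sub>R u (Suc k)" for k using lam by (simp add: u_def)
  have sub: "subgrad f (x k) (u k)" for k
    by (cases k) (use u0 pr in \<open>auto simp: x_def u_def\<close>)
  \<comment> \<open>Monotonicity of the subdifferential across a step whose displacement is \<tau>
    times the new subgradient, followed by Cauchy-Schwarz.\<close>
  have dec: "norm (u (Suc k)) \<le> norm (u k)" for k
  proof -
    have "0 \<le> inner (u k - u (Suc k)) (x k - x (Suc k))" by (rule subgrad_mono[OF sub sub])
    then have "inner (u (Suc k)) (u (Suc k)) \<le> inner (u k) (u (Suc k))"
      using lam by (simp add: step inner_diff_left zero_le_mult_iff)
    also have "\<dots> \<le> norm (u k) * norm (u (Suc k))" by (rule norm_cauchy_schwarz)
    finally have "norm (u (Suc k)) * norm (u (Suc k)) \<le> norm (u k) * norm (u (Suc k))"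
      by (simp add: power2_norm_eq_inner flip: power2_eq_square)
    then show ?thesis using mult_right_le_imp_le by (cases "u (Suc k) = 0") auto
  qed
  have desc: "\<tau> * (norm (u (Suc k)))\<^sup>2 \<le> f (x k) - f (x (Suc k))" for k
    using subgradD[OF sub[of "Suc k"], of "x k"] by (simp add: step power2_norm_eq_inner)
  have le0: "f (x k) \<le> f x0" for k
  proof (induction k)
    case (Suc k)
    have "0 \<le> \<tau> * (norm (u (Suc k)))\<^sup>2" using lam by simp
    then show ?case using Suc desc[of k] by linarith
  qed (simp add: x0)
  have bd: "bounded (range x)"
    by (rule bounded_subset[OF coer[of "f x0"]]) (use le0 in auto)
  then obtain b where b: "\<And>k. norm (x k - x0) \<le> b"
    by (metis bounded_any_center dist_norm norm_minus_commute rangeI)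
  have lower: "f x0 - L * b \<le> f (x k)" for k
  proof -
    have "\<bar>f (x k) - f x0\<bar> \<le> L * norm (x k - x0)"
      using lipschitz_onD[OF lip, of "x k" x0] by (simp add: dist_norm)
    also have "\<dots> \<le> L * b" using b lipschitz_on_nonneg[OF lip] by (intro mult_left_mono)
    finally show ?thesis by linarith
  qed
  \<comment> \<open>The last slope is the smallest, so \<open>k\<close> copies of its square fit
    into the total descent, which \<open>lower\<close> bounds; this makes the slopes tend to
    0.\<close>
  have tele: "real k * (\<tau> * (norm (u k))\<^sup>2) \<le> f x0 - f (x k)" for k
  proof (induction k)
    case (Suc k)
    have "(norm (u (Suc k)))\<^sup>2 \<le> (norm (u k))\<^sup>2" using dec by (intro power_mono) auto
    then have "real k * (\<tau> * (norm (u (Suc k)))\<^sup>2) \<le> real k * (\<tau> * (norm (u k))\<^sup>2)"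
      using lam by (intro mult_left_mono) auto
    then show ?case using Suc desc[of k] by (simp add: algebra_simps)
  qed (simp add: x0)
  have "(\<lambda>k. (norm (u k))\<^sup>2) \<longlonglongrightarrow> 0"
  proof (rule tendsto_sandwich)
    show "\<forall>\<^sub>F k in sequentially. 0 \<le> (norm (u k))\<^sup>2" by simp
    show "\<forall>\<^sub>F k in sequentially. (norm (u k))\<^sup>2 \<le> (L * b / \<tau>) * inverse (real k)"
    proof (rule eventually_sequentiallyI[of 1])
      fix k :: nat assume "1 \<le> k"
      moreover have "real k * (\<tau> * (norm (u k))\<^sup>2) \<le> L * b" using tele[of k] lower[of k] by linarith
      ultimately show "(norm (u k))\<^sup>2 \<le> (L * b / \<tau>) * inverse (real k)"
        using lam by (simp add: field_simps)
    qed
    show "(\<lambda>k. (L * b / \<tau>) * inverse (real k)) \<longlonglongrightarrow> 0"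
      by (rule tendsto_mult_right_zero[OF lim_inverse_n])
  qed simp
  then have "(\<lambda>k. sqrt ((norm (u k))\<^sup>2)) \<longlonglongrightarrow> sqrt 0" by (rule tendsto_real_sqrt)
  then have "u \<longlonglongrightarrow> 0" by (simp add: tendsto_norm_zero_iff)
  with that x0 u0' step sub dec desc bd show ?thesis by blast
qed

lemma le_of_le_add_mult:
  fixes a b C :: real
  assumes "\<And>\<tau>. \<tau> > 0 \<Longrightarrow> a \<le> b + \<tau> * C"
  shows "a \<le> b"
proof (rule field_le_epsilon)
  fix e :: real assume "e > 0"
  have "a \<le> b + e / (\<bar>C\<bar> + 1) * C" using \<open>e > 0\<close> by (intro assms) auto
  also have "e / (\<bar>C\<bar> + 1) * C \<le> e / (\<bar>C\<bar> + 1) * (\<bar>C\<bar> + 1)"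
    using \<open>e > 0\<close> by (intro mult_left_mono) auto
  also have "\<dots> = e" by (simp add: field_simps)
  finally show "a \<le> b + e" by simp
qed

text \<open>A proximal step lowers \<open>f\<close> by at least \<tau> times the squared new slope,
  and lowers \<open>g\<close> by at most \<tau> times the product of old and new slope, since
  \<open>g\<close> has a short subgradient at the old point. The discrepancies add up to O(\<tau>).
  As the slopes tend to 0, the values of \<open>g\<close> along the sequence eventually exceed
  \<open>g z\<close> by arbitrarily little.\<close>

lemma convex_determined_by_slope_aux:
  fixes f g :: "'a::{real_inner, complete_space} \<Rightarrow> real"
  assumes cvx: "convex_on UNIV f" and lip: "L-lipschitz_on UNIV f"
    and coer: "\<And>c. bounded {x. f x \<le> c}"
    and u0: "subgrad f x0 u0"
    and slope: "\<And>x u. subgrad f x u \<Longrightarrow> \<exists>w. subgrad g x w \<and> norm w \<le> norm u"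
    and a: "\<And>y. a \<le> f y"
  shows "a - g z \<le> f x0 - g x0"
proof (rule le_of_le_add_mult)
  fix \<tau> :: real assume lam: "\<tau> > 0"
  obtain x u where 1: "x 0 = x0" "u 0 = u0" "\<And>k. x k - x (Suc k) = \<tau> *\<^sub>R u (Suc k)"
    "\<And>k. subgrad f (x k) (u k)" "\<And>k. norm (u (Suc k)) \<le> norm (u k)"
    "\<And>k. \<tau> * (norm (u (Suc k)))\<^sup>2 \<le> f (x k) - f (x (Suc k))"
    "bounded (range x)" "u \<longlonglongrightarrow> 0"
    using proximal_sequence[OF cvx lip coer lam u0] by blast
  obtain w where w: "\<And>k. subgrad g (x k) (w k)" "\<And>k. norm (w k) \<le> norm (u k)"
    using slope[OF 1(4)] by metis
  have dec0: "norm (u k) \<le> norm u0" for k by (induction k) (use 1 order_trans in \<open>auto, blast\<close>)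
  have inv: "f (x k) - g (x k) \<le> f x0 - g x0 + \<tau> * (norm u0 * (norm u0 - norm (u k)))" for k
  proof (induction k)
    case (Suc k)
    let ?a = "norm (u k)" and ?b = "norm (u (Suc k))"
    have "g (x k) - g (x (Suc k)) \<le> inner (w k) (x k - x (Suc k))"
      using subgradD[OF w(1)[of k], of "x (Suc k)"] by (simp add: inner_diff_right)
    also have "\<dots> \<le> norm (w k) * norm (x k - x (Suc k))" by (rule norm_cauchy_schwarz)
    also have "\<dots> \<le> ?a * (\<tau> * ?b)" unfolding 1(3) using w(2)[of k] lam by (simp add: mult_right_mono)
    finally have g: "g (x k) - g (x (Suc k)) \<le> ?a * (\<tau> * ?b)" .
    \<comment> \<open>The excess of \<open>?a * ?b\<close> over \<open>?b * ?b\<close>; replacing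
      the factor \<open>?b\<close> by its bound \<open>norm u0\<close> makes it telescope.\<close>
    have "(?a - ?b) * ?b \<le> (?a - ?b) * norm u0" using 1(5)[of k] dec0 by (intro mult_left_mono) auto
    then have "\<tau> * ((?a - ?b) * ?b) \<le> \<tau> * ((?a - ?b) * norm u0)" using lam by simp
    then show ?case using Suc g 1(6)[of k] by (simp add: algebra_simps power2_eq_square)
  qed (use 1 in simp)
  have inv': "f (x k) - g (x k) \<le> f x0 - g x0 + \<tau> * (norm u0)\<^sup>2" for k
  proof -
    have "\<tau> * (norm u0 * (norm u0 - norm (u k))) \<le> \<tau> * (norm u0)\<^sup>2"
      unfolding power2_eq_square using lam by (intro mult_left_mono) auto
    then show ?thesis using inv[of k] by simp
  qed
  obtain b where b: "\<And>k. norm (x k - z) \<le> b"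
    using 1(7) by (metis bounded_any_center dist_norm norm_minus_commute rangeI)
  have b0: "b \<ge> 0" using b[of 0] norm_ge_zero order_trans by blast
  have gz: "g (x k) \<le> g z + norm (u k) * b" for k
  proof -
    have "g (x k) - g z \<le> inner (w k) (x k - z)"
      using subgradD[OF w(1)[of k], of z] by (simp add: inner_diff_right)
    also have "\<dots> \<le> norm (w k) * norm (x k - z)" by (rule norm_cauchy_schwarz)
    also have "\<dots> \<le> norm (u k) * b" using w b by (intro mult_mono) auto
    finally show ?thesis by simp
  qed
  have "a - g z - (f x0 - g x0 + \<tau> * (norm u0)\<^sup>2) \<le> norm (u k) * b" for k
    using gz[of k] inv'[of k] a[of "x k"] by linarith
  moreover have "(\<lambda>k. norm (u k) * b) \<longlonglongrightarrow> norm (0::'a) * b" by (intro tendsto_intros 1)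
  ultimately have "a - g z - (f x0 - g x0 + \<tau> * (norm u0)\<^sup>2) \<le> norm (0::'a) * b"
    by (intro LIMSEQ_le_const) auto
  then show "a - g z \<le> f x0 - g x0 + \<tau> * (norm u0)\<^sup>2" by simp
qed

text \<open>The preceding estimate in both roles of \<open>f\<close> and \<open>g\<close>, with the
  infimum taken over \<open>z\<close>, gives the two inequalities. Infima stand in for
  minimizers.\<close>

lemma convex_determined_by_slope:
  fixes f g :: "'a::{real_inner, complete_space} \<Rightarrow> real"
  assumes f: "convex_on UNIV f" "L-lipschitz_on UNIV f" "\<And>c. bounded {x. f x \<le> c}"
    and g: "convex_on UNIV g" "L'-lipschitz_on UNIV g" "\<And>c. bounded {x. g x \<le> c}"
    and sub: "\<And>x. \<exists>u. subgrad f x u"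
    and fg: "\<And>x u. subgrad f x u \<Longrightarrow> \<exists>w. subgrad g x w \<and> norm w \<le> norm u"
    and gf: "\<And>x u. subgrad g x u \<Longrightarrow> \<exists>w. subgrad f x w \<and> norm w \<le> norm u"
    and bdd: "\<And>y. a \<le> f y" "\<And>y. b \<le> g y"
  shows "f x - g x = (INF y. f y) - (INF y. g y)"
proof -
  let ?a = "INF y. f y" and ?b = "INF y. g y"
  have bf: "bdd_below (range f)" and bg: "bdd_below (range g)" using bdd by (auto intro!: bdd_belowI)
  have a: "?a \<le> f y" and b: "?b \<le> g y" for y by (auto intro!: cINF_lower bf bg)
  obtain u where u: "subgrad f x u" using sub by blast
  obtain w where w: "subgrad g x w" using fg u by blast
  have "?a - g z \<le> f x - g x" for z
    by (rule convex_determined_by_slope_aux[OF f u fg a])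
  then have "?a - (f x - g x) \<le> ?b" by (intro cINF_greatest) (auto simp: algebra_simps)
  moreover have "?b - f z \<le> g x - f x" for z
    by (rule convex_determined_by_slope_aux[OF g w gf b])
  then have "?b - (g x - f x) \<le> ?a" by (intro cINF_greatest) (auto simp: algebra_simps)
  ultimately show ?thesis by linarith
qed

text \<open>
  Where \<open>f\<close> and \<open>g\<close> have gradients of equal norm, the gradients of \<open>f + g\<close> and \<open>f - g\<close> are
  orthogonal, so \<open>f - g\<close> is invariant under the gradient flow of \<open>f + g\<close>.
\<close>

lemma diff_const_of_sum_flow:
  fixes f g :: "'a::{real_inner, complete_space} \<Rightarrow> real"
  defines "s \<equiv> \<lambda>x. f x + g x"
  assumes cvx: "convex_on UNIV s" and lip: "L-lipschitz_on UNIV s"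
    and lipf: "L1-lipschitz_on UNIV f" and lipg: "L2-lipschitz_on UNIV g"
    and coer: "\<And>c. bounded {x. s x \<le> c}"
    and sub: "\<And>x. \<exists>u. subgrad s x u"
    and split: "\<And>x u. subgrad s x u \<Longrightarrow> (\<forall>y. s x \<le> s y) \<or>
        (\<exists>\<xi> \<eta>. subgrad f x \<xi> \<and> subgrad g x \<eta> \<and> u = \<xi> + \<eta> \<and> norm \<xi> = norm \<eta>)"
    and m: "\<And>y. s m \<le> s y"
    and conv: "\<And>x. bounded (range x) \<Longrightarrow> (\<lambda>k. s (x k)) \<longlonglongrightarrow> s m \<Longrightarrow> x \<longlonglongrightarrow> m"
  shows "f x0 - g x0 = f m - g m"
proof -
  define d where "d x = f x - g x" for x
  obtain u0 where u0: "subgrad s x0 u0" using sub by blast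
  have dlip: "\<bar>d x - d y\<bar> \<le> (L1 + L2) * norm (x - y)" for x y
    using lipschitz_onD[OF lipf, of x y] lipschitz_onD[OF lipg, of x y]
    by (simp add: d_def dist_norm algebra_simps abs_le_iff)
  have L: "L1 + L2 \<ge> 0" using lipschitz_on_nonneg[OF lipf] lipschitz_on_nonneg[OF lipg] by simp
  \<comment> \<open>The first summand bounds the telescoping error of steps between non-minimizers,
    the second the single step that may enter the set of minimizers.\<close>
  define C where "C = (norm u0)\<^sup>2 / 2 + (L1 + L2) * norm u0"
  have "\<bar>d x0 - d m\<bar> \<le> 0"
  proof (rule le_of_le_add_mult)
    fix \<tau> :: real assume lam: "\<tau> > 0"
    obtain x u where 1: "x 0 = x0" "u 0 = u0" "\<And>k. x k - x (Suc k) = \<tau> *\<^sub>R u (Suc k)"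
      "\<And>k. subgrad s (x k) (u k)" "\<And>k. norm (u (Suc k)) \<le> norm (u k)"
      "\<And>k. \<tau> * (norm (u (Suc k)))\<^sup>2 \<le> s (x k) - s (x (Suc k))"
      "bounded (range x)" "u \<longlonglongrightarrow> 0"
      using proximal_sequence[OF cvx lip coer lam u0] by blast
    have dec0: "norm (u k) \<le> norm u0" for k by (induction k) (use 1 order_trans in \<open>auto, blast\<close>)
    define S where "S x \<longleftrightarrow> (\<forall>y. s x \<le> s y)" for x
    \<comment> \<open>The drops of \<open>f\<close> and of \<open>g\<close> each lie between the
      products of the step with the new and with the old subgradient. The lower ends coincide by
      \<open>eq\<close>, so the drops differ by at most the sum of the two interval lengths, which
      is controlled by a difference of squared slopes.\<close>
    have one: "\<bar>d (x k) - d (x (Suc k))\<bar> \<le> \<tau> * ((norm (u k))\<^sup>2 - (norm (u (Suc k)))\<^sup>2) / 2"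
      if ns: "\<not> S (x k)" "\<not> S (x (Suc k))" for k
    proof -
      let ?h = "x k - x (Suc k)" and ?u = "u k" and ?v = "u (Suc k)"
      obtain \<xi> \<eta> where A: "subgrad f (x k) \<xi>" "subgrad g (x k) \<eta>" "?u = \<xi> + \<eta>"
        using split[OF 1(4)[of k]] ns unfolding S_def by blast
      obtain \<xi>' \<eta>' where B: "subgrad f (x (Suc k)) \<xi>'" "subgrad g (x (Suc k)) \<eta>'" "?v = \<xi>' + \<eta>'"
         "norm \<xi>' = norm \<eta>'"
        using split[OF 1(4)[of "Suc k"]] ns unfolding S_def by blast
      \<comment> \<open>The step is \<tau> times \<open>\<xi>' + \<eta>'\<close>, and
        \<open>\<xi>' - \<eta>'\<close> is orthogonal to it because the norms agree. An implicit
        step has this orthogonality at the new point.\<close>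
      have eq: "inner \<xi>' ?h = inner \<eta>' ?h"
      proof -
        have "inner \<xi>' \<xi>' = inner \<eta>' \<eta>'" using B(4) by (simp flip: power2_norm_eq_inner)
        then show ?thesis unfolding 1(3) B(3) by (simp add: inner_add_right inner_commute)
      qed
      have f1: "f (x k) - f (x (Suc k)) \<le> inner \<xi> ?h" "inner \<xi>' ?h \<le> f (x k) - f (x (Suc k))"
        using subgradD[OF A(1), of "x (Suc k)"] subgradD[OF B(1), of "x k"] by (simp_all add: inner_diff_right)
      have g1: "g (x k) - g (x (Suc k)) \<le> inner \<eta> ?h" "inner \<eta>' ?h \<le> g (x k) - g (x (Suc k))"
        using subgradD[OF A(2), of "x (Suc k)"] subgradD[OF B(2), of "x k"] by (simp_all add: inner_diff_right)
      have m1: "0 \<le> inner (\<xi> - \<xi>') ?h" "0 \<le> inner (\<eta> - \<eta>') ?h"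
        by (rule subgrad_mono[OF A(1) B(1)], rule subgrad_mono[OF A(2) B(2)])
      have "inner (\<xi> - \<xi>') ?h + inner (\<eta> - \<eta>') ?h = inner (?u - ?v) ?h"
        unfolding A(3) B(3) by (simp add: inner_add_left inner_diff_left)
      also have "\<dots> = \<tau> * inner (?u - ?v) ?v" by (simp add: 1(3))
      also have "\<dots> \<le> \<tau> * (((norm ?u)\<^sup>2 - (norm ?v)\<^sup>2) / 2)"
      proof (intro mult_left_mono)
        have "0 \<le> inner (?u - ?v) (?u - ?v)" by simp
        then show "inner (?u - ?v) ?v \<le> ((norm ?u)\<^sup>2 - (norm ?v)\<^sup>2) / 2"
          unfolding power2_norm_eq_inner by (simp add: inner_diff_left inner_diff_right inner_commute)
      qed (use lam in simp)
      finally show ?thesis using f1 g1 m1 eq unfolding d_def inner_diff_left by linarith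
    qed
    \<comment> \<open>The extra term is paid at most once: from a minimizer the sequence no longer
      moves.\<close>
    have inv: "\<bar>d x0 - d (x k)\<bar> \<le> \<tau> * ((norm u0)\<^sup>2 - (norm (u k))\<^sup>2) / 2 + (if S (x k) then (L1 + L2) * (\<tau> * norm u0) else 0)" for k
    proof (induction k)
      case 0 then show ?case using 1 L lam by simp
    next
      case (Suc k)
      have sq: "(norm (u (Suc k)))\<^sup>2 \<le> (norm (u k))\<^sup>2" using 1(5) by (intro power_mono) auto
      then have sq': "\<tau> * ((norm u0)\<^sup>2 - (norm (u k))\<^sup>2) / 2 \<le> \<tau> * ((norm u0)\<^sup>2 - (norm (u (Suc k)))\<^sup>2) / 2"
        using lam by simp
      consider "S (x k)" | "\<not> S (x k)" "S (x (Suc k))" | "\<not> S (x k)" "\<not> S (x (Suc k))" by blast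
      then show ?case
      proof cases
        case 1
        have "s (x k) \<le> s (x (Suc k))" using 1 by (simp add: S_def)
        then have "\<tau> * (norm (u (Suc k)))\<^sup>2 \<le> 0" using \<open>\<And>k. \<tau> * (norm (u (Suc k)))\<^sup>2 \<le> s (x k) - s (x (Suc k))\<close>[of k] by linarith
        then have "u (Suc k) = 0" using lam by (simp add: mult_le_0_iff)
        then have "x (Suc k) = x k" using \<open>\<And>k. x k - x (Suc k) = \<tau> *\<^sub>R u (Suc k)\<close>[of k] by simp
        then show ?thesis using Suc sq' by (simp split: if_splits)
      next
        case 2
        have "\<bar>d (x k) - d (x (Suc k))\<bar> \<le> (L1 + L2) * norm (x k - x (Suc k))" by (rule dlip)
        also have "\<dots> \<le> (L1 + L2) * (\<tau> * norm u0)"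
          unfolding 1(3) using lam L dec0[of "Suc k"] by (intro mult_left_mono) auto
        finally have "\<bar>d (x k) - d (x (Suc k))\<bar> \<le> (L1 + L2) * (\<tau> * norm u0)" .
        moreover have "\<bar>d x0 - d (x k)\<bar> \<le> \<tau> * ((norm u0)\<^sup>2 - (norm (u k))\<^sup>2) / 2" using Suc 2 by simp
        ultimately show ?thesis using sq' 2 by (simp only: if_True)
      next
        case 3
        have "\<bar>d x0 - d (x (Suc k))\<bar> \<le> \<bar>d x0 - d (x k)\<bar> + \<bar>d (x k) - d (x (Suc k))\<bar>" by linarith
        then show ?thesis using Suc one[OF 3] 3 by (simp add: algebra_simps)
      qed
    qed
    have inv': "\<bar>d x0 - d (x k)\<bar> \<le> \<tau> * C" for k
    proof -
      have "0 \<le> \<tau> * (norm (u k))\<^sup>2" "0 \<le> (L1 + L2) * (\<tau> * norm u0)" using lam L by auto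
      then show ?thesis using inv[of k] unfolding C_def by (simp add: algebra_simps diff_divide_distrib split: if_splits)
    qed
    obtain b where b: "\<And>k. norm (x k - m) \<le> b"
      using 1(7) by (metis bounded_any_center dist_norm norm_minus_commute rangeI)
    have up: "s (x k) \<le> s m + norm (u k) * b" for k
    proof -
      have "s (x k) - s m \<le> inner (u k) (x k - m)"
        using subgradD[OF 1(4)[of k], of m] by (simp add: inner_diff_right)
      also have "\<dots> \<le> norm (u k) * norm (x k - m)" by (rule norm_cauchy_schwarz)
      also have "\<dots> \<le> norm (u k) * b" using b by (intro mult_left_mono) auto
      finally show ?thesis by simp
    qed
    have "(\<lambda>k. s m + norm (u k) * b) \<longlonglongrightarrow> s m + norm (0::'a) * b" by (intro tendsto_intros 1)
    then have lim: "(\<lambda>k. s m + norm (u k) * b) \<longlonglongrightarrow> s m" by simp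
    have "(\<lambda>k. s (x k)) \<longlonglongrightarrow> s m"
      by (rule tendsto_sandwich[OF _ _ tendsto_const lim]) (simp_all add: m up)
    then have xm: "x \<longlonglongrightarrow> m" using conv 1(7) by blast
    have "(\<lambda>k. \<bar>d x0 - d m\<bar> - \<tau> * C) \<longlonglongrightarrow> \<bar>d x0 - d m\<bar> - \<tau> * C" by simp
    moreover have "(\<lambda>k. (L1 + L2) * norm (x k - m)) \<longlonglongrightarrow> (L1 + L2) * norm (m - m)"
      by (intro tendsto_intros xm)
    moreover have "\<bar>d x0 - d m\<bar> - \<tau> * C \<le> (L1 + L2) * norm (x k - m)" for k
      using inv'[of k] dlip[of "x k" m] by linarith
    ultimately have "\<bar>d x0 - d m\<bar> - \<tau> * C \<le> (L1 + L2) * norm (m - m)"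
      by (intro LIMSEQ_le) auto
    then show "\<bar>d x0 - d m\<bar> \<le> 0 + \<tau> * C" by simp
  qed
  then show ?thesis by (simp add: d_def)
qed

section \<open>The spatial distribution function as a subgradient\<close>

lemma sgn_minus_integrable:
  fixes P :: "'a::{real_inner, banach, polish_space} measure"
  assumes "borel_prob P"
  shows "integrable P (\<lambda>z. sgn (x - z))"
  by (rule borel_prob_integrable_bounded[OF assms, of _ 1]) (simp add: sgn_div_norm, simp add: norm_sgn)

text \<open>\<open>sgn 0 = 0\<close> takes care of the removed point \<open>x\<close>, so the
  representer is a Bochner integral over the whole space.\<close>

lemma spatial_df_eq:
  fixes P :: "'a::{real_inner, banach, polish_space} measure"
  assumes P: "borel_prob P"
  shows "spatial_df P x = (\<integral>z. sgn (x - z) \<partial>P)"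
proof (rule spatial_df_unique[OF P])
  fix v
  have "inner (\<integral>z. sgn (x - z) \<partial>P) v = (\<integral>z. inner (sgn (x - z)) v \<partial>P)"
    using sgn_minus_integrable[OF P] by (simp add: integral_inner_left)
  also have "\<dots> = (LINT z:UNIV - {x}|P. inner (x - z) v / norm (x - z))"
    unfolding set_lebesgue_integral_def
    by (intro Bochner_Integration.integral_cong) (auto simp: sgn_div_norm divide_inverse mult.commute)
  finally show "inner (\<integral>z. sgn (x - z) \<partial>P) v = \<dots>" .
qed

lemma atom_integral:
  fixes P :: "'a::{real_inner, banach, polish_space} measure"
  assumes P: "borel_prob P"
  shows "integrable P (\<lambda>z. indicator {x} z *\<^sub>R v)" "(\<integral>z. indicator {x} z *\<^sub>R (v::'a) \<partial>P) = measure P {x} *\<^sub>R v"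
proof -
  interpret prob_space P using P by (rule borel_prob_prob_space)
  have [measurable_cong]: "sets P = sets borel" using P by (rule borel_prob_sets)
  have i: "integrable P (indicator {x} :: 'a \<Rightarrow> real)"
    by (rule integrable_real_indicator) (auto simp: emeasure_eq_measure borel_prob_sets[OF P])
  show "integrable P (\<lambda>z. indicator {x} z *\<^sub>R v)" using i by simp
  show "(\<integral>z. indicator {x} z *\<^sub>R v \<partial>P) = measure P {x} *\<^sub>R v"
    using i by (simp add: borel_prob_space[OF P])
qed

text \<open>Dominated convergence: the integrand converges at every \<open>z\<close>, and only at
  \<open>z = x\<close> does the limit depend on the direction of approach, where the atom
  contributes its mass times \<open>v\<close>.\<close>

lemma spatial_df_directional_limit:
  fixes P :: "'a::{real_inner, banach, polish_space} measure"
  assumes P: "borel_prob P" and y: "y \<longlonglongrightarrow> x" and v: "(\<lambda>n. sgn (y n - x)) \<longlonglongrightarrow> v"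
  shows "(\<lambda>n. spatial_df P (y n)) \<longlonglongrightarrow> spatial_df P x + measure P {x} *\<^sub>R v"
proof -
  interpret prob_space P using P by (rule borel_prob_prob_space)
  have [measurable_cong]: "sets P = sets borel" using P by (rule borel_prob_sets)
  note i = sgn_minus_integrable[OF P] atom_integral(1)[OF P]
  have "(\<lambda>n. \<integral>z. sgn (y n - z) \<partial>P) \<longlonglongrightarrow> (\<integral>z. sgn (x - z) + indicator {x} z *\<^sub>R v \<partial>P)"
  proof (rule integral_dominated_convergence[where w = "\<lambda>_. 1"])
    show "(\<lambda>z. sgn (x - z) + indicator {x} z *\<^sub>R v) \<in> borel_measurable P"
      using i by (intro borel_measurable_add borel_measurable_integrable)
    show "(\<lambda>z. sgn (y n - z)) \<in> borel_measurable P" for n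
      using i by (intro borel_measurable_integrable)
    have "(\<lambda>n. sgn (y n - z)) \<longlonglongrightarrow> sgn (x - z) + indicator {x} z *\<^sub>R v" for z
    proof (cases "z = x")
      case False
      then have "(\<lambda>n. sgn (y n - z)) \<longlonglongrightarrow> sgn (x - z)" by (intro tendsto_intros y) auto
      then show ?thesis using False by simp
    qed (use v in simp)
    then show "AE z in P. (\<lambda>n. sgn (y n - z)) \<longlonglongrightarrow> sgn (x - z) + indicator {x} z *\<^sub>R v" by simp
  qed (auto simp: norm_sgn)
  then show ?thesis
    unfolding spatial_df_eq[OF P] Bochner_Integration.integral_add[OF i] atom_integral(2)[OF P] .
qed

text \<open>Under the integral, \<open>sgn (x - z)\<close> is the gradient of the norm for
  \<open>z\<close> other than \<open>x\<close>, while at \<open>z = x\<close> every vector of the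
  closed unit ball is a subgradient.\<close>

lemma spatial_objective_subgrad:
  fixes P :: "'a::{real_inner, banach, polish_space} measure"
  assumes P: "borel_prob P" and b: "norm b \<le> 1"
  shows "subgrad (spatial_objective P) x (spatial_df P x + measure P {x} *\<^sub>R b)"
  unfolding subgrad_def
proof
  fix y
  note i = sgn_minus_integrable[OF P] atom_integral(1)[OF P]
  have i': "integrable P (\<lambda>z. sgn (x - z) + indicator {x} z *\<^sub>R b)"
    by (intro Bochner_Integration.integrable_add i)
  have pt: "inner (sgn (x - z) + indicator {x} z *\<^sub>R b) (y - x) \<le> norm (y - z) - norm (x - z)" for z
  proof (cases "z = x")
    case True
    have "inner b (y - x) \<le> norm b * norm (y - x)" by (rule norm_cauchy_schwarz)
    also have "\<dots> \<le> norm (y - x)" using b by (simp add: mult_left_le_one_le)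
    finally show ?thesis using True by simp
  next
    case False
    have "inner (sgn (x - z)) (y - z) \<le> norm (sgn (x - z)) * norm (y - z)" by (rule norm_cauchy_schwarz)
    also have "\<dots> = norm (y - z)" using False by (simp add: norm_sgn)
    finally have "inner (sgn (x - z)) (y - z) \<le> norm (y - z)" .
    moreover have "inner (sgn (x - z)) (x - z) = norm (x - z)"
      using False by (simp add: sgn_div_norm power2_norm_eq_inner[symmetric] power2_eq_square)
    moreover have "y - x = (y - z) - (x - z)" by simp
    ultimately show ?thesis using False by (simp only: inner_diff_right) (simp add: inner_diff_right[symmetric])
  qed
  have "inner (spatial_df P x + measure P {x} *\<^sub>R b) (y - x)
      = (\<integral>z. inner (sgn (x - z) + indicator {x} z *\<^sub>R b) (y - x) \<partial>P)"
    unfolding integral_inner_left[OF i'] Bochner_Integration.integral_add[OF i] atom_integral(2)[OF P] spatial_df_eq[OF P] ..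
  also have "\<dots> \<le> (\<integral>z. norm (y - z) - norm (x - z) \<partial>P)"
    using i' pt spatial_objective_diff(1)[OF P] by (intro integral_mono) auto
  finally show "spatial_objective P x + inner (spatial_df P x + measure P {x} *\<^sub>R b) (y - x) \<le> spatial_objective P y"
    unfolding spatial_objective_diff(2)[OF P, symmetric] by simp
qed

text \<open>The converse bound, stated abstractly so that it serves one objective as well as the
  sum. \<open>u\<close> is compared with the subgradients at points approaching \<open>x\<close> in
  the direction \<open>v\<close> of \<open>u - G0\<close>; monotonicity leaves
  \<open>inner (u - G0) v \<le> \<rho>\<close> in the limit.\<close>

lemma subgrad_norm_le:
  fixes f :: "'a::real_inner \<Rightarrow> real"
  assumes G: "\<And>y. subgrad f y (G y)" and \<rho>: "\<rho> \<ge> 0" and u: "subgrad f x u"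
    and lim: "\<And>y v. y \<longlonglongrightarrow> x \<Longrightarrow> (\<lambda>n. sgn (y n - x)) \<longlonglongrightarrow> v \<Longrightarrow> (\<lambda>n. G (y n)) \<longlonglongrightarrow> G0 + \<rho> *\<^sub>R v"
  shows "norm (u - G0) \<le> \<rho>"
proof (cases "u = G0")
  case False
  define v where "v = sgn (u - G0)"
  have v1: "norm v = 1" using False by (simp add: v_def norm_sgn)
  define y where "y n = x + (1 / real (Suc n)) *\<^sub>R v" for n
  have "y \<longlonglongrightarrow> x + 0 *\<^sub>R v" unfolding y_def by (intro tendsto_intros LIMSEQ_Suc[OF lim_inverse_n'])
  then have yx: "y \<longlonglongrightarrow> x" by simp
  have sv: "sgn (y n - x) = v" for n unfolding y_def using v1 by (simp add: sgn_div_norm)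
  have "(\<lambda>n. inner (G (y n)) v) \<longlonglongrightarrow> inner (G0 + \<rho> *\<^sub>R v) v"
    by (intro tendsto_intros lim[OF yx]) (simp add: sv)
  moreover have "inner u v \<le> inner (G (y n)) v" for n
  proof -
    have "f x + inner u (y n - x) \<le> f (y n)" by (rule subgradD[OF u])
    moreover have "f (y n) + inner (G (y n)) (x - y n) \<le> f x" by (rule subgradD[OF G])
    ultimately have "(1 / real (Suc n)) * inner u v \<le> (1 / real (Suc n)) * inner (G (y n)) v"
      by (simp add: y_def)
    then show ?thesis by (rule mult_left_le_imp_le) simp
  qed
  ultimately have "inner u v \<le> inner (G0 + \<rho> *\<^sub>R v) v" by (intro LIMSEQ_le_const) auto
  then have "inner (u - G0) v \<le> \<rho> * inner v v" by (simp add: inner_add_left inner_diff_left)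
  moreover have "inner v v = 1" using v1 by (simp flip: power2_norm_eq_inner)
  moreover have "inner (u - G0) v = norm (u - G0)"
    using False by (simp add: v_def sgn_div_norm power2_norm_eq_inner[symmetric] power2_eq_square)
  ultimately show ?thesis by simp
qed (use \<rho> in simp)

lemma spatial_objective_subgrad0:
  fixes P :: "'a::{real_inner, banach, polish_space} measure"
  assumes P: "borel_prob P"
  shows "subgrad (spatial_objective P) x (spatial_df P x)"
  using spatial_objective_subgrad[OF P, of 0 x] by simp

lemma spatial_objective_subgrad_norm:
  fixes P :: "'a::{real_inner, banach, polish_space} measure"
  assumes P: "borel_prob P" and u: "subgrad (spatial_objective P) x u"
  shows "norm (u - spatial_df P x) \<le> measure P {x}"
  by (rule subgrad_norm_le[OF spatial_objective_subgrad0[OF P] _ u spatial_df_directional_limit[OF P]]) auto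

lemma spatial_objective_sum_subgrad_norm:
  fixes P Q :: "'a::{real_inner, banach, polish_space} measure"
  assumes P: "borel_prob P" and Q: "borel_prob Q"
    and u: "subgrad (\<lambda>x. spatial_objective P x + spatial_objective Q x) x u"
  shows "norm (u - (spatial_df P x + spatial_df Q x)) \<le> measure P {x} + measure Q {x}"
proof (rule subgrad_norm_le[OF _ _ u])
  show "subgrad (\<lambda>x. spatial_objective P x + spatial_objective Q x) y (spatial_df P y + spatial_df Q y)" for y
    by (intro subgrad_add spatial_objective_subgrad0 P Q)
  fix y v assume "y \<longlonglongrightarrow> x" "(\<lambda>n. sgn (y n - x)) \<longlonglongrightarrow> v"
  then have "(\<lambda>n. spatial_df P (y n) + spatial_df Q (y n)) \<longlonglongrightarrow>
      (spatial_df P x + measure P {x} *\<^sub>R v) + (spatial_df Q x + measure Q {x} *\<^sub>R v)"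
    by (intro tendsto_add spatial_df_directional_limit P Q)
  then show "(\<lambda>n. spatial_df P (y n) + spatial_df Q (y n)) \<longlonglongrightarrow>
      spatial_df P x + spatial_df Q x + (measure P {x} + measure Q {x}) *\<^sub>R v"
    by (simp add: scaleR_add_left algebra_simps)
qed simp

lemma spatial_objective_lipschitz:
  fixes P :: "'a::{real_inner, banach, polish_space} measure"
  assumes P: "borel_prob P"
  shows "1-lipschitz_on UNIV (spatial_objective P)"
proof (rule lipschitz_onI)
  fix x y :: 'a
  have "\<bar>norm (x - z) - norm (y - z)\<bar> \<le> norm (x - y)" for z
    using norm_triangle_ineq3[of "x - z" "y - z"] by simp
  then have "\<bar>\<integral>z. norm (x - z) - norm (y - z) \<partial>P\<bar> \<le> norm (x - y)"
    by (intro borel_prob_abs_integral_le[OF P]) auto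
  then show "dist (spatial_objective P x) (spatial_objective P y) \<le> 1 * dist x y"
    unfolding spatial_objective_diff(2)[OF P, symmetric] by (simp add: dist_norm)
qed simp

text \<open>Subgradients at every point suffice: average the two subgradient inequalities at the
  convex combination, where the linear terms cancel.\<close>

lemma spatial_objective_convex:
  fixes P :: "'a::{real_inner, banach, polish_space} measure"
  assumes P: "borel_prob P"
  shows "convex_on UNIV (spatial_objective P)"
proof (rule convex_onI)
  fix t :: real and x y :: 'a assume t: "0 < t" "t < 1"
  let ?w = "(1 - t) *\<^sub>R x + t *\<^sub>R y"
  have "spatial_objective P ?w + inner (spatial_df P ?w) (x - ?w) \<le> spatial_objective P x"
    "spatial_objective P ?w + inner (spatial_df P ?w) (y - ?w) \<le> spatial_objective P y"
    by (rule subgradD[OF spatial_objective_subgrad0[OF P]])+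
  then have "(1 - t) * (spatial_objective P ?w + inner (spatial_df P ?w) (x - ?w))
      + t * (spatial_objective P ?w + inner (spatial_df P ?w) (y - ?w))
      \<le> (1 - t) * spatial_objective P x + t * spatial_objective P y"
    using t by (intro add_mono mult_left_mono) auto
  moreover have "(1 - t) * inner (spatial_df P ?w) (x - ?w) + t * inner (spatial_df P ?w) (y - ?w)
      = inner (spatial_df P ?w) ((1 - t) *\<^sub>R (x - ?w) + t *\<^sub>R (y - ?w))"
    by (simp add: inner_add_right)
  moreover have "(1 - t) *\<^sub>R (x - ?w) + t *\<^sub>R (y - ?w) = 0" by (simp add: algebra_simps)
  ultimately show "spatial_objective P ?w \<le> (1 - t) * spatial_objective P x + t * spatial_objective P y"
    by (simp add: algebra_simps)
qed simp

text \<open>A ball with more than 3/4 of the mass gains \<open>norm x\<close> up to a constant, the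
  rest loses at most \<open>norm x\<close>; twice 3/4 minus 1 is the factor 1/2.\<close>

lemma spatial_objective_lower:
  fixes P :: "'a::{real_inner, banach, polish_space} measure"
  assumes P: "borel_prob P"
  obtains C where "\<And>x. norm x / 2 - C \<le> spatial_objective P x"
proof -
  interpret prob_space P using P by (rule borel_prob_prob_space)
  have [measurable_cong]: "sets P = sets borel" using P by (rule borel_prob_sets)
  have "(\<lambda>n. measure P (cball 0 (real n))) \<longlonglongrightarrow> measure P (\<Union>n. cball 0 (real n))"
    by (intro finite_Lim_measure_incseq) (auto simp: incseq_def borel_prob_sets[OF P])
  moreover have "(\<Union>n. cball (0::'a) (real n)) = space P"
    using real_arch_simple by (auto simp: borel_prob_space[OF P])
  ultimately have "(\<lambda>n. measure P (cball 0 (real n))) \<longlonglongrightarrow> 1" by (simp add: prob_space)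
  then have "\<forall>\<^sub>F n in sequentially. measure P (cball 0 (real n)) > 3/4" by (rule order_tendstoD) simp
  then obtain n where n: "measure P (cball 0 (real n)) > 3/4" using eventually_sequentially by auto
  define B where "B = cball (0::'a) (real n)"
  have Bs: "B \<in> sets P" by (simp add: B_def borel_prob_sets[OF P])
  show ?thesis
  proof (rule that[of "2 * real n"])
    fix x :: 'a
    have iB: "integrable P (\<lambda>z. indicator B z * (2 * norm x) :: real)"
      using Bs by (intro integrable_mult_left integrable_real_indicator) (auto simp: emeasure_eq_measure)
    have pt: "indicator B z * (2 * norm x) - norm x - 2 * real n \<le> norm (x - z) - norm z" for z
    proof (cases "z \<in> B")
      case True
      then have "norm z \<le> real n" by (simp add: B_def)
      then show ?thesis using True norm_triangle_ineq2[of x z] by simp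
    next
      case False
      then show ?thesis using norm_triangle_ineq2[of z x] by (simp add: norm_minus_commute)
    qed
    have "norm x / 2 - 2 * real n \<le> measure P B * (2 * norm x) - norm x - 2 * real n"
      using n mult_right_mono[of "3/4" "measure P B" "2 * norm x"] by (simp add: B_def)
    also have "\<dots> = (\<integral>z. indicator B z * (2 * norm x) - norm x - 2 * real n \<partial>P)"
      using iB Bs prob_space by (simp add: borel_prob_space[OF P])
    also have "\<dots> \<le> spatial_objective P x"
      unfolding spatial_objective_def using iB pt spatial_objective_integrable[OF P]
      by (intro integral_mono) auto
    finally show "norm x / 2 - 2 * real n \<le> spatial_objective P x" .
  qed
qed

section \<open>Pointwise consequences of equal norms on a dense set\<close>

lemma directional_limit_identities:
  fixes F G :: "'a::real_inner"
  assumes eq: "\<And>v. norm v = 1 \<Longrightarrow> norm (F + p *\<^sub>R v) = norm (G + q *\<^sub>R v)"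
    and e: "norm (e::'a) = 1"
  shows "p *\<^sub>R F = q *\<^sub>R G" "(norm F)\<^sup>2 + p\<^sup>2 = (norm G)\<^sup>2 + q\<^sup>2"
proof -
  have sq: "(norm F)\<^sup>2 + p\<^sup>2 + 2 * (p * inner F v) = (norm G)\<^sup>2 + q\<^sup>2 + 2 * (q * inner G v)" if "norm v = 1" for v
  proof -
    have "(norm (H + r *\<^sub>R v))\<^sup>2 = (norm H)\<^sup>2 + r\<^sup>2 + 2 * (r * inner H v)" for H r
    proof -
      have "inner v v = 1" using that by (simp flip: power2_norm_eq_inner)
      then show ?thesis unfolding power2_norm_eq_inner
        by (simp add: inner_add_left inner_add_right inner_commute power2_eq_square)
    qed
    then show ?thesis using eq[OF that] by metis
  qed
  \<comment> \<open>Using the identity for \<open>v\<close> and for \<open>- v\<close> separates the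
    terms odd in \<open>v\<close> from the constant ones.\<close>
  have lin: "p * inner F v = q * inner G v" if "norm v = 1" for v
    using sq[OF that] sq[of "- v"] that by simp
  have "inner (p *\<^sub>R F - q *\<^sub>R G) (sgn (p *\<^sub>R F - q *\<^sub>R G)) = 0"
  proof (cases "p *\<^sub>R F - q *\<^sub>R G = 0")
    case False
    then show ?thesis using lin[of "sgn (p *\<^sub>R F - q *\<^sub>R G)"] by (simp add: norm_sgn inner_diff_left)
  qed simp
  then show "p *\<^sub>R F = q *\<^sub>R G" by (simp add: sgn_div_norm)
  show "(norm F)\<^sup>2 + p\<^sup>2 = (norm G)\<^sup>2 + q\<^sup>2" using sq[OF e] lin[OF e] by simp
qed

text \<open>The pairs \<open>norm F\<close>, \<open>p\<close> and \<open>norm G\<close>,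
  \<open>q\<close> have the same product and the same sum of squares, so they agree up to order. If
  they are exchanged, \<open>p *\<^sub>R F = q *\<^sub>R G\<close> keeps \<open>F\<close> and
  \<open>G\<close> from pointing in different directions, and their norms add up.\<close>

lemma directional_limit_cases:
  fixes F G :: "'a::real_inner"
  assumes eq: "\<And>v. norm v = 1 \<Longrightarrow> norm (F + p *\<^sub>R v) = norm (G + q *\<^sub>R v)"
    and e: "norm (e::'a) = 1" and p: "p \<ge> 0" and q: "q \<ge> 0"
  shows "(norm F = norm G \<and> p = q) \<or> (p + q > 0 \<and> norm (F + G) = p + q)"
proof -
  note id = directional_limit_identities[OF eq e]
  define a b where "a = norm F" and "b = norm G"
  have ab: "a \<ge> 0" "b \<ge> 0" by (simp_all add: a_def b_def)
  have "norm (p *\<^sub>R F) = norm (q *\<^sub>R G)" using id(1) by simp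
  then have 1: "p * a = q * b" using p q by (simp add: a_def b_def)
  have 2: "a\<^sup>2 + p\<^sup>2 = b\<^sup>2 + q\<^sup>2" using id(2) by (simp add: a_def b_def)
  \<comment> \<open>Product and sum of squares leave only the sign of the difference of squares
    open; the two signs are the two cases.\<close>
  have "(a\<^sup>2 - p\<^sup>2)\<^sup>2 = (a\<^sup>2 + p\<^sup>2)\<^sup>2 - 4 * (p * a)\<^sup>2" by (simp add: power2_eq_square algebra_simps)
  also have "\<dots> = (b\<^sup>2 + q\<^sup>2)\<^sup>2 - 4 * (q * b)\<^sup>2" unfolding 1 2 ..
  also have "\<dots> = (b\<^sup>2 - q\<^sup>2)\<^sup>2" by (simp add: power2_eq_square algebra_simps)
  finally have "a\<^sup>2 - p\<^sup>2 = b\<^sup>2 - q\<^sup>2 \<or> a\<^sup>2 - p\<^sup>2 = - (b\<^sup>2 - q\<^sup>2)" by (simp add: power2_eq_iff)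
  then have "(a\<^sup>2 = b\<^sup>2 \<and> p\<^sup>2 = q\<^sup>2) \<or> (a\<^sup>2 = q\<^sup>2 \<and> p\<^sup>2 = b\<^sup>2)" using 2 by auto
  then consider "a = b" "p = q" | "a = q" "p = b" using ab p q by (auto simp: power2_eq_iff_nonneg)
  then show ?thesis
  proof cases
    case 1 then show ?thesis by (simp add: a_def b_def)
  next
    case 2
    show ?thesis
    proof (cases "p = q")
      case True then show ?thesis using 2 by (simp add: a_def b_def)
    next
      case False
      then have pq: "p + q > 0" using p q by linarith
      have "norm (F + G) = p + q"
      proof (cases "p = 0")
        case True
        then have "G = 0" using 2 by (simp add: b_def)
        then show ?thesis using 2 True by (simp add: a_def)
      next
        case False
        have "p *\<^sub>R (F + G) = (p + q) *\<^sub>R G" using id(1) by (simp add: algebra_simps)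
        then have "norm (p *\<^sub>R (F + G)) = norm ((p + q) *\<^sub>R G)" by simp
        then have "p * norm (F + G) = (p + q) * p" using p q 2 by (simp add: b_def)
        then show ?thesis using False by simp
      qed
      then show ?thesis using pq by simp
    qed
  qed
qed

text \<open>\<open>d n\<close> is chosen within \<open>r n * r n\<close> of
  \<open>x + r n *\<^sub>R v\<close>. This error is small compared with the distance
  \<open>r n\<close> to \<open>x\<close>, so the points of \<open>D\<close> approach
  \<open>x\<close> in the direction \<open>v\<close>.\<close>

lemma dense_directional_limits:
  fixes P Q :: "'a::{real_inner, banach, polish_space} measure"
  assumes P: "borel_prob P" and Q: "borel_prob Q"
    and D: "closure D = UNIV" and eq: "\<And>x. x \<in> D \<Longrightarrow> norm (spatial_df P x) = norm (spatial_df Q x)"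
    and v: "norm v = 1"
  shows "norm (spatial_df P x + measure P {x} *\<^sub>R v) = norm (spatial_df Q x + measure Q {x} *\<^sub>R v)"
proof -
  define r where "r n = 1 / real (Suc n)" for n
  have r: "r n > 0" for n by (simp add: r_def)
  have r0: "r \<longlonglongrightarrow> 0" unfolding r_def by (rule LIMSEQ_Suc[OF lim_inverse_n'])
  have "\<exists>d\<in>D. dist d (x + r n *\<^sub>R v) < r n * r n" for n
    using D r[of n] closure_approachable[of "x + r n *\<^sub>R v" D] by auto
  then obtain d where d: "\<And>n. d n \<in> D" "\<And>n. dist (d n) (x + r n *\<^sub>R v) < r n * r n" by metis
  define \<epsilon> where "\<epsilon> n = (d n - (x + r n *\<^sub>R v)) /\<^sub>R r n" for n
  have dx: "d n = x + r n *\<^sub>R (v + \<epsilon> n)" for n using r[of n] by (simp add: \<epsilon>_def algebra_simps)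
  have "norm (\<epsilon> n) \<le> r n" for n
  proof -
    have "norm (\<epsilon> n) = norm (d n - (x + r n *\<^sub>R v)) / r n"
      using r[of n] by (simp add: \<epsilon>_def divide_inverse_commute del: scaleR_right_diff_distrib)
    also have "\<dots> \<le> r n" using d(2)[of n] r[of n] by (simp add: dist_norm pos_divide_le_eq)
    finally show ?thesis .
  qed
  then have e0: "\<epsilon> \<longlonglongrightarrow> 0" by (intro Lim_null_comparison[OF _ r0] always_eventually allI)
  then have ve: "(\<lambda>n. v + \<epsilon> n) \<longlonglongrightarrow> v + 0" by (intro tendsto_intros)
  have "(\<lambda>n. x + r n *\<^sub>R (v + \<epsilon> n)) \<longlonglongrightarrow> x + 0 *\<^sub>R (v + 0)" by (intro tendsto_intros r0 e0)
  then have l1: "d \<longlonglongrightarrow> x" unfolding dx[abs_def, symmetric] by simp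
  have "(\<lambda>n. sgn (v + \<epsilon> n)) \<longlonglongrightarrow> sgn (v + 0)" using v by (intro tendsto_sgn ve) auto
  moreover have "sgn (d n - x) = sgn (v + \<epsilon> n)" for n unfolding dx using r[of n] by (simp add: sgn_scaleR)
  ultimately have l2: "(\<lambda>n. sgn (d n - x)) \<longlonglongrightarrow> v" using v by (simp add: sgn_div_norm)
  have "(\<lambda>n. norm (spatial_df P (d n))) \<longlonglongrightarrow> norm (spatial_df P x + measure P {x} *\<^sub>R v)"
    by (intro tendsto_norm spatial_df_directional_limit P l1 l2)
  moreover have "(\<lambda>n. norm (spatial_df Q (d n))) \<longlonglongrightarrow> norm (spatial_df Q x + measure Q {x} *\<^sub>R v)"
    by (intro tendsto_norm spatial_df_directional_limit Q l1 l2)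
  ultimately show ?thesis unfolding eq[OF d(1)] by (rule LIMSEQ_unique)
qed

lemma spatial_objective_coercive:
  fixes P :: "'a::{real_inner, banach, polish_space} measure"
  assumes P: "borel_prob P"
  shows "bounded {x. spatial_objective P x \<le> c}"
proof -
  obtain C where C: "\<And>x. norm x / 2 - C \<le> spatial_objective P x" using spatial_objective_lower[OF P] by blast
  show ?thesis
  proof (rule boundedI[of _ "2 * (c + C)"])
    fix x assume "x \<in> {x. spatial_objective P x \<le> c}"
    then show "norm x \<le> 2 * (c + C)" using C[of x] by simp
  qed
qed

text \<open>The subdifferential at \<open>x\<close> is the ball of radius
  \<open>measure Q {x}\<close> around \<open>spatial_df Q x\<close>. The length of its shortest
  element depends only on this radius and on the norm of the centre, and both numbers agree for
  \<open>P\<close> and \<open>Q\<close>.\<close>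

lemma slope_transfer:
  fixes P Q :: "'a::{real_inner, banach, polish_space} measure"
  assumes P: "borel_prob P" and Q: "borel_prob Q"
    and eq: "norm (spatial_df P x) = norm (spatial_df Q x)" "measure P {x} = measure Q {x}"
    and u: "subgrad (spatial_objective P) x u"
  shows "\<exists>w. subgrad (spatial_objective Q) x w \<and> norm w \<le> norm u"
proof -
  let ?G = "spatial_df Q x" and ?q = "measure Q {x}"
  have u': "norm ?G - ?q \<le> norm u"
    using spatial_objective_subgrad_norm[OF P u] norm_triangle_ineq2[of "spatial_df P x" u] eq
    by (simp add: norm_minus_commute)
  show ?thesis
  proof (cases "norm ?G \<le> ?q")
    case True
    define b where "b = - (?G /\<^sub>R ?q)"
    have "norm b \<le> 1"
    proof (cases "?q = 0")
      case False
      then have "?q > 0" by (simp add: less_le)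
      then show ?thesis using True by (simp add: b_def divide_inverse_commute[symmetric])
    qed (simp add: b_def)
    then have "subgrad (spatial_objective Q) x (?G + ?q *\<^sub>R b)" by (rule spatial_objective_subgrad[OF Q])
    moreover have "?G + ?q *\<^sub>R b = 0" using True by (cases "?q = 0") (auto simp: b_def)
    ultimately show ?thesis by (metis norm_ge_zero norm_zero)
  next
    case False
    then have nz: "?G \<noteq> 0" using measure_nonneg[of Q "{x}"] by (metis norm_zero)
    have "subgrad (spatial_objective Q) x (?G + ?q *\<^sub>R (- sgn ?G))"
      by (rule spatial_objective_subgrad[OF Q]) (simp add: norm_sgn)
    moreover have "norm (?G + ?q *\<^sub>R (- sgn ?G)) = norm ?G - ?q"
    proof -
      have "?G + ?q *\<^sub>R (- sgn ?G) = (norm ?G - ?q) *\<^sub>R sgn ?G"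
        using nz by (simp add: sgn_div_norm algebra_simps)
      then show ?thesis using False nz by (simp add: norm_sgn)
    qed
    ultimately show ?thesis using u' by metis
  qed
qed

section \<open>Exceptional points: equal measures or a common line\<close>

lemma eq_if_no_exceptional_point:
  fixes P Q :: "'a::{real_inner, banach, polish_space} measure"
  assumes P: "borel_prob P" and Q: "borel_prob Q"
    and eq: "\<And>x. norm (spatial_df P x) = norm (spatial_df Q x)" "\<And>x. measure P {x} = measure Q {x}"
    and v: "(v::'a) \<noteq> 0"
  shows "P = Q"
proof -
  obtain A where A: "\<And>x. norm x / 2 - A \<le> spatial_objective P x" using spatial_objective_lower[OF P] by blast
  obtain B where B: "\<And>x. norm x / 2 - B \<le> spatial_objective Q x" using spatial_objective_lower[OF Q] by blast
  have A': "- A \<le> spatial_objective P x" and B': "- B \<le> spatial_objective Q x" for x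
    using A[of x] B[of x] norm_ge_zero[of x] by linarith+
  show ?thesis
  proof (rule spatial_objective_inj[OF P Q _ v])
    fix x
    show "spatial_objective P x - spatial_objective Q x = (INF y. spatial_objective P y) - (INF y. spatial_objective Q y)"
    proof (rule convex_determined_by_slope)
      show "\<exists>w. subgrad (spatial_objective Q) x w \<and> norm w \<le> norm u" if "subgrad (spatial_objective P) x u" for x u
        by (rule slope_transfer[OF P Q eq that])
      show "\<exists>w. subgrad (spatial_objective P) x w \<and> norm w \<le> norm u" if "subgrad (spatial_objective Q) x u" for x u
        by (rule slope_transfer[OF Q P eq[symmetric] that])
      show "\<exists>u. subgrad (spatial_objective P) x u" for x using spatial_objective_subgrad0[OF P] by blast
    qed (rule spatial_objective_convex spatial_objective_lipschitz spatial_objective_coercive P Q A' B')+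
  qed
qed

text \<open>Taking both subgradients in the direction opposite to the sum of the two distribution
  values makes them cancel, as the joint mass at \<open>m\<close> equals the norm of that
  sum.\<close>

lemma sum_minimizer_if_exceptional:
  fixes P Q :: "'a::{real_inner, banach, polish_space} measure"
  assumes P: "borel_prob P" and Q: "borel_prob Q"
    and eq: "norm (spatial_df P m + spatial_df Q m) = measure P {m} + measure Q {m}"
  shows "spatial_objective P m + spatial_objective Q m \<le> spatial_objective P y + spatial_objective Q y"
proof -
  let ?F = "spatial_df P m + spatial_df Q m"
  let ?b = "- sgn ?F"
  have "norm ?b \<le> 1" by (simp add: norm_sgn)
  then have "subgrad (\<lambda>x. spatial_objective P x + spatial_objective Q x) m
    ((spatial_df P m + measure P {m} *\<^sub>R ?b) + (spatial_df Q m + measure Q {m} *\<^sub>R ?b))"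
    by (intro subgrad_add spatial_objective_subgrad P Q)
  also have "(spatial_df P m + measure P {m} *\<^sub>R ?b) + (spatial_df Q m + measure Q {m} *\<^sub>R ?b) = ?F - norm ?F *\<^sub>R sgn ?F"
    unfolding eq by (simp add: algebra_simps)
  also have "\<dots> = 0" by (cases "?F = 0") (simp_all add: sgn_div_norm)
  finally show ?thesis using subgradD[of "\<lambda>x. spatial_objective P x + spatial_objective Q x" m 0 y] by simp
qed

text \<open>\<open>g\<close> is the convexity defect of the norm at the midpoint \<open>c\<close>.
  It is nonnegative with integral 0 under both measures, so almost every \<open>z\<close> has
  equality in the triangle inequality, which puts \<open>z\<close> on the line through
  \<open>a\<close> and \<open>b\<close>.\<close>

lemma on_line_if_two_minimizers:
  fixes P Q :: "'a::{real_inner, banach, polish_space} measure"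
  assumes P: "borel_prob P" and Q: "borel_prob Q" and ab: "a \<noteq> b"
    and a: "\<And>y. spatial_objective P a + spatial_objective Q a \<le> spatial_objective P y + spatial_objective Q y"
    and b: "spatial_objective P b + spatial_objective Q b \<le> spatial_objective P a + spatial_objective Q a"
  defines "e \<equiv> sgn (b - a)"
  shows "AE z in P. z = a + inner (z - a) e *\<^sub>R e" "AE z in Q. z = a + inner (z - a) e *\<^sub>R e"
proof -
  define c where "c = (1/2) *\<^sub>R (a + b)"
  define g where "g z = (norm (a - z) - norm (c - z)) / 2 + (norm (b - z) - norm (c - z)) / 2" for z
  have tri: "norm (c - z) = norm ((a - z) + (b - z)) / 2" for z
  proof -
    have "c - z = (1/2) *\<^sub>R ((a - z) + (b - z))" by (simp add: c_def algebra_simps flip: scaleR_add_left)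
    then show ?thesis by simp
  qed
  have "0 \<le> (A - N / 2) / 2 + (B - N / 2) / 2" if "N \<le> A + B" for A B N :: real
    using that by (simp add: field_simps)
  then have g0: "0 \<le> g z" for z unfolding g_def tri by (simp only: norm_triangle_ineq)
  have ig: "integrable M g" and vg: "integral\<^sup>L M g = (spatial_objective M a + spatial_objective M b) / 2 - spatial_objective M c"
    if M: "borel_prob M" for M
  proof -
    note i = spatial_objective_diff(1)[OF M] and v = spatial_objective_diff(2)[OF M, symmetric]
    show "integrable M g" unfolding g_def by (intro Bochner_Integration.integrable_add integrable_divide i)
    show "integral\<^sup>L M g = (spatial_objective M a + spatial_objective M b) / 2 - spatial_objective M c"
      unfolding g_def by (subst Bochner_Integration.integral_add) (use i in \<open>auto simp: v field_simps\<close>)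
  qed
  have "integral\<^sup>L P g + integral\<^sup>L Q g \<le> 0"
    unfolding vg[OF P] vg[OF Q] using a[of c] b by (simp add: field_simps)
  moreover have "0 \<le> integral\<^sup>L P g" "0 \<le> integral\<^sup>L Q g" using g0 by (auto intro: integral_nonneg_AE)
  ultimately have z: "integral\<^sup>L P g = 0" "integral\<^sup>L Q g = 0" by auto
  have line: "z = a + inner (z - a) e *\<^sub>R e" if gz: "g z = 0" for z
  proof -
    define r s where "r = norm (a - z)" and "s = norm (b - z)"
    have "norm ((a - z) + (b - z)) = norm (a - z) + norm (b - z)"
      using gz unfolding g_def tri by (simp add: field_simps)
    then have rs: "r *\<^sub>R (b - z) = s *\<^sub>R (a - z)" unfolding norm_triangle_eq r_def s_def .
    then have "r *\<^sub>R (b - a) = (r - s) *\<^sub>R (z - a)" by (simp add: algebra_simps)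
    \<comment> \<open>Equal distances would make \<open>a - z\<close> and \<open>b - z\<close> the
      same vector, against \<open>a \<noteq> b\<close>.\<close>
    moreover have "r \<noteq> s"
    proof
      assume "r = s"
      then have "r *\<^sub>R (b - a) = 0" using rs by (simp add: algebra_simps)
      then have "r = 0" using ab by simp
      then show False using \<open>r = s\<close> ab by (simp add: r_def s_def)
    qed
    ultimately have "z - a = (r / (r - s)) *\<^sub>R (b - a)"
      by (metis (no_types, lifting) divide_inverse_commute eq_iff_diff_eq_0 eq_vector_fraction_iff scaleR_scaleR)
    moreover have "b - a = norm (b - a) *\<^sub>R e" using ab by (simp add: e_def sgn_div_norm)
    ultimately obtain k where k: "z - a = k *\<^sub>R e" by (metis scaleR_scaleR)
    have "inner e e = 1" using ab by (simp add: e_def norm_sgn flip: power2_norm_eq_inner)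
    then have "inner (z - a) e = k" unfolding k by simp
    then show ?thesis using k by (simp add: algebra_simps)
  qed
  have "AE z in M. z = a + inner (z - a) e *\<^sub>R e" if M: "borel_prob M" and z: "integral\<^sup>L M g = 0" for M
  proof -
    have "AE z in M. g z = 0" using integral_nonneg_eq_0_iff_AE[OF ig[OF M]] g0 z by auto
    then show ?thesis by eventually_elim (rule line)
  qed
  then show "AE z in P. z = a + inner (z - a) e *\<^sub>R e" "AE z in Q. z = a + inner (z - a) e *\<^sub>R e"
    using P Q z by blast+
qed

text \<open>
  At an exceptional point \<open>m\<close> the sum of the objectives grows at least like
  \<open>\<rho> * (\<parallel>y - m\<parallel> + \<langle>n, y - m\<rangle>)\<close> with \<open>n\<close> the direction of its gradient, so a minimizing sequence
  approaches the ray from \<open>m\<close> in the direction \<open>- n\<close>; this replaces compactness.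
\<close>

lemma minimizing_sequence_converges:
  fixes P Q :: "'a::{real_inner, banach, polish_space} measure"
  assumes P: "borel_prob P" and Q: "borel_prob Q"
    and eq: "norm (spatial_df P m + spatial_df Q m) = measure P {m} + measure Q {m}"
    and pos: "measure P {m} + measure Q {m} > 0"
    and uniq: "\<And>y. spatial_objective P y + spatial_objective Q y \<le> spatial_objective P m + spatial_objective Q m \<Longrightarrow> y = m"
    and bd: "bounded (range y)"
    and lim: "(\<lambda>k. spatial_objective P (y k) + spatial_objective Q (y k)) \<longlonglongrightarrow> spatial_objective P m + spatial_objective Q m"
  shows "y \<longlonglongrightarrow> m"
proof -
  define s where "s x = spatial_objective P x + spatial_objective Q x" for x
  define F where "F = spatial_df P m + spatial_df Q m"
  define \<rho> where "\<rho> = measure P {m} + measure Q {m}"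
  define n where "n = F /\<^sub>R \<rho>"
  have \<rho>: "\<rho> > 0" using pos by (simp add: \<rho>_def)
  have n1: "inner n n = 1"
  proof -
    have "norm n = 1" using eq \<rho> by (simp add: n_def F_def \<rho>_def)
    then show ?thesis by (simp flip: power2_norm_eq_inner)
  qed
  have \<rho>n: "\<rho> *\<^sub>R n = F" using \<rho> by (simp add: n_def)
  define l where "l k = norm (y k - m)" for k
  have growth: "\<rho> * (l k + inner n (y k - m)) \<le> s (y k) - s m" for k
  proof -
    let ?b = "sgn (y k - m)"
    have "norm ?b \<le> 1" by (simp add: norm_sgn)
    then have "subgrad s m ((spatial_df P m + measure P {m} *\<^sub>R ?b) + (spatial_df Q m + measure Q {m} *\<^sub>R ?b))"
      unfolding s_def[abs_def] by (intro subgrad_add spatial_objective_subgrad P Q)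
    moreover have "(spatial_df P m + measure P {m} *\<^sub>R ?b) + (spatial_df Q m + measure Q {m} *\<^sub>R ?b) = \<rho> *\<^sub>R (n + ?b)"
      unfolding scaleR_add_right \<rho>n by (simp add: F_def \<rho>_def algebra_simps)
    moreover have "inner ?b (y k - m) = l k"
      by (cases "y k = m") (auto simp: l_def sgn_div_norm power2_norm_eq_inner[symmetric] power2_eq_square)
    ultimately show ?thesis using subgradD[of s m "\<rho> *\<^sub>R (n + ?b)" "y k"]
      by (simp add: inner_add_left algebra_simps)
  qed
  have slim: "(\<lambda>k. s (y k)) \<longlonglongrightarrow> s m" using lim by (simp add: s_def)
  have sm: "s m \<le> s x" for x unfolding s_def by (rule sum_minimizer_if_exceptional[OF P Q eq])
  obtain B where B: "\<And>k. l k \<le> B"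
    using bd unfolding l_def by (metis bounded_any_center dist_norm norm_minus_commute rangeI)
  \<comment> \<open>As \<open>n\<close> is a unit vector and \<open>l k\<close> the length of
    \<open>y k - m\<close>, the square on the left is
    \<open>2 * l k * (l k + inner n (y k - m))\<close>, to which \<open>growth\<close>
    applies.\<close>
  have near: "(norm (y k - (m - l k *\<^sub>R n)))\<^sup>2 \<le> 2 * B / \<rho> * (s (y k) - s m)" for k
  proof -
    define w where "w = y k - m"
    have lw: "(l k)\<^sup>2 = inner w w" by (simp add: l_def w_def power2_norm_eq_inner)
    have "y k - (m - l k *\<^sub>R n) = w + l k *\<^sub>R n" by (simp add: w_def)
    then have "(norm (y k - (m - l k *\<^sub>R n)))\<^sup>2 = (norm (w + l k *\<^sub>R n))\<^sup>2" by (simp only:)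
    also have "\<dots> = inner w w + (l k)\<^sup>2 * inner n n + 2 * l k * inner n w"
      unfolding power2_norm_eq_inner
      by (simp add: inner_add_left inner_add_right inner_commute power2_eq_square)
    also have "\<dots> = (l k)\<^sup>2 + (l k)\<^sup>2 + 2 * l k * inner n (y k - m)"
      unfolding lw n1 by (simp add: w_def)
    also have "\<dots> = 2 * l k / \<rho> * (\<rho> * (l k + inner n (y k - m)))"
      using \<rho> by (simp add: power2_eq_square algebra_simps)
    also have "\<dots> \<le> 2 * l k / \<rho> * (s (y k) - s m)"
      using \<rho> by (intro mult_left_mono growth) (auto simp: l_def)
    also have "\<dots> \<le> 2 * B / \<rho> * (s (y k) - s m)"
      using \<rho> sm[of "y k"] B[of k] by (intro mult_right_mono divide_right_mono) auto
    finally show ?thesis .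
  qed
  have "(\<lambda>k. 2 * B / \<rho> * (s (y k) - s m)) \<longlonglongrightarrow> 2 * B / \<rho> * (s m - s m)"
    by (intro tendsto_intros slim)
  then have "(\<lambda>k. 2 * B / \<rho> * (s (y k) - s m)) \<longlonglongrightarrow> 0" by simp
  then have "(\<lambda>k. (norm (y k - (m - l k *\<^sub>R n)))\<^sup>2) \<longlonglongrightarrow> 0"
    by (rule tendsto_sandwich[OF _ _ tendsto_const, rotated 2]) (intro always_eventually allI near zero_le_power2)+
  then have "(\<lambda>k. sqrt ((norm (y k - (m - l k *\<^sub>R n)))\<^sup>2)) \<longlonglongrightarrow> sqrt 0" by (rule tendsto_real_sqrt)
  then have ray: "(\<lambda>k. norm (y k - (m - l k *\<^sub>R n))) \<longlonglongrightarrow> 0" by simp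
  have slip: "s a \<le> s b + 2 * norm (b - a)" for a b
    using lipschitz_onD[OF spatial_objective_lipschitz[OF P], of a b]
      lipschitz_onD[OF spatial_objective_lipschitz[OF Q], of a b]
    by (simp add: s_def dist_norm norm_minus_commute abs_le_iff)
  have "(\<lambda>k. s (y k) + 2 * norm (y k - (m - l k *\<^sub>R n))) \<longlonglongrightarrow> s m + 2 * 0"
    by (intro tendsto_intros slim ray)
  then have up: "(\<lambda>k. s (y k) + 2 * norm (y k - (m - l k *\<^sub>R n))) \<longlonglongrightarrow> s m" by simp
  have cvx: "convex_on UNIV s" unfolding s_def[abs_def]
    by (intro convex_on_add spatial_objective_convex P Q)
  have "l \<longlonglongrightarrow> 0"
  proof (rule LIMSEQ_I)
    fix \<epsilon> :: real assume \<epsilon>: "\<epsilon> > 0"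
    have "m - \<epsilon> *\<^sub>R n \<noteq> m" using \<epsilon> n1 by auto
    then have "s m < s (m - \<epsilon> *\<^sub>R n)" using uniq[of "m - \<epsilon> *\<^sub>R n"] by (auto simp: s_def not_le[symmetric])
    then have "\<forall>\<^sub>F k in sequentially. s (y k) + 2 * norm (y k - (m - l k *\<^sub>R n)) < s (m - \<epsilon> *\<^sub>R n)"
      by (rule order_tendstoD(2)[OF up])
    then have "\<forall>\<^sub>F k in sequentially. norm (l k - 0) < \<epsilon>"
    proof eventually_elim
      case (elim k)
      show ?case
      proof (rule ccontr)
        assume "\<not> norm (l k - 0) < \<epsilon>"
        then have lk: "\<epsilon> \<le> l k" by (simp add: l_def)
        \<comment> \<open>A far iterate puts \<open>m - \<epsilon> *\<^sub>R n\<close> on the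
          segment from \<open>m\<close> to \<open>m - l k *\<^sub>R n\<close>. By convexity its
          value is at most that at the far end, which is already too small.\<close>
        define t where "t = \<epsilon> / l k"
        have t: "0 \<le> t" "t \<le> 1" "t * l k = \<epsilon>" using \<epsilon> lk by (auto simp: t_def)
        have "m - \<epsilon> *\<^sub>R n = (1 - t) *\<^sub>R m + t *\<^sub>R (m - l k *\<^sub>R n)"
          using t(3) by (simp add: algebra_simps)
        then have "s (m - \<epsilon> *\<^sub>R n) \<le> (1 - t) * s m + t * s (m - l k *\<^sub>R n)"
          using convex_onD[OF cvx, of t m "m - l k *\<^sub>R n"] t by simp
        also have "\<dots> \<le> (1 - t) * s (m - l k *\<^sub>R n) + t * s (m - l k *\<^sub>R n)"
          using t sm by (intro add_right_mono mult_left_mono) auto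
        also have "\<dots> = s (m - l k *\<^sub>R n)" by (simp add: algebra_simps)
        also have "\<dots> \<le> s (y k) + 2 * norm (y k - (m - l k *\<^sub>R n))" by (rule slip)
        finally show False using elim by simp
      qed
    qed
    then show "\<exists>no. \<forall>k\<ge>no. norm (l k - 0) < \<epsilon>" by (simp add: eventually_sequentially)
  qed
  then show ?thesis unfolding l_def by (simp add: tendsto_norm_zero_iff LIM_zero_iff)
qed

text \<open>Without an atom the subgradient of the sum is unique. With equal positive atoms the
  third equation makes the two distribution values equal, and \<open>u\<close> splits into two equal
  halves.\<close>

lemma sum_subgrad_split:
  fixes P Q :: "'a::{real_inner, banach, polish_space} measure"
  assumes P: "borel_prob P" and Q: "borel_prob Q"
    and eq: "norm (spatial_df P x) = norm (spatial_df Q x)" "measure P {x} = measure Q {x}"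
      "measure P {x} *\<^sub>R spatial_df P x = measure Q {x} *\<^sub>R spatial_df Q x"
    and u: "subgrad (\<lambda>x. spatial_objective P x + spatial_objective Q x) x u"
  shows "\<exists>\<xi> \<eta>. subgrad (spatial_objective P) x \<xi> \<and> subgrad (spatial_objective Q) x \<eta> \<and> u = \<xi> + \<eta> \<and> norm \<xi> = norm \<eta>"
proof (cases "measure Q {x} = 0")
  case True
  then have "u = spatial_df P x + spatial_df Q x"
    using spatial_objective_sum_subgrad_norm[OF P Q u] eq by simp
  then show ?thesis using spatial_objective_subgrad0[OF P] spatial_objective_subgrad0[OF Q] eq by blast
next
  case False
  define q where "q = measure Q {x}"
  have q: "q > 0" using False by (simp add: q_def less_le)
  have FG: "spatial_df P x = spatial_df Q x" using eq False by simp
  define b where "b = (u - (spatial_df Q x + spatial_df Q x)) /\<^sub>R (2 * q)"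
  have b: "norm b \<le> 1"
    using spatial_objective_sum_subgrad_norm[OF P Q u] eq(2) q unfolding FG
    by (simp add: b_def q_def divide_inverse_commute[symmetric] del: scaleR_right_diff_distrib)
  have "u = (spatial_df Q x + q *\<^sub>R b) + (spatial_df Q x + q *\<^sub>R b)"
  proof -
    have "(2 * q) *\<^sub>R b = u - (spatial_df Q x + spatial_df Q x)" using q by (simp add: b_def)
    then show ?thesis by (simp add: algebra_simps flip: scaleR_2)
  qed
  moreover have "subgrad (spatial_objective P) x (spatial_df Q x + q *\<^sub>R b)"
    using spatial_objective_subgrad[OF P b, of x] FG eq(2) by (simp add: q_def)
  moreover have "subgrad (spatial_objective Q) x (spatial_df Q x + q *\<^sub>R b)"
    using spatial_objective_subgrad[OF Q b, of x] by (simp add: q_def)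
  ultimately show ?thesis by blast
qed

theorem eq_or_on_line:
  fixes P Q :: "'a::{real_inner, banach, polish_space} measure"
  assumes P: "borel_prob P" and Q: "borel_prob Q" and v: "norm (v::'a) = 1"
    and eq: "\<And>x v. norm v = 1 \<Longrightarrow> norm (spatial_df P x + measure P {x} *\<^sub>R v) = norm (spatial_df Q x + measure Q {x} *\<^sub>R v)"
    and ne: "P \<noteq> Q"
  obtains a e where "norm (e::'a) = 1"
    "AE z in P. z = a + inner (z - a) e *\<^sub>R e" "AE z in Q. z = a + inner (z - a) e *\<^sub>R e"
proof -
  define s where "s x = spatial_objective P x + spatial_objective Q x" for x
  have v0: "v \<noteq> 0" using v by auto
  let ?reg = "\<lambda>x. norm (spatial_df P x) = norm (spatial_df Q x) \<and> measure P {x} = measure Q {x}"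
  let ?exc = "\<lambda>x. measure P {x} + measure Q {x} > 0 \<and> norm (spatial_df P x + spatial_df Q x) = measure P {x} + measure Q {x}"
  have cases: "?reg x \<or> ?exc x" for x
    by (rule directional_limit_cases[OF eq v]) auto
  have "\<exists>m. ?exc m"
  proof (rule ccontr)
    assume "\<not> ?thesis"
    then have "?reg x" for x using cases by blast
    then have "P = Q" by (intro eq_if_no_exceptional_point[OF P Q _ _ v0]) auto
    then show False using ne by simp
  qed
  then obtain m where m: "?exc m" by blast
  have sm: "s m \<le> s y" for y unfolding s_def by (rule sum_minimizer_if_exceptional[OF P Q]) (use m in simp)
  show ?thesis
  proof (cases "\<exists>b. b \<noteq> m \<and> s b \<le> s m")
    case True
    then obtain b where b: "b \<noteq> m" "s b \<le> s m" by blast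
    show ?thesis
      by (rule that[OF _ on_line_if_two_minimizers[OF P Q b(1)[symmetric]]])
        (use b sm in \<open>auto simp: s_def norm_sgn\<close>)
  next
    case False
    have "spatial_objective P x - spatial_objective Q x = spatial_objective P m - spatial_objective Q m" for x
    proof (rule diff_const_of_sum_flow)
      show "convex_on UNIV (\<lambda>x. spatial_objective P x + spatial_objective Q x)"
        by (intro convex_on_add spatial_objective_convex P Q)
      show "(1 + 1)-lipschitz_on UNIV (\<lambda>x. spatial_objective P x + spatial_objective Q x)"
        by (intro lipschitz_on_add spatial_objective_lipschitz P Q)
      show "1-lipschitz_on UNIV (spatial_objective P)" "1-lipschitz_on UNIV (spatial_objective Q)"
        by (intro spatial_objective_lipschitz P Q)+
      show "bounded {x. spatial_objective P x + spatial_objective Q x \<le> c}" for c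
      proof -
        obtain C where C: "\<And>x. norm x / 2 - C \<le> spatial_objective Q x" using spatial_objective_lower[OF Q] by blast
        have "spatial_objective P x \<le> c + C" if "spatial_objective P x + spatial_objective Q x \<le> c" for x
          using that C[of x] norm_ge_zero[of x] by linarith
        then have "{x. spatial_objective P x + spatial_objective Q x \<le> c} \<subseteq> {x. spatial_objective P x \<le> c + C}"
          by blast
        then show ?thesis by (rule bounded_subset[OF spatial_objective_coercive[OF P]])
      qed
      show "\<exists>u. subgrad (\<lambda>x. spatial_objective P x + spatial_objective Q x) x u" for x
        using subgrad_add[OF spatial_objective_subgrad0[OF P] spatial_objective_subgrad0[OF Q]] by blast
      show "(\<forall>y. spatial_objective P x + spatial_objective Q x \<le> spatial_objective P y + spatial_objective Q y) \<or>
        (\<exists>\<xi> \<eta>. subgrad (spatial_objective P) x \<xi> \<and> subgrad (spatial_objective Q) x \<eta> \<and> u = \<xi> + \<eta> \<and> norm \<xi> = norm \<eta>)"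
        if u: "subgrad (\<lambda>x. spatial_objective P x + spatial_objective Q x) x u" for x u
        \<comment> \<open>The split is only demanded off the minimizers of the sum, where
          \<open>x\<close> cannot be exceptional.\<close>
        using cases[of x]
      proof
        assume "?reg x"
        then show ?thesis
          using sum_subgrad_split[OF P Q _ _ directional_limit_identities(1)[OF eq v] u] by blast
      next
        assume "?exc x"
        then show ?thesis using sum_minimizer_if_exceptional[OF P Q] by blast
      qed
      show "spatial_objective P m + spatial_objective Q m \<le> spatial_objective P y + spatial_objective Q y" for y
        using sm by (simp add: s_def)
      show "x \<longlonglongrightarrow> m" if "bounded (range x)"
        "(\<lambda>k. spatial_objective P (x k) + spatial_objective Q (x k)) \<longlonglongrightarrow> spatial_objective P m + spatial_objective Q m" for x
        by (rule minimizing_sequence_converges[OF P Q _ _ _ that]) (use m False in \<open>auto simp: s_def\<close>)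
    qed
    then have "P = Q" by (rule spatial_objective_inj[OF P Q _ v0])
    then show ?thesis using ne by simp
  qed
qed

section \<open>Distribution functions on the line\<close>

lemma cdf_right_limit_eq:
  assumes M: "real_distribution M" and ab: "a < b" and c: "\<And>t. a < t \<Longrightarrow> t < b \<Longrightarrow> cdf M t = c"
  shows "cdf M a = c"
proof -
  interpret real_distribution M by (rule M)
  have "(cdf M \<longlongrightarrow> cdf M a) (at_right a)"
    using cdf_is_right_cont[of a] by (simp add: continuous_within)
  moreover have "\<forall>\<^sub>F t in at_right a. cdf M t = c"
    unfolding eventually_at_right[OF ab] using ab c by blast
  then have "(cdf M \<longlongrightarrow> c) (at_right a)" by (rule tendsto_eventually)
  ultimately show ?thesis by (rule tendsto_unique[rotated]) simp
qed

text \<open>\<open>p\<close> and \<open>q\<close> are nondecreasing and agree up to sign. The signs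
  differ on an interval around \<open>x0\<close> with end points \<open>m1\<close> and
  \<open>m2\<close>; outside it monotonicity excludes opposite nonzero values.\<close>

lemma cdf_folded_eq_cases:
  assumes M: "real_distribution M" and N: "real_distribution N"
    and eq: "\<And>t. \<bar>2 * cdf M t - 1\<bar> = \<bar>2 * cdf N t - 1\<bar>"
    and x0: "cdf M x0 > 1/2" "cdf N x0 < 1/2"
  obtains m1 m2 \<alpha> where "m1 < m2" "0 < \<alpha>"
    "\<And>t. t < m1 \<Longrightarrow> cdf M t = cdf N t \<and> cdf M t \<le> (1 - \<alpha>) / 2"
    "\<And>t. m1 \<le> t \<Longrightarrow> t < m2 \<Longrightarrow> cdf M t = (1 + \<alpha>) / 2 \<and> cdf N t = (1 - \<alpha>) / 2"
    "\<And>t. m2 \<le> t \<Longrightarrow> cdf M t = cdf N t \<and> (1 + \<alpha>) / 2 \<le> cdf M t"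
proof -
  interpret M: real_distribution M by (rule M)
  interpret N: real_distribution N by (rule N)
  define p q where "p t = 2 * cdf M t - 1" and "q t = 2 * cdf N t - 1" for t
  have pm: "s \<le> t \<Longrightarrow> p s \<le> p t" and qm: "s \<le> t \<Longrightarrow> q s \<le> q t" for s t
    using M.cdf_nondecreasing N.cdf_nondecreasing by (auto simp: p_def q_def)
  have pq: "p t = q t \<or> p t = - q t" for t using eq[of t] by (simp add: p_def q_def abs_eq_iff)
  have p0: "p x0 > 0" and q0: "q x0 < 0" using x0 by (auto simp: p_def q_def)
  have pq0: "p x0 = - q x0" using pq[of x0] p0 q0 by linarith
  define \<alpha> where "\<alpha> = p x0"
  \<comment> \<open>Where the signs differ, \<open>p = - q\<close> with \<open>p\<close> and
    \<open>q\<close> both nondecreasing, so \<open>p\<close> can only keep its value at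
    \<open>x0\<close>.\<close>
  have const: "p t = \<alpha> \<and> q t = - \<alpha>" if "p t > 0" "q t < 0" for t
    using pq[of t] that pq0 pm[of t x0] pm[of x0 t] qm[of t x0] qm[of x0 t] unfolding \<alpha>_def
    by (cases "t \<le> x0") linarith+
  define U where "U = {t. p t > 0}"
  define V where "V = {t. q t < 0}"
  have "\<forall>\<^sub>F t in at_bot. cdf M t < 1/2"
    by (rule order_tendstoD[OF M.cdf_lim_at_bot]) simp
  then obtain l where l: "cdf M l < 1/2" unfolding eventually_at_bot_linorder by blast
  have "\<forall>\<^sub>F t in at_top. cdf N t > 1/2"
    by (rule order_tendstoD[OF N.cdf_lim_at_top_prob]) simp
  then obtain u where u: "cdf N u > 1/2" unfolding eventually_at_top_linorder by blast
  have Ub: "bdd_below U"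
  proof (rule bdd_belowI)
    fix t assume "t \<in> U"
    then show "l \<le> t" using pm[of t l] l by (cases "t \<le> l") (auto simp: U_def p_def)
  qed
  have Vb: "bdd_above V"
  proof (rule bdd_aboveI)
    fix t assume "t \<in> V"
    then show "t \<le> u" using qm[of u t] u by (cases "u \<le> t") (auto simp: V_def q_def)
  qed
  have xU: "x0 \<in> U" and xV: "x0 \<in> V" using p0 q0 by (auto simp: U_def V_def)
  define m1 where "m1 = Inf U"
  define m2 where "m2 = Sup V"
  have m1x: "m1 \<le> x0" unfolding m1_def using Ub xU by (rule cInf_lower[rotated])
  have below: "p t \<le> 0" if "t < m1" for t
    using that cInf_lower[OF _ Ub, of t] unfolding m1_def U_def by (auto simp: not_less[symmetric])
  have "p t > 0" if mt: "m1 < t" for t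
  proof -
    obtain s where "s \<in> U" "s < t" using cInf_lessD[of U t] mt xU unfolding m1_def by auto
    then show ?thesis using pm[of s t] by (simp add: U_def)
  qed
  \<comment> \<open>Right continuity assigns the left end point to the middle range; in the same way
    \<open>m2\<close> falls to the right-hand range below.\<close>
  moreover have "p m1 > 0"
  proof (cases "m1 = x0")
    case False
    then have lt: "m1 < x0" using m1x by simp
    have "cdf M m1 = (1 + \<alpha>) / 2"
    proof (rule cdf_right_limit_eq[OF M lt])
      fix t assume "m1 < t" "t < x0"
      then have "p t > 0" "q t < 0" using \<open>\<And>t. m1 < t \<Longrightarrow> p t > 0\<close> qm[of t x0] q0 by auto
      then show "cdf M t = (1 + \<alpha>) / 2" using const[of t] by (simp add: p_def field_simps)
    qed
    then show ?thesis using p0 by (simp add: p_def \<alpha>_def)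
  qed (use p0 in simp)
  ultimately have above: "p t > 0" if "m1 \<le> t" for t using that by (cases "t = m1") auto
  have left: "q t < 0" if mt: "t < m2" for t
  proof -
    obtain s where "s \<in> V" "t < s" using less_cSupD[of V t] mt xV unfolding m2_def by auto
    then show ?thesis using qm[of t s] by (simp add: V_def)
  qed
  have right: "q t \<ge> 0" if "m2 \<le> t" for t
  proof (rule ccontr)
    assume "\<not> 0 \<le> q t"
    then have qt: "q t < 0" by simp
    have "(cdf N \<longlongrightarrow> cdf N t) (at_right t)"
      using N.cdf_is_right_cont[of t] by (simp add: continuous_within)
    then have "\<forall>\<^sub>F s in at_right t. cdf N s < 1/2" by (rule order_tendstoD) (use qt in \<open>simp add: q_def\<close>)
    then obtain b where b: "b > t" "\<And>s. t < s \<Longrightarrow> s < b \<Longrightarrow> cdf N s < 1/2"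
      unfolding eventually_at_right[OF less_add_one] by blast
    have "(t + b) / 2 \<in> V" using b(1) b(2)[of "(t + b) / 2"] by (simp add: V_def q_def)
    then have "(t + b) / 2 \<le> m2" unfolding m2_def using Vb by (rule cSup_upper)
    then show False using that \<open>b > t\<close> by simp
  qed
  have x0m2: "x0 < m2" using right[of x0] q0 by (cases "m2 \<le> x0") auto
  show ?thesis
  proof (rule that[of m1 m2 \<alpha>])
    show "m1 < m2" using m1x x0m2 by simp
    show "0 < \<alpha>" using p0 by (simp add: \<alpha>_def)
    show "cdf M t = cdf N t \<and> cdf M t \<le> (1 - \<alpha>) / 2" if "t < m1" for t
    proof -
      have "q t \<le> - \<alpha>" using qm[of t x0] that m1x pq0 by (simp add: \<alpha>_def)
      moreover have "p t \<le> 0" using below that by simp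
      ultimately have "p t = q t" using pq[of t] p0 unfolding \<alpha>_def by linarith
      then show ?thesis using \<open>q t \<le> - \<alpha>\<close> by (simp add: p_def q_def)
    qed
    show "cdf M t = (1 + \<alpha>) / 2 \<and> cdf N t = (1 - \<alpha>) / 2" if "m1 \<le> t" "t < m2" for t
      using const[of t] above[OF that(1)] left[OF that(2)] by (simp add: p_def q_def field_simps)
    show "cdf M t = cdf N t \<and> (1 + \<alpha>) / 2 \<le> cdf M t" if "m2 \<le> t" for t
    proof -
      have "\<alpha> \<le> p t" using pm[of x0 t] that x0m2 by (simp add: \<alpha>_def)
      moreover have "q t \<ge> 0" using right that by simp
      ultimately have "p t = q t" using pq[of t] p0 unfolding \<alpha>_def by linarith
      then show ?thesis using \<open>\<alpha> \<le> p t\<close> by (simp add: p_def q_def field_simps)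
    qed
  qed
qed

text \<open>Induction over the sigma-algebra generated by the half-lines, carried out for a signed
  difference: both sides add up over disjoint unions and change sign under complements, because both
  vanish on the whole line.\<close>

lemma real_measure_diff_eqI:
  assumes M: "real_distribution M" and N: "real_distribution N"
    and eq: "\<And>t. cdf M t - cdf N t = \<alpha> * (indicator {..t} m1 - indicator {..t} m2)"
    and B: "B \<in> sets borel"
  shows "measure M B - measure N B = \<alpha> * (indicator B m1 - indicator B m2)"
proof -
  interpret M: real_distribution M by (rule M)
  interpret N: real_distribution N by (rule N)
  have gen: "sets borel = sigma_sets UNIV (range (\<lambda>t::real. {..t}))"
    by (subst borel_eq_atMost) simp
  have stable: "Int_stable (range (\<lambda>t::real. {..t}))"
  proof (rule Int_stableI)
    fix a b :: "real set" assume "a \<in> range (\<lambda>t. {..t})" "b \<in> range (\<lambda>t. {..t})"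
    then obtain s t where "a = {..s}" "b = {..t}" by auto
    then have "a \<inter> b = {..min s t}" by auto
    then show "a \<inter> b \<in> range (\<lambda>t. {..t})" by simp
  qed
  have sub: "range (\<lambda>t::real. {..t}) \<subseteq> Pow UNIV" by simp
  from stable sub B[unfolded gen] show ?thesis
  proof (induction rule: sigma_sets_induct_disjoint)
    case (basic A)
    then show ?case using eq by (auto simp: cdf_def)
  next
    case (compl A)
    then have "A \<in> sets borel" by (simp add: gen)
    then have c: "measure M (UNIV - A) = 1 - measure M A" "measure N (UNIV - A) = 1 - measure N A"
      using M.prob_compl[of A] N.prob_compl[of A] by auto
    have i: "indicator (UNIV - A) m = 1 - (indicator A m :: real)" for m by (simp add: indicator_def)
    show ?case unfolding c i using compl by (simp add: algebra_simps)
  next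
    case (union A)
    have A: "range A \<subseteq> sets borel" using union(2) by (simp add: gen)
    have "(\<lambda>i. measure M (A i) - measure N (A i)) sums (measure M (\<Union>i. A i) - measure N (\<Union>i. A i))"
      using union(1) A by (intro sums_diff M.finite_measure_UNION N.finite_measure_UNION) auto
    moreover have "(\<lambda>i. \<alpha> * (indicator (A i) m1 - indicator (A i) m2)) sums (\<alpha> * (indicator (\<Union>i. A i) m1 - indicator (\<Union>i. A i) m2))"
      using union(1) by (intro sums_mult sums_diff indicator_sums) (auto simp: disjoint_family_on_def)
    ultimately show ?case using union(3) by (simp add: sums_unique2)
  qed simp
qed

text \<open>
  With \<open>e\<^sub>1\<close>, \<open>e\<^sub>2\<close> the unit vectors from the points \<open>(0, 0)\<close> and \<open>(l, 0)\<close> to \<open>(0, t)\<close>, the kernel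
  is a multiple of the inner product of \<open>e\<^sub>1 - e\<^sub>2\<close> with the unit vector from \<open>(y, 0)\<close> to \<open>(0, t)\<close>.
\<close>

definition segment_kernel :: "real \<Rightarrow> real \<Rightarrow> real \<Rightarrow> real" where
  "segment_kernel l t y = (t * (sqrt (l\<^sup>2 + t\<^sup>2) - t) - l * y) / sqrt (y\<^sup>2 + t\<^sup>2)"

lemma segment_kernel_measurable [measurable]: "segment_kernel l t \<in> borel_measurable borel"
  unfolding segment_kernel_def by measurable

text \<open>
  As \<open>t\<close> tends to 0, the terms of order \<open>t\<close> in the orthogonality relation bound the mass to the
  left of the segment in terms of the mass to the right.
\<close>

lemma left_mass_le:
  fixes l :: real
  assumes M: "real_distribution M" and N: "real_distribution N" and l: "l > 0"
    and eq: "\<And>t. t > 0 \<Longrightarrow>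
        (\<integral>y. segment_kernel l t y \<partial>M) + (\<integral>y. segment_kernel l t y \<partial>N) = 0"
    and gap: "measure M {0<..<l} = 0" "measure N {0<..<l} = 0"
    and balance: "measure M {..0} + measure N {..0} = 1"
  shows "measure M {..<0} + measure N {..<0}
      \<le> (\<integral>y. indicator {l<..} y * (1 - l / y) \<partial>M) + (\<integral>y. indicator {l<..} y * (1 - l / y) \<partial>N)"
proof -
  define D where "D t = sqrt (l\<^sup>2 + t\<^sup>2)" for t
  define \<kappa> where "\<kappa> t y = (t * (D t - t) - l * y) / sqrt (y\<^sup>2 + t\<^sup>2)" for t y
  \<comment> \<open>The leading term: off the gap \<open>\<kappa> t y\<close> tends to
    \<open>l * w y\<close> as \<open>t\<close> tends to 0, and \<open>D t - t\<close> tends to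
    \<open>l\<close>. Summed over both measures this term cancels by \<open>balance\<close>; \<phi>
    bounds what remains, divided by \<open>t\<close>, from below.\<close>
  define w where "w y = (if y \<le> 0 then 1 else - 1 :: real)" for y :: real
  define \<phi> where "\<phi> t y = indicator {..<0} y * ((1 - t / (D t + l)) * (1 - t / sqrt (y\<^sup>2 + t\<^sup>2)))
      - indicator {l<..} y * (1 - (D t - t) / sqrt (y\<^sup>2 + t\<^sup>2))" for t y :: real
  define \<psi> where "\<psi> y = indicator {..<0} y - indicator {l<..} y * (1 - l / y)" for y :: real
  have Dl: "l \<le> D t" for t unfolding D_def using l by (simp add: real_le_rsqrt)
  have Dt: "t < D t" for t unfolding D_def using l by (cases "t < 0") (auto intro: real_less_rsqrt less_le_trans)
  have DK: "D t - t \<le> l" if "t > 0" for t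
    unfolding D_def using l that sqrt_sum_squares_le_sum[of l t] by simp
  have Dsq: "(D t)\<^sup>2 = l\<^sup>2 + t\<^sup>2" for t by (simp add: D_def)
  have r: "sqrt (y\<^sup>2 + t\<^sup>2) > 0" "t \<le> sqrt (y\<^sup>2 + t\<^sup>2)" "\<bar>y\<bar> \<le> sqrt (y\<^sup>2 + t\<^sup>2)" if "t > 0" for y t
    using that by (auto simp: add_nonneg_pos intro: real_le_rsqrt)
  \<comment> \<open>Equality holds at both end points 0 and \<open>l\<close>, where \<phi> vanishes.
    To the left the inequality reduces to \<open>sqrt (y^2 + t^2) \<le> - y + t\<close>, to the
    right to \<open>y \<le> sqrt (y^2 + t^2)\<close> and \<open>l \<le> D t\<close>.\<close>
  have key: "t * \<phi> t y \<le> \<kappa> t y - (D t - t) * w y" if t: "t > 0" and y: "y \<notin> {0<..<l}" for t y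
  proof -
    let ?r = "sqrt (y\<^sup>2 + t\<^sup>2)"
    note r = r[OF t, of y]
    consider "y < 0" | "y = 0" | "y = l" | "y > l" using y l by force
    then show ?thesis
    proof cases
      case 1
      have "?r \<le> - y + t" using sqrt_sum_squares_le_sum[of "- y" t] 1 t by simp
      have q: "t * (1 - t / (D t + l)) = l - (D t - t)"
      proof -
        have "D t + l > 0" using Dl[of t] l by linarith
        moreover have "t * t = (D t - l) * (D t + l)" using Dsq[of t] by (simp add: power2_eq_square algebra_simps)
        ultimately show ?thesis by (simp add: field_simps)
      qed
      have "\<kappa> t y - (D t - t) * w y - t * \<phi> t y
          = (t * (D t - t) - l * y) / ?r - (D t - t) - (l - (D t - t)) * (1 - t / ?r)"
        using 1 l unfolding \<kappa>_def w_def \<phi>_def by (simp add: q[symmetric] mult.assoc)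
      also have "\<dots> = l * ((- y + t) / ?r - 1)"
      proof -
        have "(t * K - l * y) / \<rho> - K - (l - K) * (1 - t / \<rho>) = l * ((- y + t) / \<rho> - 1)" if "\<rho> > 0" for K \<rho> :: real
          using that by (simp add: field_simps)
        then show ?thesis using r(1) .
      qed
      also have "\<dots> \<ge> 0" using l r(1) \<open>?r \<le> - y + t\<close> by simp
      finally show ?thesis by simp
    next
      case 2
      then show ?thesis using t l by (simp add: \<kappa>_def w_def \<phi>_def)
    next
      case 3
      have "?r = D t" using 3 by (simp add: D_def)
      moreover have "D t > 0" using Dl[of t] l by linarith
      moreover have "t * (D t - t) - l * l = - (D t - t) * D t"
        using Dsq[of t] by (simp add: power2_eq_square algebra_simps)
      ultimately have "\<kappa> t y = - (D t - t)" using 3 by (simp add: \<kappa>_def)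
      then show ?thesis using 3 l by (simp add: w_def \<phi>_def)
    next
      case 4
      have "\<kappa> t y - (D t - t) * w y - t * \<phi> t y = D t - l * (y / ?r)"
      proof -
        have "(t * K - l * y) / \<rho> + K + t * (1 - K / \<rho>) = t + K - l * (y / \<rho>)" if "\<rho> > 0" for K \<rho> :: real
          using that by (simp add: field_simps)
        from this[OF r(1), of "D t - t"] show ?thesis using 4 l unfolding \<kappa>_def w_def \<phi>_def by (simp add: right_diff_distrib)
      qed
      moreover have "l * (y / ?r) \<le> l * 1" using l r 4 by (intro mult_left_mono) auto
      ultimately show ?thesis using Dl[of t] by linarith
    qed
  qed
  have bl: "\<bar>\<phi> t y\<bar> \<le> 1" if t: "t > 0" for t y
  proof -
    note r = r[OF t, of y]
    have s: "0 \<le> t / sqrt (y\<^sup>2 + t\<^sup>2)" "t / sqrt (y\<^sup>2 + t\<^sup>2) \<le> 1" using r t by auto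
    have d: "0 \<le> t / (D t + l)" "t / (D t + l) \<le> 1" using t Dt[of t] l by (auto simp: divide_le_eq)
    show ?thesis
    proof (cases "y < 0")
      case True
      have "\<bar>(1 - t / (D t + l)) * (1 - t / sqrt (y\<^sup>2 + t\<^sup>2))\<bar> \<le> 1"
        unfolding abs_mult by (intro mult_le_one) (use s d in auto)
      then show ?thesis using True l by (simp add: \<phi>_def)
    next
      case False
      show ?thesis
      proof (cases "y > l")
        case True
        have "D t - t \<le> sqrt (y\<^sup>2 + t\<^sup>2)" using DK[OF t] True r(3) by linarith
        then have "0 \<le> (D t - t) / sqrt (y\<^sup>2 + t\<^sup>2)" "(D t - t) / sqrt (y\<^sup>2 + t\<^sup>2) \<le> 1"
          using Dt[of t] r(1) by auto
        then show ?thesis using True False by (simp add: \<phi>_def)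
      qed (use False in \<open>simp add: \<phi>_def\<close>)
    qed
  qed
  have [measurable]: "\<phi> t \<in> borel_measurable borel" "\<kappa> t \<in> borel_measurable borel"
    "w \<in> borel_measurable borel" "\<psi> \<in> borel_measurable borel" for t
    unfolding \<phi>_def \<kappa>_def w_def \<psi>_def by measurable
  have \<kappa>b: "\<bar>\<kappa> t y\<bar> \<le> \<bar>D t - t\<bar> + l" if t: "t > 0" for t y
  proof -
    note r = r[OF t, of y]
    have "\<bar>t * (D t - t) - l * y\<bar> \<le> t * \<bar>D t - t\<bar> + l * \<bar>y\<bar>"
      using t l abs_triangle_ineq4[of "t * (D t - t)" "l * y"] by (simp add: abs_mult)
    also have "\<dots> \<le> sqrt (y\<^sup>2 + t\<^sup>2) * \<bar>D t - t\<bar> + l * sqrt (y\<^sup>2 + t\<^sup>2)"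
      using r l by (intro add_mono mult_right_mono mult_left_mono) auto
    finally show ?thesis using r(1) by (simp add: \<kappa>_def pos_divide_le_eq algebra_simps)
  qed
  have ineq: "t * integral\<^sup>L A (\<phi> t) \<le> integral\<^sup>L A (\<kappa> t) - (D t - t) * (2 * measure A {..0} - 1)"
    and conv: "(\<lambda>n. integral\<^sup>L A (\<phi> (1 / real (Suc n)))) \<longlonglongrightarrow>
        measure A {..<0} - (\<integral>y. indicator {l<..} y * (1 - l / y) \<partial>A)"
    if A: "real_distribution A" and gap: "measure A {0<..<l} = 0" and t: "t > 0" for A t
  proof -
    interpret A: real_distribution A by (rule A)
    have i\<phi>: "integrable A (\<phi> t)" by (rule A.integrable_const_bound[where B = 1]) (use bl[OF t] in auto)
    have i\<kappa>: "integrable A (\<kappa> t)" by (rule A.integrable_const_bound[where B = "\<bar>D t - t\<bar> + l"]) (use \<kappa>b[OF t] in auto)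
    have iw: "integrable A w" by (rule A.integrable_const_bound[where B = 1]) (auto simp: w_def)
    have "integral\<^sup>L A w = (\<integral>y. 2 * indicator {..0} y - 1 \<partial>A)"
      by (intro Bochner_Integration.integral_cong) (auto simp: w_def)
    also have "\<dots> = 2 * measure A {..0} - 1"
      by (subst Bochner_Integration.integral_diff) (use A.prob_space in \<open>auto simp: A.emeasure_eq_measure\<close>)
    finally have Iw: "integral\<^sup>L A w = 2 * measure A {..0} - 1" .
    have "AE y in A. y \<notin> {0<..<l}"
      using gap by (subst AE_iff_measurable[OF _ refl]) (auto simp: A.emeasure_eq_measure set_eq_iff greaterThanLessThan_def greaterThan_def lessThan_def Int_def)
    then have "AE y in A. t * \<phi> t y \<le> \<kappa> t y - (D t - t) * w y"
      by eventually_elim (rule key[OF t])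
    then have "(\<integral>y. t * \<phi> t y \<partial>A) \<le> (\<integral>y. \<kappa> t y - (D t - t) * w y \<partial>A)"
      using i\<phi> i\<kappa> iw by (intro integral_mono_AE) simp_all
    then show "t * integral\<^sup>L A (\<phi> t) \<le> integral\<^sup>L A (\<kappa> t) - (D t - t) * (2 * measure A {..0} - 1)"
      using i\<kappa> iw by (simp add: Iw)
    have r0: "(\<lambda>n. 1 / real (Suc n)) \<longlonglongrightarrow> 0" by (rule LIMSEQ_Suc[OF lim_inverse_n'])
    have "(\<lambda>n. integral\<^sup>L A (\<phi> (1 / real (Suc n)))) \<longlonglongrightarrow> integral\<^sup>L A \<psi>"
    proof (rule integral_dominated_convergence[where w = "\<lambda>_. 1"])
      have "(\<lambda>n. \<phi> (1 / real (Suc n)) y) \<longlonglongrightarrow> \<psi> y" for y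
      proof (cases "y = 0")
        case False
        have "(\<lambda>n. \<phi> (1 / real (Suc n)) y) \<longlonglongrightarrow> indicator {..<0} y * ((1 - 0 / (D 0 + l)) * (1 - 0 / sqrt (y\<^sup>2 + 0\<^sup>2)))
          - indicator {l<..} y * (1 - (D 0 - 0) / sqrt (y\<^sup>2 + 0\<^sup>2))"
          unfolding \<phi>_def D_def by (intro tendsto_intros r0) (use l False in auto)
        also have "indicator {..<0} y * ((1 - 0 / (D 0 + l)) * (1 - 0 / sqrt (y\<^sup>2 + 0\<^sup>2)))
          - indicator {l<..} y * (1 - (D 0 - 0) / sqrt (y\<^sup>2 + 0\<^sup>2)) = \<psi> y"
          using l by (auto simp: \<psi>_def D_def indicator_def)
        finally show ?thesis .
      qed (use l in \<open>simp add: \<phi>_def \<psi>_def\<close>)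
      then show "AE y in A. (\<lambda>n. \<phi> (1 / real (Suc n)) y) \<longlonglongrightarrow> \<psi> y" by simp
    qed (use bl in auto)
    also have "integral\<^sup>L A \<psi> = measure A {..<0} - (\<integral>y. indicator {l<..} y * (1 - l / y) \<partial>A)"
    proof -
      have "integrable A (\<lambda>y. indicator {l<..} y * (1 - l / y))"
        by (rule A.integrable_const_bound[where B = 1]) (use l in \<open>auto simp: indicator_def\<close>)
      then show ?thesis unfolding \<psi>_def
        by (subst Bochner_Integration.integral_diff) (auto simp: A.emeasure_eq_measure)
    qed
    finally show "(\<lambda>n. integral\<^sup>L A (\<phi> (1 / real (Suc n)))) \<longlonglongrightarrow>
        measure A {..<0} - (\<integral>y. indicator {l<..} y * (1 - l / y) \<partial>A)" .
  qed
  have neg: "integral\<^sup>L M (\<phi> t) + integral\<^sup>L N (\<phi> t) \<le> 0" if t: "t > 0" for t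
  proof -
    have "t * (integral\<^sup>L M (\<phi> t) + integral\<^sup>L N (\<phi> t)) \<le> (integral\<^sup>L M (\<kappa> t) + integral\<^sup>L N (\<kappa> t))
        - (D t - t) * (2 * (measure M {..0} + measure N {..0}) - 2)"
      using ineq[OF M gap(1) t] ineq[OF N gap(2) t] by (simp add: algebra_simps)
    also have "\<dots> = 0" using eq[OF t] balance unfolding \<kappa>_def D_def segment_kernel_def by simp
    finally show ?thesis using t by (simp add: mult_le_0_iff)
  qed
  have "(\<lambda>n. integral\<^sup>L M (\<phi> (1 / real (Suc n))) + integral\<^sup>L N (\<phi> (1 / real (Suc n)))) \<longlonglongrightarrow>
      (measure M {..<0} - (\<integral>y. indicator {l<..} y * (1 - l / y) \<partial>M))
    + (measure N {..<0} - (\<integral>y. indicator {l<..} y * (1 - l / y) \<partial>N))"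
    by (intro tendsto_add conv[OF M gap(1) zero_less_one] conv[OF N gap(2) zero_less_one])
  then have "(measure M {..<0} - (\<integral>y. indicator {l<..} y * (1 - l / y) \<partial>M))
    + (measure N {..<0} - (\<integral>y. indicator {l<..} y * (1 - l / y) \<partial>N)) \<le> 0"
    by (rule LIMSEQ_le_const2) (use neg in auto)
  then show ?thesis by simp
qed

section \<open>Measures concentrated on a line\<close>

text \<open>\<open>left_mass_le\<close> for the pair and for its reflection closes a cycle: left
  mass \<le> weighted right mass \<le> right mass \<le> weighted left mass \<le> left mass. The
  weight \<open>1 - l / y\<close> is below 1, so equality throughout forces the right mass to be 0,
  and then the left mass too.\<close>

lemma mass_outside_segment_zero:
  fixes l :: real
  assumes M: "real_distribution M" and N: "real_distribution N" and l: "l > 0"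
    and eq: "\<And>t. t > 0 \<Longrightarrow> (\<integral>y. segment_kernel l t y \<partial>M) + (\<integral>y. segment_kernel l t y \<partial>N) = 0"
    and eq': "\<And>t. t > 0 \<Longrightarrow> (\<integral>y. segment_kernel l t (l - y) \<partial>M) + (\<integral>y. segment_kernel l t (l - y) \<partial>N) = 0"
    and gap: "measure M {0<..<l} = 0" "measure N {0<..<l} = 0"
    and balance: "measure M {..0} + measure N {..0} = 1"
  shows "measure M {..<0} = 0 \<and> measure M {l<..} = 0"
proof -
  interpret M: real_distribution M by (rule M)
  interpret N: real_distribution N by (rule N)
  define G where "G A = (\<integral>y. indicator {l<..} y * (1 - l / y) \<partial>A)" for A :: "real measure"
  define refl where "refl A = distr A borel (\<lambda>y. l - y)" for A :: "real measure"
  have left: "measure M {..<0} + measure N {..<0} \<le> G M + G N"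
    unfolding G_def by (rule left_mass_le[OF M N l eq gap balance])
  have R: "real_distribution (refl A)" "\<And>S. S \<in> sets borel \<Longrightarrow> measure (refl A) S = measure A ((\<lambda>y. l - y) -` S)"
    "\<And>f :: real \<Rightarrow> real. f \<in> borel_measurable borel \<Longrightarrow> integral\<^sup>L (refl A) f = (\<integral>y. f (l - y) \<partial>A)"
    if A: "real_distribution A" for A
  proof -
    interpret A: real_distribution A by (rule A)
    show "real_distribution (refl A)" unfolding refl_def by (rule A.real_distribution_distr) simp
    show "measure (refl A) S = measure A ((\<lambda>y. l - y) -` S)" if "S \<in> sets borel" for S
      unfolding refl_def using that by (subst measure_distr) auto
    show "integral\<^sup>L (refl A) f = (\<integral>y. f (l - y) \<partial>A)" if "f \<in> borel_measurable borel" for f :: "real \<Rightarrow> real"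
      unfolding refl_def using that by (subst integral_distr) auto
  qed
  have vim: "(\<lambda>y. l - y) -` {..0} = {l..}" "(\<lambda>y. l - y) -` {..<0} = {l<..}" "(\<lambda>y. l - y) -` {0<..<l} = {0<..<l}"
    by auto
  \<comment> \<open>Supplies the balance of the reflected pair: \<open>{..0}\<close> pulls back to
    \<open>{l..}\<close>, which up to the null gap is the complement of
    \<open>{..0}\<close>.\<close>
  have pos: "measure A {l..} = 1 - measure A {..0}" if A: "real_distribution A" and gap: "measure A {0<..<l} = 0" for A
  proof -
    interpret A: real_distribution A by (rule A)
    have "measure A {0<..} = measure A {0<..<l} + measure A {l..}"
      using l by (subst A.finite_measure_Union[symmetric]) (auto intro!: arg_cong[where f = "measure A"])
    moreover have "measure A {0<..} = 1 - measure A {..0}"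
    proof -
      have "UNIV - {..0} = {0::real<..}" by auto
      then show ?thesis using A.prob_compl[of "{..0}"] by simp
    qed
    ultimately show ?thesis using gap by simp
  qed
  have right: "measure M {l<..} + measure N {l<..}
      \<le> (\<integral>y. indicator {l<..} (l - y) * (1 - l / (l - y)) \<partial>M) + (\<integral>y. indicator {l<..} (l - y) * (1 - l / (l - y)) \<partial>N)"
  proof -
    have "measure (refl M) {..<0} + measure (refl N) {..<0} \<le> G (refl M) + G (refl N)"
      unfolding G_def
    proof (rule left_mass_le[OF R(1)[OF M] R(1)[OF N] l])
      show "(\<integral>y. segment_kernel l t y \<partial>refl M) + (\<integral>y. segment_kernel l t y \<partial>refl N) = 0" if "t > 0" for t
        using eq'[OF that] by (subst (1 2) R(3)) (auto simp: M N)
      show "measure (refl M) {0<..<l} = 0" "measure (refl N) {0<..<l} = 0"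
        using gap R(2)[OF M] R(2)[OF N] by (simp_all add: vim)
      show "measure (refl M) {..0} + measure (refl N) {..0} = 1"
        using balance R(2)[OF M] R(2)[OF N] pos[OF M gap(1)] pos[OF N gap(2)] by (simp add: vim)
    qed
    then show ?thesis unfolding G_def using R(2)[OF M] R(2)[OF N] by (simp add: vim R(3)[OF M] R(3)[OF N])
  qed
  have Gle: "G A \<le> measure A {l<..}" "(\<integral>y. indicator {l<..} (l - y) * (1 - l / (l - y)) \<partial>A) \<le> measure A {..<0}"
    "G A = measure A {l<..} \<Longrightarrow> measure A {l<..} = 0" if A: "real_distribution A" for A
  proof -
    interpret A: real_distribution A by (rule A)
    have i1: "integrable A (\<lambda>y. indicator {l<..} y * (1 - l / y))"
      by (rule A.integrable_const_bound[where B = 1]) (use l in \<open>auto simp: indicator_def\<close>)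
    have i2: "integrable A (\<lambda>y. indicator {l<..} (l - y) * (1 - l / (l - y)))"
      by (rule A.integrable_const_bound[where B = 1]) (use l in \<open>auto simp: indicator_def\<close>)
    have i3: "integrable A (indicator S :: real \<Rightarrow> real)" if "S \<in> sets borel" for S
      using that by (intro integrable_real_indicator) (auto simp: A.emeasure_eq_measure)
    have "G A \<le> (\<integral>y. indicator {l<..} y \<partial>A)" unfolding G_def
      using l by (intro integral_mono i1 i3) (auto simp: indicator_def)
    then show "G A \<le> measure A {l<..}" by simp
    have "(\<integral>y. indicator {l<..} (l - y) * (1 - l / (l - y)) \<partial>A) \<le> (\<integral>y. indicator {..<0} y \<partial>A)"
      using l by (intro integral_mono i2 i3) (auto simp: indicator_def)
    then show "(\<integral>y. indicator {l<..} (l - y) * (1 - l / (l - y)) \<partial>A) \<le> measure A {..<0}" by simp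
    show "measure A {l<..} = 0" if "G A = measure A {l<..}"
    proof -
      define f where "f y = indicator {l<..} y * (l / y)" for y
      have fd: "f y = indicator {l<..} y - indicator {l<..} y * (1 - l / y)" for y
        by (simp add: f_def algebra_simps)
      have "integral\<^sup>L A f = 0" unfolding fd
        using that i1 i3[of "{l<..}"] by (simp add: G_def)
      moreover have "integrable A f" unfolding fd using i1 i3[of "{l<..}"] by simp
      moreover have "0 \<le> f y" for y using l by (auto simp: f_def indicator_def)
      ultimately have "AE y in A. f y = 0" using integral_nonneg_eq_0_iff_AE[of A f] by simp
      then have "AE y in A. y \<notin> {l<..}" by eventually_elim (use l in \<open>auto simp: f_def\<close>)
      then have "{l<..} \<in> null_sets A" by (subst AE_iff_null_sets) auto
      then show ?thesis by (simp add: null_sets_def A.emeasure_eq_measure)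
    qed
  qed
  have "measure M {l<..} = 0" "measure N {l<..} = 0"
    using left right Gle[OF M] Gle[OF N] by linarith+
  moreover have "measure M {..<0} = 0"
    using left right Gle[OF M] Gle[OF N] measure_nonneg[of M "{..<0}"] measure_nonneg[of N "{..<0}"] calculation by linarith
  ultimately show ?thesis by simp
qed

locale on_line =
  fixes P :: "'a::{real_inner, banach, polish_space} measure" and a e :: 'a
  assumes P: "borel_prob P" and e: "norm e = 1"
    and line: "AE z in P. z = a + inner (z - a) e *\<^sub>R e"
begin

text \<open>Neither \<open>coord\<close> nor \<open>pt\<close> mentions \<open>P\<close>, so two
  measures on the same line share these maps.\<close>

definition coord :: "'a \<Rightarrow> real" where "coord z = inner (z - a) e"
definition pt :: "real \<Rightarrow> 'a" where "pt t = a + t *\<^sub>R e"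
definition R :: "real measure" where "R = distr P borel coord"

lemma coord_measurable [measurable]: "coord \<in> borel_measurable borel" and pt_measurable [measurable]: "pt \<in> borel_measurable borel"
  unfolding coord_def pt_def by measurable

lemma coord_P [measurable]: "coord \<in> borel_measurable P"
  unfolding measurable_cong_sets[OF borel_prob_sets[OF P] refl] by (rule coord_measurable)

lemma ee: "inner e e = 1" using e by (simp flip: power2_norm_eq_inner)

lemma coord_pt [simp]: "coord (pt t) = t" by (simp add: coord_def pt_def ee)

lemma pt_inject [simp]: "pt s = pt t \<longleftrightarrow> s = t" by (metis coord_pt)

lemma line': "AE z in P. z = pt (coord z)" using line by (simp add: pt_def coord_def)

lemma R: "real_distribution R"
  unfolding R_def using borel_prob_prob_space[OF P] by (intro prob_space.real_distribution_distr) auto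

lemma measure_R: "B \<in> sets borel \<Longrightarrow> measure R B = measure P (coord -` B)"
  unfolding R_def by (subst measure_distr) (auto simp: borel_prob_space[OF P])

lemma integral_R: "f \<in> borel_measurable borel \<Longrightarrow> integral\<^sup>L R f = (\<integral>z. f (coord z) \<partial>P)"
  for f :: "real \<Rightarrow> real"
  unfolding R_def by (subst integral_distr) auto

lemma vimage_pt: "B \<in> sets borel \<Longrightarrow> pt -` B \<in> sets borel"
  using measurable_sets[OF pt_measurable, of B] by simp

lemma measure_P: assumes B: "B \<in> sets borel" shows "measure P B = measure R (pt -` B)"
proof -
  interpret prob_space P using P by (rule borel_prob_prob_space)
  have s: "coord -` (pt -` B) \<in> sets borel"
    using measurable_sets[OF coord_measurable vimage_pt[OF B]] by simp
  have "measure P B = measure P (coord -` (pt -` B))"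
    using line' by (intro finite_measure_eq_AE) (auto simp: borel_prob_sets[OF P] s B elim!: eventually_mono)
  then show ?thesis by (simp add: measure_R vimage_pt B)
qed

lemma measure_pt: "measure P {pt t} = measure R {t}"
proof -
  have "pt -` {pt t} = {t}" by auto
  then show ?thesis by (simp add: measure_P)
qed

lemma sgn_e: "sgn e = e" using e by (simp add: sgn_div_norm)

lemma integrable_R_indicator: "B \<in> sets borel \<Longrightarrow> integrable P (\<lambda>z. indicator B (coord z) :: real)"
  using P by (intro borel_prob_integrable_bounded[OF P, of _ 1]) auto

lemma integral_R_indicator: "B \<in> sets borel \<Longrightarrow> (\<integral>z. indicator B (coord z) \<partial>P) = measure R B"
proof -
  assume B: "B \<in> sets borel"
  interpret real_distribution R by (rule R)
  show ?thesis using integral_R[of "indicator B"] B by simp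
qed

text \<open>Adding or subtracting the atom turns the symmetric value
  \<open>measure R {..<t} - measure R {t<..}\<close> into the right and left derivatives of the
  objective along \<open>e\<close>, which see the distribution function and its left limit.\<close>

lemma spatial_df_pt:
  "spatial_df P (pt t) + measure P {pt t} *\<^sub>R e = (2 * cdf R t - 1) *\<^sub>R e"
  "spatial_df P (pt t) - measure P {pt t} *\<^sub>R e = (2 * measure R {..<t} - 1) *\<^sub>R e"
proof -
  interpret prob_space P using P by (rule borel_prob_prob_space)
  interpret R: real_distribution R by (rule R)
  have sg: "sgn (pt t - z) = (indicator {..<t} (coord z) - indicator {t<..} (coord z)) *\<^sub>R e"
    if "z = pt (coord z)" for z
  proof -
    have "pt t - z = (t - coord z) *\<^sub>R e" by (subst that) (simp add: pt_def algebra_simps)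
    then have "sgn (pt t - z) = sgn (t - coord z) *\<^sub>R e" by (simp add: sgn_scaleR sgn_e)
    then show ?thesis by (simp add: sgn_if indicator_def)
  qed
  have "spatial_df P (pt t) = (\<integral>z. (indicator {..<t} (coord z) - indicator {t<..} (coord z)) *\<^sub>R e \<partial>P)"
    unfolding spatial_df_eq[OF P]
  proof (rule integral_cong_AE)
    show "(\<lambda>z. sgn (pt t - z)) \<in> borel_measurable P"
      by (rule borel_measurable_integrable[OF sgn_minus_integrable[OF P]])
    show "AE z in P. sgn (pt t - z) = (indicator {..<t} (coord z) - indicator {t<..} (coord z)) *\<^sub>R e"
      using line' by eventually_elim (rule sg)
  qed measurable
  also have "\<dots> = (measure R {..<t} - measure R {t<..}) *\<^sub>R e"
    using integrable_R_indicator[of "{..<t}"] integrable_R_indicator[of "{t<..}"]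
    by (simp add: integral_R_indicator)
  finally have F: "spatial_df P (pt t) = (measure R {..<t} - measure R {t<..}) *\<^sub>R e" .
  have c: "cdf R t = measure R {..<t} + measure R {t}"
    unfolding cdf_def by (subst R.finite_measure_Union[symmetric]) (auto intro!: arg_cong[where f = "measure R"])
  have g: "measure R {t<..} = 1 - cdf R t"
  proof -
    have "UNIV - {..t} = {t<..}" by auto
    then show ?thesis using R.prob_compl[of "{..t}"] by (simp add: cdf_def)
  qed
  show "spatial_df P (pt t) + measure P {pt t} *\<^sub>R e = (2 * cdf R t - 1) *\<^sub>R e"
    unfolding F measure_pt g using c by (simp flip: scaleR_add_left)
  show "spatial_df P (pt t) - measure P {pt t} *\<^sub>R e = (2 * measure R {..<t} - 1) *\<^sub>R e"
    unfolding F measure_pt g using c by (simp flip: scaleR_diff_left)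
qed

text \<open>The two one-sided subgradients along \<open>e\<close> have strictly opposite signs, so
  the objective increases strictly in both directions.\<close>

lemma unique_median_pt:
  assumes all: "\<And>x. x = pt (coord x)" and up: "cdf R t > 1/2" and down: "measure R {..<t} < 1/2"
  shows "spatial_median P m \<longleftrightarrow> m = pt t"
proof -
  have gt: "spatial_objective P (pt t) < spatial_objective P x" if "x \<noteq> pt t" for x
  proof -
    define d where "d = coord x - t"
    have xd: "x - pt t = d *\<^sub>R e" by (subst all[of x]) (simp add: d_def pt_def algebra_simps)
    have "d \<noteq> 0" using xd that by auto
    have "subgrad (spatial_objective P) (pt t) ((2 * cdf R t - 1) *\<^sub>R e)"
      using spatial_objective_subgrad[OF P, of e "pt t"] e by (simp add: spatial_df_pt(1))
    moreover have "subgrad (spatial_objective P) (pt t) ((2 * measure R {..<t} - 1) *\<^sub>R e)"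
      using spatial_objective_subgrad[OF P, of "- e" "pt t"] e spatial_df_pt(2)[of t] by simp
    ultimately have "spatial_objective P (pt t) + (2 * cdf R t - 1) * d \<le> spatial_objective P x"
      "spatial_objective P (pt t) + (2 * measure R {..<t} - 1) * d \<le> spatial_objective P x"
      by (auto dest!: subgradD[where y = x] simp: xd ee mult.commute)
    moreover have "(2 * cdf R t - 1) * d > 0 \<or> (2 * measure R {..<t} - 1) * d > 0"
      using up down \<open>d \<noteq> 0\<close> by (cases "d > 0") (auto intro: mult_neg_neg)
    ultimately show ?thesis by linarith
  qed
  show ?thesis unfolding spatial_median_def using gt by (metis less_imp_le not_le)
qed

end

section \<open>Two measures on a common line\<close>

locale two_on_line = P: on_line P a e + Q: on_line Q a e
  for P Q :: "'a::{real_inner, banach, polish_space} measure" and a e +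
  assumes dir: "\<And>x v. norm v = 1 \<Longrightarrow>
      norm (spatial_df P x + measure P {x} *\<^sub>R v) = norm (spatial_df Q x + measure Q {x} *\<^sub>R v)"
begin

lemma folded_eq: "\<bar>2 * cdf P.R t - 1\<bar> = \<bar>2 * cdf Q.R t - 1\<bar>"
  using dir[OF P.e, of "P.pt t"] P.e unfolding P.spatial_df_pt Q.spatial_df_pt by simp

lemma cdf_neq_cases:
  assumes "P \<noteq> Q"
  obtains x0 where "cdf P.R x0 > 1/2" "cdf Q.R x0 < 1/2" | x0 where "cdf Q.R x0 > 1/2" "cdf P.R x0 < 1/2"
proof -
  have "\<exists>t. cdf P.R t \<noteq> cdf Q.R t"
  proof (rule ccontr)
    assume "\<not> ?thesis"
    then have R: "P.R = Q.R" by (intro cdf_unique P.R Q.R) auto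
    interpret PP: prob_space P using P.P by (rule borel_prob_prob_space)
    interpret QQ: prob_space Q using Q.P by (rule borel_prob_prob_space)
    have "P = Q"
    proof (rule measure_eqI)
      show "sets P = sets Q" by (simp add: borel_prob_sets P.P Q.P)
      fix A assume "A \<in> sets P"
      then have "A \<in> sets borel" by (simp add: borel_prob_sets P.P)
      then show "emeasure P A = emeasure Q A"
        by (simp add: PP.emeasure_eq_measure QQ.emeasure_eq_measure P.measure_P Q.measure_P R)
    qed
    then show False using assms by simp
  qed
  then obtain t where "cdf P.R t \<noteq> cdf Q.R t" by blast
  then have h: "2 * cdf P.R t - 1 = - (2 * cdf Q.R t - 1)" "cdf P.R t \<noteq> cdf Q.R t"
    using folded_eq[of t] by (auto simp: abs_eq_iff)
  show ?thesis
  proof (cases "cdf P.R t > 1/2")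
    case True
    with h show ?thesis by (intro that(1)[of t]) linarith+
  next
    case False
    with h show ?thesis by (intro that(2)[of t]) linarith+
  qed
qed

lemma swap: "two_on_line Q P a e"
  using P.on_line_axioms Q.on_line_axioms dir by (simp add: two_on_line_def two_on_line_axioms_def)

end

text \<open>The distribution function of \<open>P\<close> passes 1/2 at \<open>m1\<close>, that of
  \<open>Q\<close> only at \<open>m2\<close>. The opposite order is the same locale with
  \<open>P\<close> and \<open>Q\<close> exchanged.\<close>

locale two_on_line_ordered = two_on_line P Q a e
  for P Q :: "'a::{real_inner, banach, polish_space} measure" and a e +
  fixes m1 m2 \<alpha> :: real
  assumes m12: "m1 < m2" and \<alpha>: "0 < \<alpha>"
    and left: "\<And>t. t < m1 \<Longrightarrow> cdf P.R t = cdf Q.R t \<and> cdf P.R t \<le> (1 - \<alpha>) / 2"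
    and mid: "\<And>t. m1 \<le> t \<Longrightarrow> t < m2 \<Longrightarrow> cdf P.R t = (1 + \<alpha>) / 2 \<and> cdf Q.R t = (1 - \<alpha>) / 2"
    and right: "\<And>t. m2 \<le> t \<Longrightarrow> cdf P.R t = cdf Q.R t \<and> (1 + \<alpha>) / 2 \<le> cdf P.R t"
begin

sublocale PR: real_distribution P.R by (rule P.R)
sublocale QR: real_distribution Q.R by (rule Q.R)

lemma measure_R_diff:
  "B \<in> sets borel \<Longrightarrow> measure P.R B - measure Q.R B = \<alpha> * (indicator B m1 - indicator B m2)"
proof (rule real_measure_diff_eqI[OF P.R Q.R])
  fix t
  show "cdf P.R t - cdf Q.R t = \<alpha> * (indicator {..t} m1 - indicator {..t} m2)"
    using left[of t] mid[of t] right[of t] m12 by (cases "t < m1"; cases "t < m2") (auto simp: indicator_def field_simps)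
qed

lemma measure_diff:
  assumes "B \<in> sets borel"
  shows "measure P B - measure Q B = \<alpha> * (indicator B (P.pt m1) - indicator B (P.pt m2))"
proof -
  have "indicator (P.pt -` B) m = (indicator B (P.pt m) :: real)" for m by (simp add: indicator_def)
  then show ?thesis
    using measure_R_diff[OF P.vimage_pt[OF assms]] by (simp add: P.measure_P Q.measure_P assms)
qed

text \<open>Both distribution functions are constant from \<open>m1\<close> up to but excluding
  \<open>m2\<close>. Half-open intervals ending before \<open>m2\<close> are therefore null, and
  countably many exhaust the open interval.\<close>

lemma gap: "measure P.R {m1<..<m2} = 0" "measure Q.R {m1<..<m2} = 0"
proof -
  have lim: "(\<lambda>n. m2 - (m2 - m1) / real (Suc n)) \<longlonglongrightarrow> m2 - (m2 - m1) * 0"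
    unfolding divide_inverse by (intro tendsto_intros LIMSEQ_inverse_real_of_nat)
  have U: "{m1<..<m2} = (\<Union>n. {m1<..m2 - (m2 - m1) / real (Suc n)})"
  proof (intro set_eqI iffI)
    fix x assume x: "x \<in> {m1<..<m2}"
    then have "\<forall>\<^sub>F n in sequentially. x < m2 - (m2 - m1) / real (Suc n)"
      by (intro order_tendstoD(1)[OF lim]) simp
    then obtain n where "x < m2 - (m2 - m1) / real (Suc n)" unfolding eventually_sequentially by blast
    then show "x \<in> (\<Union>n. {m1<..m2 - (m2 - m1) / real (Suc n)})" using x by (auto intro: less_imp_le)
  next
    fix x assume "x \<in> (\<Union>n. {m1<..m2 - (m2 - m1) / real (Suc n)})"
    then obtain n where x: "m1 < x" "x \<le> m2 - (m2 - m1) / real (Suc n)" by auto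
    have "(m2 - m1) / real (Suc n) > 0" using m12 by simp
    then show "x \<in> {m1<..<m2}" using x by (simp del: of_nat_Suc)
  qed
  have z: "measure P.R {m1<..m2 - (m2 - m1) / real (Suc n)} = 0 \<and> measure Q.R {m1<..m2 - (m2 - m1) / real (Suc n)} = 0" for n
  proof (cases "m1 < m2 - (m2 - m1) / real (Suc n)")
    case True
    have "m2 - (m2 - m1) / real (Suc n) < m2" using m12 by simp
    from mid[OF less_imp_le[OF True] this] show ?thesis
      using PR.cdf_diff_eq[OF True] QR.cdf_diff_eq[OF True] mid[OF order_refl m12] by (intro conjI) linarith+
  qed simp
  have "{m1<..<m2} \<in> null_sets P.R" "{m1<..<m2} \<in> null_sets Q.R"
    unfolding U by (rule null_sets_UN, simp only: null_sets_def, simp add: PR.emeasure_eq_measure QR.emeasure_eq_measure z del: of_nat_Suc)+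
  then show "measure P.R {m1<..<m2} = 0" "measure Q.R {m1<..<m2} = 0"
    by (auto simp: null_sets_def PR.emeasure_eq_measure QR.emeasure_eq_measure)
qed

lemma left_limit: "measure P.R {..<m1} \<le> (1 - \<alpha>) / 2" "measure P.R {..<m1} = measure Q.R {..<m1}"
  "measure Q.R {..<m2} = (1 - \<alpha>) / 2"
proof -
  have b: "m1 - 1 < m1" by simp
  have ev: "\<forall>\<^sub>F t in at_left m1. cdf P.R t \<le> (1 - \<alpha>) / 2"
    unfolding eventually_at_left[OF b] 
    by (intro exI[of _ "m1 - 1"] conjI allI impI, simp, use left in blast)
  show "measure P.R {..<m1} \<le> (1 - \<alpha>) / 2"
    by (rule tendsto_upperbound[OF PR.cdf_at_left ev]) simp
  show "measure P.R {..<m1} = measure Q.R {..<m1}" using measure_R_diff[of "{..<m1}"] m12 by simp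
  have "\<forall>\<^sub>F t in at_left m2. cdf Q.R t = (1 - \<alpha>) / 2"
    unfolding eventually_at_left[OF m12] using mid m12 by (intro exI[of _ m1]) auto
  then have "(cdf Q.R \<longlongrightarrow> (1 - \<alpha>) / 2) (at_left m2)" by (rule tendsto_eventually)
  then show "measure Q.R {..<m2} = (1 - \<alpha>) / 2"
    by (rule tendsto_unique[rotated, OF QR.cdf_at_left]) simp
qed

text \<open>Each distribution function jumps by at least \<alpha> there, from at most
  \<open>(1 - \<alpha>) / 2\<close> to at least \<open>(1 + \<alpha>) / 2\<close>.\<close>

lemma atoms: "measure P {P.pt m1} > 0" "measure Q {P.pt m2} > 0"
proof -
  have c: "cdf M t = measure M {..<t} + measure M {t}" if "real_distribution M" for M t
  proof -
    interpret real_distribution M by fact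
    show ?thesis
      unfolding cdf_def by (subst finite_measure_Union[symmetric]) (auto intro!: arg_cong[where f = "measure M"])
  qed
  show "measure P {P.pt m1} > 0"
    unfolding P.measure_pt using c[OF P.R, of m1] mid[of m1] m12 left_limit(1) \<alpha> by simp
  have "\<alpha> \<le> measure Q.R {m2}"
    using c[OF Q.R, of m2] right[OF order_refl, THEN conjunct1]
      right[OF order_refl, THEN conjunct2] left_limit(3) by argo
  then show "measure Q {P.pt m2} > 0" unfolding Q.measure_pt using \<alpha> by (rule less_le_trans[rotated])
qed

lemma segment: "measure P (open_segment (P.pt m1) (P.pt m2)) = 0" "measure Q (open_segment (P.pt m1) (P.pt m2)) = 0"
proof -
  let ?S = "open_segment (P.pt m1) (P.pt m2)"
  have "?S = closed_segment (P.pt m1) (P.pt m2) - {P.pt m1, P.pt m2}" by (simp add: open_segment_def)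
  then have S: "?S \<in> sets borel" by (auto intro!: borel_closed sets.Diff)
  have "P.pt -` ?S \<subseteq> {m1<..<m2}"
  proof
    fix t assume "t \<in> P.pt -` ?S"
    then obtain u where u: "0 < u" "u < 1" "P.pt t = (1 - u) *\<^sub>R P.pt m1 + u *\<^sub>R P.pt m2"
      by (auto simp: in_segment)
    have "(1 - u) *\<^sub>R P.pt m1 + u *\<^sub>R P.pt m2 = P.pt ((1 - u) * m1 + u * m2)"
      by (simp add: P.pt_def algebra_simps)
    then have "t = (1 - u) * m1 + u * m2" using u(3) by simp
    then have t: "t - m1 = u * (m2 - m1)" "m2 - t = (1 - u) * (m2 - m1)" by (simp_all add: algebra_simps)
    have "t - m1 > 0" "m2 - t > 0" unfolding t using u m12 by simp_all
    then show "t \<in> {m1<..<m2}" by simp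
  qed
  then show "measure P ?S = 0" "measure Q ?S = 0"
    unfolding P.measure_P[OF S] Q.measure_P[OF S]
    using PR.finite_measure_mono[of _ "{m1<..<m2}"] QR.finite_measure_mono[of _ "{m1<..<m2}"] gap
    by (auto intro!: antisym)
qed

text \<open>Restricted to the complement of the two points the measures coincide, so only the atoms
  contribute, and their masses differ by \<alpha> in opposite directions.\<close>

lemma integral_diff:
  fixes g :: "'a \<Rightarrow> 'b::{banach, second_countable_topology}"
  assumes g: "g \<in> borel_measurable borel" and bd: "\<And>z. norm (g z) \<le> C"
  shows "integral\<^sup>L P g - integral\<^sup>L Q g = \<alpha> *\<^sub>R (g (P.pt m1) - g (P.pt m2))"
proof -
  let ?p = "P.pt m1" and ?q = "P.pt m2"
  let ?S = "UNIV - {?p, ?q}"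
  have pq: "?p \<noteq> ?q" using m12 by simp
  interpret PP: prob_space P using P.P by (rule borel_prob_prob_space)
  interpret QQ: prob_space Q using Q.P by (rule borel_prob_prob_space)
  have split: "integral\<^sup>L A g = measure A {?p} *\<^sub>R g ?p + measure A {?q} *\<^sub>R g ?q
      + integral\<^sup>L (density A (\<lambda>z. ennreal (indicator ?S z))) g" if A: "borel_prob A" for A
  proof -
    interpret prob_space A using A by (rule borel_prob_prob_space)
    have [measurable_cong]: "sets A = sets borel" using A by (rule borel_prob_sets)
    have [measurable]: "g \<in> borel_measurable A"
      unfolding measurable_cong_sets[OF borel_prob_sets[OF A] refl] by (rule g)
    have i: "integrable A (\<lambda>z. indicator B z *\<^sub>R g z)" if "B \<in> sets borel" for B
      using that by (intro integrable_mult_indicator borel_prob_integrable_bounded[OF A g bd]) (simp add: borel_prob_sets[OF A])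
    have at: "(\<integral>z. indicator {x} z *\<^sub>R g z \<partial>A) = measure A {x} *\<^sub>R g x" for x
    proof -
      have "(\<lambda>z. indicator {x} z *\<^sub>R g z) = (\<lambda>z. indicator {x} z *\<^sub>R g x)"
        by (auto simp: indicator_def)
      moreover have "integrable A (indicator {x} :: 'a \<Rightarrow> real)"
        by (rule integrable_real_indicator) (auto simp: emeasure_eq_measure)
      ultimately show ?thesis by (simp add: borel_prob_space[OF A])
    qed
    have "integral\<^sup>L A g = (\<integral>z. indicator {?p} z *\<^sub>R g z + indicator {?q} z *\<^sub>R g z + indicator ?S z *\<^sub>R g z \<partial>A)"
      by (intro Bochner_Integration.integral_cong) (use pq in \<open>auto simp: indicator_def\<close>)
    also have "\<dots> = measure A {?p} *\<^sub>R g ?p + measure A {?q} *\<^sub>R g ?q + (\<integral>z. indicator ?S z *\<^sub>R g z \<partial>A)"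
      by (subst Bochner_Integration.integral_add Bochner_Integration.integral_add[OF i i], (intro i Bochner_Integration.integrable_add; simp)+)+
        (simp add: at)
    also have "(\<integral>z. indicator ?S z *\<^sub>R g z \<partial>A) = integral\<^sup>L (density A (\<lambda>z. ennreal (indicator ?S z))) g"
      by (rule integral_density[symmetric]) auto
    finally show ?thesis .
  qed
  have "density P (\<lambda>z. ennreal (indicator ?S z)) = density Q (\<lambda>z. ennreal (indicator ?S z))"
  proof (rule measure_eqI)
    fix B assume "B \<in> sets (density P (\<lambda>z. ennreal (indicator ?S z)))"
    then have B: "B \<in> sets borel" by (simp add: borel_prob_sets[OF P.P])
    have "?S \<inter> B \<in> sets borel" using B by auto
    from measure_diff[OF this] have "measure P (?S \<inter> B) = measure Q (?S \<inter> B)" by simp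
    then show "emeasure (density P (\<lambda>z. ennreal (indicator ?S z))) B = emeasure (density Q (\<lambda>z. ennreal (indicator ?S z))) B"
      using B by (simp add: ennreal_indicator emeasure_restricted borel_prob_sets[OF P.P] borel_prob_sets[OF Q.P]
          PP.emeasure_eq_measure QQ.emeasure_eq_measure)
  qed (simp add: borel_prob_sets[OF P.P] borel_prob_sets[OF Q.P])
  moreover have pm: "measure P {?p} = measure Q {?p} + \<alpha>" "measure P {?q} = measure Q {?q} - \<alpha>"
    using measure_diff[of "{?p}"] measure_diff[of "{?q}"] pq by (auto simp: algebra_simps)
  ultimately show ?thesis unfolding split[OF P.P] split[OF Q.P] pm by (simp add: algebra_simps)
qed

end

section \<open>Evaluation at points off the line\<close>

context on_line
begin

lemma inner_spatial_df:
  "inner w (spatial_df P x) = (\<integral>y. inner w (sgn (x - pt y)) \<partial>R)"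
proof -
  have i: "integrable P (\<lambda>z. sgn (x - z))" by (rule sgn_minus_integrable[OF P])
  have m: "(\<lambda>y. inner w (sgn (x - pt y))) \<in> borel_measurable borel" unfolding sgn_div_norm by measurable
  have "inner w (spatial_df P x) = (\<integral>z. inner w (sgn (x - z)) \<partial>P)"
    unfolding spatial_df_eq[OF P] using i by (simp add: integral_inner_right)
  also have "\<dots> = (\<integral>z. inner w (sgn (x - pt (coord z))) \<partial>P)"
  proof (rule integral_cong_AE)
    show "(\<lambda>z. inner w (sgn (x - z))) \<in> borel_measurable P"
      using i by (intro borel_measurable_inner borel_measurable_const borel_measurable_integrable)
    show "(\<lambda>z. inner w (sgn (x - pt (coord z)))) \<in> borel_measurable P"
      using measurable_compose[OF coord_P m] .
    show "AE z in P. inner w (sgn (x - z)) = inner w (sgn (x - pt (coord z)))"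
      using line' by eventually_elim simp
  qed
  also have "\<dots> = (\<integral>y. inner w (sgn (x - pt y)) \<partial>R)" using integral_R[OF m] by simp
  finally show ?thesis .
qed

lemma off_line_null:
  assumes "x \<noteq> pt (coord x)" shows "measure P {x} = 0"
proof -
  interpret prob_space P using P by (rule borel_prob_prob_space)
  have "AE z in P. z \<notin> {x}" using line' by eventually_elim (use assms in auto)
  then have "{x} \<in> null_sets P" by (subst AE_iff_null_sets) (auto simp: borel_prob_sets[OF P])
  then show ?thesis by (simp add: null_sets_def emeasure_eq_measure)
qed

text \<open>The line is the horizontal axis, \<open>h\<close> the vertical direction, and the
  observer sits at height \<open>t\<close> above the origin; \<open>s\<close> and \<open>y\<close>
  are signed positions on the axis. The factor in front clears the distance from the observer to
  position \<open>s\<close>.\<close>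

lemma sgn_difference_inner:
  assumes h: "norm h = 1" "inner h e = 0" and t: "t > 0"
  shows "sqrt (s\<^sup>2 + t\<^sup>2) * inner (sgn (t *\<^sub>R h) - sgn (t *\<^sub>R h - s *\<^sub>R e)) (sgn (t *\<^sub>R h - y *\<^sub>R e))
    = segment_kernel s t y"
proof -
  have hh: "inner h h = 1" using h by (simp flip: power2_norm_eq_inner)
  have he: "inner e h = 0" using h by (simp add: inner_commute)
  have n: "norm (t *\<^sub>R h - r *\<^sub>R e) = sqrt (r\<^sup>2 + t\<^sup>2)" for r
    unfolding norm_eq_sqrt_inner
    by (simp add: inner_diff_left inner_diff_right hh ee he h(2) power2_eq_square)
  have in1: "inner (t *\<^sub>R h - s *\<^sub>R e) (t *\<^sub>R h - y *\<^sub>R e) = t * t + s * y"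
    by (simp add: inner_diff_left inner_diff_right hh ee he h(2))
  have in2: "inner (t *\<^sub>R h) (t *\<^sub>R h - y *\<^sub>R e) = t * t"
    by (simp add: inner_diff_right hh h(2))
  have nt: "norm (t *\<^sub>R h) = t" using h t by simp
  have D: "sqrt (s\<^sup>2 + t\<^sup>2) > 0" "sqrt (y\<^sup>2 + t\<^sup>2) > 0" using t by (auto simp: add_nonneg_pos)
  have "inner (sgn (t *\<^sub>R h) - sgn (t *\<^sub>R h - s *\<^sub>R e)) (sgn (t *\<^sub>R h - y *\<^sub>R e))
      = (t - (t * t + s * y) / sqrt (s\<^sup>2 + t\<^sup>2)) / sqrt (y\<^sup>2 + t\<^sup>2)"
    unfolding sgn_div_norm n nt
    by (simp only: inner_diff_left inner_scaleR_left inner_scaleR_right in1 in2[unfolded inner_scaleR_left])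
      (use t in \<open>simp add: divide_inverse hh ee he algebra_simps\<close>)
  also have "sqrt (s\<^sup>2 + t\<^sup>2) * \<dots> = (t * (sqrt (s\<^sup>2 + t\<^sup>2) - t) - s * y) / sqrt (y\<^sup>2 + t\<^sup>2)"
  proof -
    have "\<delta> * ((t - (t * t + s * y) / \<delta>) / r) = (t * (\<delta> - t) - s * y) / r" if "\<delta> > 0" "r > 0" for \<delta> r :: real
      using that by (simp add: field_simps)
    then show ?thesis using D .
  qed
  finally show ?thesis unfolding segment_kernel_def .
qed

end

context two_on_line_ordered
begin

text \<open>Off the line there are no atoms, so the two distribution values have equal norm. Their
  difference, which is \<open>\<alpha> *\<^sub>R w\<close>, is therefore orthogonal to their
  sum.\<close>

lemma orthogonality:
  assumes x: "x \<noteq> P.pt (P.coord x)"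
  defines "w \<equiv> sgn (x - P.pt m1) - sgn (x - P.pt m2)"
  shows "(\<integral>y. inner w (sgn (x - P.pt y)) \<partial>P.R) + (\<integral>y. inner w (sgn (x - P.pt y)) \<partial>Q.R) = 0"
proof -
  have "norm (spatial_df P x) = norm (spatial_df Q x)"
    using dir[OF P.e, of x] P.off_line_null[OF x] Q.off_line_null[OF x] by simp
  moreover have "inner (spatial_df P x - spatial_df Q x) (spatial_df P x + spatial_df Q x)
      = (norm (spatial_df P x))\<^sup>2 - (norm (spatial_df Q x))\<^sup>2"
    unfolding power2_norm_eq_inner
    by (simp add: inner_diff_left inner_diff_right inner_add_left inner_add_right inner_commute)
  ultimately have "inner (spatial_df P x - spatial_df Q x) (spatial_df P x + spatial_df Q x) = 0" by simp
  moreover have "spatial_df P x - spatial_df Q x = \<alpha> *\<^sub>R w"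
    unfolding spatial_df_eq[OF P.P] spatial_df_eq[OF Q.P] w_def
    by (rule integral_diff[where C = 1]) (simp add: sgn_div_norm, simp add: norm_sgn)
  ultimately have "\<alpha> * (inner w (spatial_df P x) + inner w (spatial_df Q x)) = 0"
    by (simp add: inner_add_right distrib_left)
  then have "inner w (spatial_df P x) + inner w (spatial_df Q x) = 0" using \<alpha> by simp
  then show ?thesis unfolding P.inner_spatial_df Q.inner_spatial_df .
qed

text \<open>The observer stands at height \<open>t\<close> above the end point \<open>c\<close>, and
  \<open>s\<close> is the signed displacement to the other end point. The sign \<sigma> compensates
  for the order in which the end points enter the difference.\<close>

lemma kernel_equation:
  assumes h: "norm h = 1" "inner h e = 0" and t: "t > 0"
    and s: "s = m2 - m1 \<and> c = m1 \<or> s = m1 - m2 \<and> c = m2"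
  shows "(\<integral>y. segment_kernel s t (y - c) \<partial>P.R) + (\<integral>y. segment_kernel s t (y - c) \<partial>Q.R) = 0"
proof -
  define x where "x = P.pt c + t *\<^sub>R h"
  have he: "inner h e = 0" "h \<noteq> 0" using h by auto
  have "P.coord x = c"
    using he by (simp add: P.coord_def x_def P.pt_def inner_diff_left inner_add_left P.ee)
  then have x: "x \<noteq> P.pt (P.coord x)" using he t by (simp add: x_def)
  have xy: "x - P.pt y = t *\<^sub>R h - (y - c) *\<^sub>R e" for y by (simp add: x_def P.pt_def algebra_simps)
  let ?w = "sgn (x - P.pt m1) - sgn (x - P.pt m2)"
  define \<sigma> where "\<sigma> = (if c = m1 then 1 else - 1 :: real)"
  have \<sigma>: "\<sigma> * \<sigma> = 1" by (simp add: \<sigma>_def)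
  have w: "?w = \<sigma> *\<^sub>R (sgn (t *\<^sub>R h) - sgn (t *\<^sub>R h - s *\<^sub>R e))"
    using s m12 unfolding xy by (auto simp: \<sigma>_def)
  have k: "segment_kernel s t (y - c) = \<sigma> * sqrt (s\<^sup>2 + t\<^sup>2) * inner ?w (sgn (x - P.pt y))" for y
  proof -
    have "inner ?w (sgn (x - P.pt y)) = \<sigma> * inner (sgn (t *\<^sub>R h) - sgn (t *\<^sub>R h - s *\<^sub>R e)) (sgn (t *\<^sub>R h - (y - c) *\<^sub>R e))"
      unfolding w by (simp add: xy)
    then show ?thesis
      unfolding P.sgn_difference_inner[OF h t, of s "y - c", symmetric] using \<sigma> by (simp add: mult.assoc mult.left_commute)
  qed
  show ?thesis unfolding k using orthogonality[OF x]
    by (simp flip: distrib_left)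
qed

lemma two_point:
  assumes h: "norm h = 1" "inner h e = 0"
  shows "measure P.R {..<m1} = 0 \<and> measure P.R {m2<..} = 0"
proof -
  let ?l = "m2 - m1"
  define M where "M A = distr A borel (\<lambda>y. y - m1)" for A :: "real measure"
  have M: "real_distribution (M A)" "\<And>S. S \<in> sets borel \<Longrightarrow> measure (M A) S = measure A ((\<lambda>y. y - m1) -` S)"
    "\<And>f :: real \<Rightarrow> real. f \<in> borel_measurable borel \<Longrightarrow> integral\<^sup>L (M A) f = (\<integral>y. f (y - m1) \<partial>A)"
    if A: "real_distribution A" for A
  proof -
    interpret A: real_distribution A by (rule A)
    show "real_distribution (M A)" unfolding M_def by (rule A.real_distribution_distr) simp
    show "measure (M A) S = measure A ((\<lambda>y. y - m1) -` S)" if "S \<in> sets borel" for S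
      unfolding M_def using that by (subst measure_distr) auto
    show "integral\<^sup>L (M A) f = (\<integral>y. f (y - m1) \<partial>A)" if "f \<in> borel_measurable borel" for f :: "real \<Rightarrow> real"
      unfolding M_def using that by (subst integral_distr) auto
  qed
  have vim: "(\<lambda>y. y - m1) -` {..<0} = {..<m1}" "(\<lambda>y. y - m1) -` {?l<..} = {m2<..}"
    "(\<lambda>y. y - m1) -` {0<..<?l} = {m1<..<m2}" "(\<lambda>y. y - m1) -` {..0} = {..m1}" by auto
  have "measure (M P.R) {..<0} = 0 \<and> measure (M P.R) {?l<..} = 0"
  proof (rule mass_outside_segment_zero[OF M(1)[OF P.R] M(1)[OF Q.R]])
    show "?l > 0" using m12 by simp
    show "measure (M P.R) {0<..<?l} = 0" "measure (M Q.R) {0<..<?l} = 0"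
      using gap M(2)[OF P.R] M(2)[OF Q.R] by (simp_all add: vim)
    \<comment> \<open>The two middle values \<open>(1 + \<alpha>) / 2\<close> and
      \<open>(1 - \<alpha>) / 2\<close> add up to 1.\<close>
    show "measure (M P.R) {..0} + measure (M Q.R) {..0} = 1"
      using mid[OF order_refl m12] M(2)[OF P.R] M(2)[OF Q.R] by (simp add: vim cdf_def field_simps)
  next
    fix t :: real assume t: "t > 0"
    show "(\<integral>y. segment_kernel ?l t y \<partial>M P.R) + (\<integral>y. segment_kernel ?l t y \<partial>M Q.R) = 0"
      using kernel_equation[OF h t, of ?l m1] by (subst (1 2) M(3)) (auto simp: P.R Q.R)
    \<comment> \<open>From the other end point both displacements change sign, and the kernel
      contains only their squares and their product.\<close>
    have "segment_kernel (m1 - m2) t (y - m2) = segment_kernel ?l t (?l - (y - m1))" for y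
    proof -
      have "(m1 - m2)\<^sup>2 = ?l\<^sup>2" "(y - m2)\<^sup>2 = (?l - (y - m1))\<^sup>2" by (simp_all add: power2_commute)
      moreover have "(m1 - m2) * (y - m2) = ?l * (?l - (y - m1))" by (simp add: algebra_simps)
      ultimately show ?thesis by (simp only: segment_kernel_def)
    qed
    then have e: "(\<integral>y. segment_kernel ?l t (?l - (y - m1)) \<partial>P.R) + (\<integral>y. segment_kernel ?l t (?l - (y - m1)) \<partial>Q.R) = 0"
      using kernel_equation[OF h t, of "m1 - m2" m2] by (simp only: simp_thms)
    show "(\<integral>y. segment_kernel ?l t (?l - y) \<partial>M P.R) + (\<integral>y. segment_kernel ?l t (?l - y) \<partial>M Q.R) = 0"
      using e by (subst (1 2) M(3)) (auto simp: P.R Q.R)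
  qed
  then show ?thesis using M(2)[OF P.R] by (simp add: vim)
qed

text \<open>With no mass left of \<open>m1\<close>, the atom of \<open>P\<close> at
  \<open>m1\<close> is the middle value of its distribution function, which is \<beta>; \<alpha> > 0
  makes it exceed 1/2.\<close>

lemma two_point_measures:
  assumes h: "norm h = 1" "inner h e = 0" and B: "B \<in> sets borel"
  defines "\<beta> \<equiv> (1 + \<alpha>) / 2"
  shows "measure P B = \<beta> * indicator B (P.pt m1) + (1 - \<beta>) * indicator B (P.pt m2)"
    "measure Q B = (1 - \<beta>) * indicator B (P.pt m1) + \<beta> * indicator B (P.pt m2)" "\<beta> \<in> {1/2<..1}"
proof -
  note out = two_point[OF h]
  have null: "{..<m1} \<in> null_sets P.R" "{m2<..} \<in> null_sets P.R" "{m1<..<m2} \<in> null_sets P.R"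
    using out gap by (auto simp: null_sets_def PR.emeasure_eq_measure)
  have ae: "AE y in P.R. y = m1 \<or> y = m2"
    using null[THEN AE_not_in] by eventually_elim auto
  have b1: "measure P.R {m1} = \<beta>"
  proof -
    have "cdf P.R m1 = measure P.R {..<m1} + measure P.R {m1}"
      unfolding cdf_def by (subst PR.finite_measure_Union[symmetric]) (auto intro!: arg_cong[where f = "measure P.R"])
    then show ?thesis using mid[OF order_refl m12] out by (simp add: \<beta>_def)
  qed
  have full: "measure P.R {m1, m2} = 1"
    using ae by (subst PR.prob_eq_1) auto
  have "measure P.R {m1, m2} = measure P.R {m1} + measure P.R {m2}"
    using m12 by (subst PR.finite_measure_Union[symmetric]) (auto intro!: arg_cong[where f = "measure P.R"])
  then have b2: "measure P.R {m2} = 1 - \<beta>" using full b1 by simp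
  define C where "C = P.pt -` B"
  have C: "C \<in> sets borel" unfolding C_def by (rule P.vimage_pt[OF B])
  have "measure P.R C = measure P.R (C \<inter> {m1, m2})"
    using ae C by (intro PR.finite_measure_eq_AE) (auto elim!: eventually_mono)
  also have "\<dots> = \<beta> * indicator C m1 + (1 - \<beta>) * indicator C m2"
    by (cases "m1 \<in> C"; cases "m2 \<in> C") (simp_all add: full b1 b2)
  finally show 1: "measure P B = \<beta> * indicator B (P.pt m1) + (1 - \<beta>) * indicator B (P.pt m2)"
    unfolding P.measure_P[OF B] C_def by (simp add: indicator_def)
  have "measure Q B = measure P B - \<alpha> * (indicator B (P.pt m1) - indicator B (P.pt m2))"
    using measure_diff[OF B] by simp
  also have "\<dots> = (1 - \<beta>) * indicator B (P.pt m1) + \<beta> * indicator B (P.pt m2)"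
    unfolding 1 by (simp add: \<beta>_def field_simps)
  finally show "measure Q B = (1 - \<beta>) * indicator B (P.pt m1) + \<beta> * indicator B (P.pt m2)" .
  have "\<beta> \<le> 1" using PR.prob_le_1[of "{m1}"] b1 by simp
  then show "\<beta> \<in> {1/2<..1}" using \<alpha> by (simp add: \<beta>_def)
qed

lemma medians:
  assumes all: "\<And>x. x = P.pt (P.coord x)"
  shows "spatial_median P m \<longleftrightarrow> m = P.pt m1" "spatial_median Q m \<longleftrightarrow> m = P.pt m2"
proof -
  have h: "(1 - \<alpha>) / 2 < 1 / 2" "1 / 2 < (1 + \<alpha>) / 2" using \<alpha> by simp_all
  show "spatial_median P m \<longleftrightarrow> m = P.pt m1"
  proof (rule P.unique_median_pt[OF all])
    show "cdf P.R m1 > 1 / 2" using mid[OF order_refl m12] h by simp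
    show "measure P.R {..<m1} < 1 / 2" using left_limit(1) h(1) by (rule le_less_trans)
  qed
  show "spatial_median Q m \<longleftrightarrow> m = P.pt m2"
  proof (rule Q.unique_median_pt[OF all])
    show "cdf Q.R m2 > 1 / 2" using right[OF order_refl] h(2) by (auto intro: less_le_trans)
    show "measure Q.R {..<m2} < 1 / 2" using left_limit(3) h(1) by simp
  qed
qed

end

context two_on_line
begin

lemma ordered_cases:
  assumes "P \<noteq> Q"
  obtains m1 m2 \<alpha> where "two_on_line_ordered P Q a e m1 m2 \<alpha>" | m1 m2 \<alpha> where "two_on_line_ordered Q P a e m1 m2 \<alpha>"
proof (rule cdf_neq_cases[OF assms])
  fix x0 assume x0: "cdf P.R x0 > 1/2" "cdf Q.R x0 < 1/2"
  obtain m1 m2 \<alpha> where "m1 < m2" "0 < \<alpha>"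
    "\<And>t. t < m1 \<Longrightarrow> cdf P.R t = cdf Q.R t \<and> cdf P.R t \<le> (1 - \<alpha>) / 2"
    "\<And>t. m1 \<le> t \<Longrightarrow> t < m2 \<Longrightarrow> cdf P.R t = (1 + \<alpha>) / 2 \<and> cdf Q.R t = (1 - \<alpha>) / 2"
    "\<And>t. m2 \<le> t \<Longrightarrow> cdf P.R t = cdf Q.R t \<and> (1 + \<alpha>) / 2 \<le> cdf P.R t"
    using cdf_folded_eq_cases[OF P.R Q.R folded_eq x0] by blast
  then have "two_on_line_ordered P Q a e m1 m2 \<alpha>" by unfold_locales
  then show ?thesis by (rule that(1))
next
  fix x0 assume x0: "cdf Q.R x0 > 1/2" "cdf P.R x0 < 1/2"
  obtain m1 m2 \<alpha> where m: "m1 < m2" "0 < \<alpha>"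
    "\<And>t. t < m1 \<Longrightarrow> cdf Q.R t = cdf P.R t \<and> cdf Q.R t \<le> (1 - \<alpha>) / 2"
    "\<And>t. m1 \<le> t \<Longrightarrow> t < m2 \<Longrightarrow> cdf Q.R t = (1 + \<alpha>) / 2 \<and> cdf P.R t = (1 - \<alpha>) / 2"
    "\<And>t. m2 \<le> t \<Longrightarrow> cdf Q.R t = cdf P.R t \<and> (1 + \<alpha>) / 2 \<le> cdf Q.R t"
    using cdf_folded_eq_cases[OF Q.R P.R folded_eq[symmetric] x0] by blast
  interpret S: two_on_line Q P a e by (rule swap)
  have "two_on_line_ordered Q P a e m1 m2 \<alpha>" using m by unfold_locales
  then show ?thesis by (rule that(2))
qed

end

section \<open>The zero space, the dimension hypotheses, and the assembly\<close>

lemma borel_prob_eq_if_trivial: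
  fixes P Q :: "'a::t1_space measure"
  assumes P: "borel_prob P" and Q: "borel_prob Q" and triv: "\<And>x y :: 'a. x = y"
  shows "P = Q"
proof (rule measure_eqI)
  show "sets P = sets Q" using P Q by (simp add: borel_prob_sets)
  fix A assume "A \<in> sets P"
  have "A = {} \<or> A = UNIV" using triv by (metis UNIV_eq_I all_not_in_conv)
  then show "emeasure P A = emeasure Q A"
    using prob_space.emeasure_space_1[OF borel_prob_prob_space[OF P]] prob_space.emeasure_space_1[OF borel_prob_prob_space[OF Q]]
    by (auto simp: borel_prob_space P Q)
qed

text \<open>Without a unit vector the empty set spans; without a unit vector orthogonal to
  \<open>e\<close>, each \<open>x\<close> is its own projection onto \<open>e\<close>, and
  \<open>{e}\<close> spans. Either contradicts the dimension.\<close>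

lemma space_dim_ge_2D:
  assumes "space_dim TYPE('a::real_inner) \<ge> 2"
  shows "\<exists>v::'a::real_inner. norm v = 1" "\<And>e::'a::real_inner. norm e = 1 \<Longrightarrow> \<exists>h. norm h = 1 \<and> inner h e = 0"
proof -
  have no: False if "finite B" "card B \<le> 1" "span B = (UNIV :: 'a set)" for B
  proof -
    have "dim (UNIV :: 'a set) \<le> card B" using that by (intro dim_le_card) auto
    then have "space_dim TYPE('a) \<le> enat 1" using that unfolding space_dim_def by auto
    then have "(2::enat) \<le> enat 1" using assms by (rule order_trans[rotated])
    then show False by (simp add: numeral_eq_enat)
  qed
  show "\<exists>v::'a. norm v = 1"
  proof (rule ccontr)
    assume n: "\<not> ?thesis"
    have "v = 0" for v :: 'a
    proof (rule ccontr)
      assume "v \<noteq> 0"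
      then have "norm (sgn v) = 1" by (simp add: norm_sgn)
      then show False using n by blast
    qed
    then have "span {} = (UNIV :: 'a set)" by (metis UNIV_eq_I span_zero)
    then show False using no[of "{}"] by simp
  qed
  fix e :: 'a assume e: "norm e = 1"
  show "\<exists>h. norm h = 1 \<and> inner h e = 0"
  proof (rule ccontr)
    assume n: "\<not> ?thesis"
    have "x = inner x e *\<^sub>R e" for x
    proof (rule ccontr)
      assume ne: "x \<noteq> inner x e *\<^sub>R e"
      define y where "y = x - inner x e *\<^sub>R e"
      have "y \<noteq> 0" using ne by (simp add: y_def)
      have "inner e e = 1" using e by (simp flip: power2_norm_eq_inner)
      then have "inner y e = 0" by (simp add: y_def inner_diff_left)
      then have "norm (sgn y) = 1 \<and> inner (sgn y) e = 0"
        using \<open>y \<noteq> 0\<close> by (simp add: norm_sgn) (simp add: sgn_div_norm)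
      then show False using n by blast
    qed
    then have "x \<in> span {e}" for x by (metis insertI1 span_base span_scale)
    then have "span {e} = UNIV" by auto
    then show False using no[of "{e}"] by simp
  qed
qed

lemma space_dim_eq_1D:
  assumes "space_dim TYPE('a::real_inner) = 1"
  obtains e :: "'a::real_inner" where "norm e = 1" "\<And>x. x = inner x e *\<^sub>R e"
proof -
  have d: "dim (UNIV :: 'a set) = 1" using assms unfolding space_dim_def by (auto simp: one_enat_def split: if_splits)
  obtain B :: "'a set" where B: "independent B" "UNIV \<subseteq> span B" "card B = dim (UNIV :: 'a set)"
    by (rule basis_exists[of UNIV]) auto
  then obtain b where b: "B = {b}" using d by (metis card_1_singletonE)
  have b0: "b \<noteq> 0" using B(1) b dependent_zero by blast
  have nb: "norm (sgn b) = 1" using b0 by (simp add: norm_sgn)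
  have "x = inner x (sgn b) *\<^sub>R sgn b" for x
  proof -
    have "x \<in> span {b}" using B(2) b by auto
    then obtain k where x: "x = k *\<^sub>R b" by (auto simp: span_singleton)
    have bs: "b = norm b *\<^sub>R sgn b" using b0 by (simp add: sgn_div_norm)
    have ss: "inner (sgn b) (sgn b) = 1" using nb by (simp flip: power2_norm_eq_inner)
    then have "inner b (sgn b) = norm b" by (subst bs) simp
    moreover have "k *\<^sub>R b = k *\<^sub>R (norm b *\<^sub>R sgn b)" using bs by (rule arg_cong)
    ultimately show ?thesis unfolding x by (simp add: ss)
  qed
  with that nb show ?thesis by blast
qed

theorem theorem1p2:
  fixes P Q :: "'a::{real_inner, banach, polish_space} measure"
  assumes "borel_prob P" and "borel_prob Q"
  shows
    "((\<forall>x. norm (spatial_df P x) = norm (spatial_df Q x)) \<longrightarrow> P = Q) \<and>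
     (\<forall>D :: 'a set.
        closure D = UNIV \<and> (\<forall>x\<in>D. norm (spatial_df P x) = norm (spatial_df Q x)) \<and>
        space_dim TYPE('a) \<ge> 2 \<and> P \<noteq> Q \<longrightarrow>
        (\<exists>mP mQ. \<exists>\<beta>\<in>{1/2<..1::real}. mP \<noteq> mQ \<and>
           (\<forall>B\<in>sets borel. measure P B =
              \<beta> * measure (return borel mP) B + (1 - \<beta>) * measure (return borel mQ) B) \<and>
           (\<forall>B\<in>sets borel. measure Q B =
              (1 - \<beta>) * measure (return borel mP) B + \<beta> * measure (return borel mQ) B))) \<and>
     (\<forall>D :: 'a set.
        closure D = UNIV \<and> (\<forall>x\<in>D. norm (spatial_df P x) = norm (spatial_df Q x)) \<and>
        space_dim TYPE('a) = 1 \<and> P \<noteq> Q \<longrightarrow>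
        (\<exists>mP mQ.
           (\<forall>m. spatial_median P m \<longleftrightarrow> m = mP) \<and>
           (\<forall>m. spatial_median Q m \<longleftrightarrow> m = mQ) \<and>
           (\<forall>B\<in>sets borel. B \<subseteq> UNIV - {mP, mQ} \<longrightarrow> measure P B = measure Q B) \<and>
           measure P (open_segment mP mQ) = 0 \<and> measure Q (open_segment mP mQ) = 0 \<and>
           measure P {mP} > 0 \<and> measure Q {mQ} > 0))"
proof (intro conjI allI impI)
  note P = assms(1) and Q = assms(2)
  assume eq: "\<forall>x. norm (spatial_df P x) = norm (spatial_df Q x)"
  show "P = Q"
  proof (cases "\<exists>v::'a. v \<noteq> 0")
    case True
    then obtain v :: 'a where v: "v \<noteq> 0" by blast
    then have sv: "norm (sgn v) = 1" by (simp add: norm_sgn)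
    \<comment> \<open>The norms agree at \<open>x\<close> itself, so the identity for sums of
      squares leaves equal masses and no point is exceptional.\<close>
    have "measure P {x} = measure Q {x}" for x
    proof -
      have "(norm (spatial_df P x))\<^sup>2 + (measure P {x})\<^sup>2 = (norm (spatial_df Q x))\<^sup>2 + (measure Q {x})\<^sup>2"
        by (rule directional_limit_identities(2)[OF dense_directional_limits[OF P Q closure_UNIV] sv]) (use eq in auto)
      then show ?thesis using eq by (simp add: power2_eq_iff_nonneg)
    qed
    then show ?thesis using eq v by (intro eq_if_no_exceptional_point[OF P Q]) auto
  next
    case False
    then have "x = y" for x y :: 'a by metis
    \<comment> \<open>The zero space has no direction to approach a point or to shift along, but
      also only one probability measure.\<close>
    then show ?thesis by (rule borel_prob_eq_if_trivial[OF P Q])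
  qed
next
  note P = assms(1) and Q = assms(2)
  fix D :: "'a set"
  assume "closure D = UNIV \<and> (\<forall>x\<in>D. norm (spatial_df P x) = norm (spatial_df Q x)) \<and>
    space_dim TYPE('a) \<ge> 2 \<and> P \<noteq> Q"
  then have D: "closure D = UNIV" "\<And>x. x \<in> D \<Longrightarrow> norm (spatial_df P x) = norm (spatial_df Q x)"
    and dim: "space_dim TYPE('a) \<ge> 2" and ne: "P \<noteq> Q" by auto
  note dir = dense_directional_limits[OF P Q D]
  obtain v :: 'a where v: "norm v = 1" using space_dim_ge_2D(1)[OF dim] by blast
  obtain a e where e: "norm (e::'a) = 1"
    "AE z in P. z = a + inner (z - a) e *\<^sub>R e" "AE z in Q. z = a + inner (z - a) e *\<^sub>R e"
    using eq_or_on_line[OF P Q v dir ne] by blast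
  obtain h where h: "norm h = 1" "inner h e = 0" using space_dim_ge_2D(2)[OF dim e(1)] by blast
  interpret two_on_line P Q a e using P Q e dir by unfold_locales
  have r: "measure (return borel x) B = indicator B x" if "B \<in> sets borel" for x :: 'a and B
    using that by (simp add: measure_return)
  show "\<exists>mP mQ. \<exists>\<beta>\<in>{1/2<..1::real}. mP \<noteq> mQ \<and>
      (\<forall>B\<in>sets borel. measure P B =
        \<beta> * measure (return borel mP) B + (1 - \<beta>) * measure (return borel mQ) B) \<and>
      (\<forall>B\<in>sets borel. measure Q B =
        (1 - \<beta>) * measure (return borel mP) B + \<beta> * measure (return borel mQ) B)"
  proof (rule ordered_cases[OF ne])
    fix m1 m2 \<alpha> assume "two_on_line_ordered P Q a e m1 m2 \<alpha>"
    then interpret O: two_on_line_ordered P Q a e m1 m2 \<alpha> .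
    show ?thesis
      by (rule exI[of _ "P.pt m1"], rule exI[of _ "P.pt m2"], rule bexI[OF _ O.two_point_measures(3)[OF h sets.empty_sets]])
        (use O.two_point_measures(1,2)[OF h] O.m12 in \<open>auto simp: r\<close>)
  next
    fix m1 m2 \<alpha> assume "two_on_line_ordered Q P a e m1 m2 \<alpha>"
    then interpret O: two_on_line_ordered Q P a e m1 m2 \<alpha> .
    \<comment> \<open>Here \<open>Q\<close> is the measure with the earlier crossing, so the heavier
      atom of \<open>P\<close> is the one at \<open>m2\<close>.\<close>
    show ?thesis
      by (rule exI[of _ "P.pt m2"], rule exI[of _ "P.pt m1"], rule bexI[OF _ O.two_point_measures(3)[OF h sets.empty_sets]])
        (use O.two_point_measures(1,2)[OF h] O.m12 in \<open>auto simp: r\<close>)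
  qed
next
  note P = assms(1) and Q = assms(2)
  fix D :: "'a set"
  assume "closure D = UNIV \<and> (\<forall>x\<in>D. norm (spatial_df P x) = norm (spatial_df Q x)) \<and>
    space_dim TYPE('a) = 1 \<and> P \<noteq> Q"
  then have D: "closure D = UNIV" "\<And>x. x \<in> D \<Longrightarrow> norm (spatial_df P x) = norm (spatial_df Q x)"
    and dim: "space_dim TYPE('a) = 1" and ne: "P \<noteq> Q" by auto
  obtain e :: 'a where e: "norm e = 1" and all: "\<And>x. x = inner x e *\<^sub>R e"
    using space_dim_eq_1D[OF dim] by blast
  \<comment> \<open>The space itself is a line, so \<open>eq_or_on_line\<close> is bypassed and the
    analysis on the line starts at once.\<close>
  have "AE z in M. z = 0 + inner (z - 0) e *\<^sub>R e" for M :: "'a measure" using all by simp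
  then interpret two_on_line P Q 0 e
    using P Q e dense_directional_limits[OF P Q D] by unfold_locales
  show "\<exists>mP mQ.
      (\<forall>m. spatial_median P m \<longleftrightarrow> m = mP) \<and>
      (\<forall>m. spatial_median Q m \<longleftrightarrow> m = mQ) \<and>
      (\<forall>B\<in>sets borel. B \<subseteq> UNIV - {mP, mQ} \<longrightarrow> measure P B = measure Q B) \<and>
      measure P (open_segment mP mQ) = 0 \<and> measure Q (open_segment mP mQ) = 0 \<and>
      measure P {mP} > 0 \<and> measure Q {mQ} > 0"
  proof (rule ordered_cases[OF ne])
    fix m1 m2 \<alpha> assume "two_on_line_ordered P Q 0 e m1 m2 \<alpha>"
    then interpret O: two_on_line_ordered P Q 0 e m1 m2 \<alpha> .
    have all': "x = P.pt (P.coord x)" for x using all[of x] by (simp add: P.pt_def P.coord_def)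
    have "measure P B = measure Q B" if "B \<in> sets borel" "B \<subseteq> UNIV - {P.pt m1, P.pt m2}" for B
    proof -
      have "P.pt m1 \<notin> B" "P.pt m2 \<notin> B" using that(2) by auto
      then show ?thesis using O.measure_diff[OF that(1)] by simp
    qed
    then show ?thesis
      using O.medians[OF all'] O.segment O.atoms
      by (intro exI[of _ "P.pt m1"] exI[of _ "P.pt m2"]) auto
  next
    fix m1 m2 \<alpha> assume "two_on_line_ordered Q P 0 e m1 m2 \<alpha>"
    then interpret O: two_on_line_ordered Q P 0 e m1 m2 \<alpha> .
    have all': "x = P.pt (P.coord x)" for x using all[of x] by (simp add: P.pt_def P.coord_def)
    have "measure P B = measure Q B" if "B \<in> sets borel" "B \<subseteq> UNIV - {P.pt m2, P.pt m1}" for B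
    proof -
      have "P.pt m1 \<notin> B" "P.pt m2 \<notin> B" using that(2) by auto
      then show ?thesis using O.measure_diff[OF that(1)] by simp
    qed
    then show ?thesis
      using O.medians[OF all'] O.segment O.atoms
      by (intro exI[of _ "P.pt m2"] exI[of _ "P.pt m1"]) (auto simp: open_segment_commute)
  qed
qed

end
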